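(* Let $\mu\in\mathbb{C}\setminus\{-1,-2,-3,\dots\}$ and $\nu\in\mathbb{R}$; for $i=3,4$ assume moreover that $\mu$ is a positive odd integer. Let $j\ge0$ if $i=1,2$ and $j\geq-\mu$ if $i=3,4$. (1) As $x\to0^+$: $\Lambda_{1,j}^{\mu,\nu}(x)=\frac{(\frac{\mu+\nu+2}{2})_j}{j!\,\Gamma(\frac{\mu+2}{2})\Gamma(\frac{\nu+2}{2})}+o(1)$; $\Lambda_{2,j}^{\mu,\nu}(x)=\frac{(\frac{\mu-|\nu|+2}{2})_j}{j!\,\Gamma(\frac{\mu+2}{2})}\times\begin{cases}2^{\nu-1}\Gamma(\frac\nu2)x^{-\nu}+o(x^{-\nu}),&\nu>0,\\ -\log(\frac x2)+o(\log(\frac x2)),&\nu=0,\\ \frac12\Gamma(-\frac\nu2)+o(1),&\nu<0;\end{cases}$ $\Lambda_{3,j}^{\mu,\nu}(x)=\frac{2^{\mu-1}\Gamma(\frac\mu2)(\frac{-\mu+\nu+2}{2})_{j+\mu}}{(j+\mu)!\,\Gamma(\frac{\nu+2}{2})}x^{-\mu}+o(x^{-\mu})$; $\Lambda_{4,j}^{\mu,\nu}(x)=\frac{\Gamma(\frac\mu2)(\frac{-\mu-|\nu|+2}{2})_{j+\mu}}{(j+\mu)!}\times\begin{cases}2^{\mu+\nu-2}\Gamma(\frac\nu2)x^{-\mu-\nu}+o(x^{-\mu-\nu}),&\nu>0,\\ -2^{\mu-1}x^{-\mu}\log(\frac x2)+o(x^{-\mu}\log(\frac x2)),&\nu=0,\\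 2^{\mu-2}\Gamma(-\frac\nu2)x^{-\mu}+o(x^{-\mu}),&\nu<0.\end{cases}$ (2) As $x\to\infty$: $\Lambda_{1,j}^{\mu,\nu}(x)=C_{1,j}^{\mu,\nu}x^{j-\frac{\nu+1}{2}}e^{x}(1+O(\frac1x))$, $\Lambda_{2,j}^{\mu,\nu}(x)=C_{2,j}^{\mu,\nu}x^{j-\frac{\nu+1}{2}}e^{-x}(1+O(\frac1x))$ with constants $C_{1,j}^{\mu,\nu},C_{2,j}^{\mu,\nu}\neq0$, and $\Lambda_{3,j}^{\mu,\nu}(x)=O(x^{j-\frac{\nu+1}{2}}e^{x})$, $\Lambda_{4,j}^{\mu,\nu}(x)=O(x^{j-\frac{\nu+1}{2}}e^{-x})$.
   Context: $(a)_n=a(a+1)\cdots(a+n-1)$ is the Pochhammer symbol. Normalized modified Bessel functions: $\widetilde I_\alpha(z)=(z/2)^{-\alpha}I_\alpha(z)=\sum_{n\ge0}\frac{(z/2)^{2n}}{n!\Gamma(n+\alpha+1)}$, $\widetilde K_\alpha(z)=(z/2)^{-\alpha}K_\alpha(z)$. For $x>0$ and $t$ near $0$ (principal branch of $(1-t)^{-s}$), define $G_1^{\mu,\nu}=(1-t)^{-\frac{\mu+\nu+2}{2}}\widetilde I_{\mu/2}(\tfrac{tx}{1-t})\widetilde I_{\nu/2}(\tfrac{x}{1-t})$, $G_2^{\mu,\nu}=(1-t)^{-\frac{\mu+\nu+2}{2}}\widetilde I_{\mu/2}(\tfrac{tx}{1-t})\widetilde K_{\nu/2}(\tfrac{x}{1-t})$,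 $G_3^{\mu,\nu}=(1-t)^{-\frac{\mu+\nu+2}{2}}\widetilde K_{\mu/2}(\tfrac{tx}{1-t})\widetilde I_{\nu/2}(\tfrac{x}{1-t})$, $G_4^{\mu,\nu}=(1-t)^{-\frac{\mu+\nu+2}{2}}\widetilde K_{\mu/2}(\tfrac{tx}{1-t})\widetilde K_{\nu/2}(\tfrac{x}{1-t})$. $G_1,G_2$ are holomorphic in $t$ near $0$; when $\mu$ is an odd integer, $G_3,G_4$ are meromorphic at $t=0$. The functions $\Lambda_{i,j}^{\mu,\nu}$ on $\mathbb{R}_+$ ($j\in\mathbb{Z}$) are defined by the Taylor/Laurent expansions $G_i^{\mu,\nu}(t,x)=\sum_{j\in\mathbb{Z}}t^j\Lambda_{i,j}^{\mu,\nu}(x)$ (for $i=3,4$ only when $\mu$ is an odd integer). Thus $\Lambda_{1,j}=\Lambda_{2,j}=0$ for $j<0$ and, for $\mu$ a positive odd integer, $\Lambda_{3,j}=\Lambda_{4,j}=0$ for $j<-\mu$.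
   Formalization: In (1) for i=2,4, "constant × (main term + o(·))" is proved as "constant × main term + o(·)"; this differs only when the Pochhammer constant is zero, where the literal form fails (e.g. μ=1, ν=3, j=1: Λ_2 is a nonzero multiple of e^{-x}/x). *)

theory Defs
  imports "HOL-Analysis.Analysis" "HOL-Library.Landau_Symbols"
begin

text \<open>Normalized modified Bessel function of the first kind:
  Itilde a z = sum_n (z/2)^(2n) / (n! Gamma(n+a+1)), with 1/Gamma written as rGamma
  (entire; equals 0 at the poles of Gamma).\<close>
definition Itilde :: "complex \<Rightarrow> complex \<Rightarrow> complex" where
  "Itilde a z = (\<Sum>n. (z / 2) ^ (2 * n) * rGamma (of_nat n + a + 1) / fact n)"

definition besselI :: "complex \<Rightarrow> complex \<Rightarrow> complex" where
  "besselI a z = (z / 2) powr a * Itilde a z"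

definition besselK_aux :: "complex \<Rightarrow> complex \<Rightarrow> complex" where
  "besselK_aux b z = of_real pi / 2 * (besselI (- b) z - besselI b z) / sin (b * of_real pi)"

definition besselK :: "complex \<Rightarrow> complex \<Rightarrow> complex" where
  "besselK a z = (if a \<in> \<int> then Lim (at a) (\<lambda>b. besselK_aux b z) else besselK_aux a z)"

definition Ktilde :: "complex \<Rightarrow> complex \<Rightarrow> complex" where
  "Ktilde a z = (z / 2) powr (- a) * besselK a z"

definition Gfun :: "nat \<Rightarrow> complex \<Rightarrow> real \<Rightarrow> complex \<Rightarrow> real \<Rightarrow> complex" where
  "Gfun i \<mu> \<nu> t x =
     (let pre = (1 - t) powr (- ((\<mu> + of_real \<nu> + 2) / 2));
          u = t * of_real x / (1 - t);
          v = of_real x / (1 - t)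
      in if i = 1 then pre * Itilde (\<mu> / 2) u * Itilde (of_real \<nu> / 2) v
         else if i = 2 then pre * Itilde (\<mu> / 2) u * Ktilde (of_real \<nu> / 2) v
         else if i = 3 then pre * Ktilde (\<mu> / 2) u * Itilde (of_real \<nu> / 2) v
         else pre * Ktilde (\<mu> / 2) u * Ktilde (of_real \<nu> / 2) v)"

text \<open>Coefficients of the (Taylor/)Laurent expansion at 0 of a function with at most a pole
  at 0: the unique c :: int => complex, vanishing below some -N, such that
  f t = sum_{j >= -N} c j t^j on a punctured disc around 0.\<close>
definition laurent_coeff :: "(complex \<Rightarrow> complex) \<Rightarrow> int \<Rightarrow> complex" where
  "laurent_coeff f = (THE c. \<exists>N::nat. \<exists>r>0. (\<forall>j < - int N. c j = 0) \<and>
      (\<forall>t. 0 < norm t \<and> norm t < r \<longrightarrow>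
         (\<lambda>n. c (int n - int N) * t powi (int n - int N)) sums f t))"

definition Lambda :: "nat \<Rightarrow> complex \<Rightarrow> real \<Rightarrow> int \<Rightarrow> real \<Rightarrow> complex" where
  "Lambda i \<mu> \<nu> j x = laurent_coeff (\<lambda>t. Gfun i \<mu> \<nu> t x) j"

end

theory Submission
  imports Defs "HOL-Complex_Analysis.Complex_Analysis" "HOL-Real_Asymp.Real_Asymp"
begin

text \<open>
In the variable $w = (z/2)^2$ the normalized functions become $\hat I_a(w) = \sum_n w^n/(n!\,\Gamma(n+a+1))$
and $\hat K_a(w) = \frac12\int_{-\infty}^\infty \exp(-e^u - w e^{-u} - a u)\,du$, with
$\hat I_a' = \hat I_{a+1}$ and $\hat K_a' = -\hat K_{a+1}$. The integral is identified with the
definition of $K$ through the Wronskians of $\hat K_a$ with both series; since it is continuous in $a$, it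
also computes the limit that defines $K$ at integer order.

Expanding around $w_0 = x^2/4$, the coefficient of $t^j$ in $G_1$ or $G_2$ is a finite sum
$\sum_{n,k} c_{n,k}\, w_0^{n+k}\, \hat F_{\nu/2+k}(w_0)$ in which $c_{n,k} = 0$ for $2n+k > j$. As $x \to 0$ only $n = 0$
contributes. As $x \to \infty$ only $2n+k = j$ contributes, and these terms add up to
a coefficient of $e^{\pm 2s}\hat I_{\mu/2}(s^2)$, which is nonzero by a two-term recurrence. For odd $\mu = m$ the
functions $G_3, G_4$ are combinations of $t^{-m} G_i^{-m,\nu}$ and $G_i^{m,\nu}$, $i = 1, 2$.

The asymptotics of $K_a(x)$ follow from those of $K_{1/2}$ because $K_a$ is monotone in $|a|$ and satisfies a three-term
recurrence; those of $I_a(x)$ follow from $I_{a+1} \le I_a$ ($a \ge 0$) and the Wronskian.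
\<close>

section \<open>The Macdonald function as an integral\<close>

text \<open>The variable w removes the power (z/2)^a, and with it the branch cut, from both
  functions. A derivative in w is then exactly a shift of the order by one, with no lower-order
  term, so all Taylor coefficients at w0 stay within the same family. At integer order the formula
  for K has the form 0/0 and the definition offers only a limit. An integral that is continuous in
  the order supplies this limit without differentiating the series in the order. At the other orders
  the two Wronskians are read as a linear system for \<open>Khat a\<close> and
  \<open>Khat (a + 1)\<close>, whose determinant is the Wronskian of the two series. For i = 3, 4
  only an upper bound holds at infinity. These functions are built from \<mu> = -m, where the
  recurrence for the leading constants contains the factor 2j - m + 1; it is 0 at j = (m - 1)/2, and
  the constants can vanish.\<close>

definition Kker :: "complex \<Rightarrow> complex \<Rightarrow> real \<Rightarrow> complex" where
  "Kker a w u = exp (- of_real (exp u) - w * of_real (exp (- u)) - a * of_real u)"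

text \<open>With \<open>\<tau> = exp u\<close> this is half the integral of
  \<open>exp (- \<tau> - w / \<tau>) * \<tau> powr (- a - 1)\<close> over \<tau> > 0, the classical
  representation of (z/2)^(-a) K_a(z) at w = (z/2)^2. In the variable u, a factor
  \<open>exp (- u)\<close> or \<open>exp u\<close> is a shift of the order by one.\<close>

definition Khat :: "complex \<Rightarrow> complex \<Rightarrow> complex" where
  "Khat a w = (\<integral>u. Kker a w u \<partial>lborel) / 2"

lemma norm_Kker: "norm (Kker a w u) = exp (- exp u - Re w * exp (- u) - Re a * u)"
  by (simp add: Kker_def)

lemma continuous_Kker [continuous_intros]: "continuous_on A (Kker a w)"
  unfolding Kker_def by (intro continuous_intros)

lemma measurable_Kker [measurable]: "Kker a w \<in> borel_measurable borel"
  by (intro borel_measurable_continuous_onI continuous_intros)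

text \<open>At w = 0 the substitution t = exp u turns Euler's integral for
  \<open>Gamma (- a)\<close> into the integral of the kernel; Re a < 0 is Euler's convergence
  condition.\<close>

lemma
  assumes "Re a < 0"
  shows integrable_Kker_0: "integrable lborel (Kker a 0)"
    and integral_Kker_0: "(\<integral>u. Kker a 0 u \<partial>lborel) = Gamma (- a)"
proof -
  define f where "f = (\<lambda>t. complex_of_real t powr (- a - 1) / of_real (exp t))"
  have Re: "Re (- a) > 0" using assms by simp
  have fK: "exp u *\<^sub>R f (exp u) = Kker a 0 u" for u
  proof -
    have "Ln (complex_of_real (exp u)) = of_real u"
      by (subst Ln_of_real) auto
    thus ?thesis
      by (simp add: f_def Kker_def scaleR_conv_of_real powr_def exp_diff exp_minus
        field_simps exp_add exp_of_real)
  qed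
  have f_int: "f absolutely_integrable_on {0<..}"
    using absolutely_integrable_Gamma_integral'[OF Re] by (simp add: f_def)
  have cont: "continuous_on {0<..} f"
    unfolding f_def by (intro continuous_intros) auto
  have f_int2: "set_integrable lborel {0<..} f"
  proof -
    have "(\<lambda>x. indicator {0<..} x *\<^sub>R f x) \<in> borel_measurable borel"
      using cont by (intro borel_measurable_continuous_on_indicator) auto
    thus ?thesis
      using f_int unfolding set_integrable_def
      by (subst (asm) integrable_completion) auto
  qed
  have rng: "range (exp :: real \<Rightarrow> real) = {0<..}"
  proof safe
    fix y :: real assume "y > 0"
    thus "y \<in> range exp" by (intro image_eqI[of _ _ "ln y"]) auto
  qed auto
  \<comment> \<open>The substitution rule for interval integrals asks for integrability on both
    sides, so integrability is obtained beforehand from the change of variables for absolutely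
    integrable functions.\<close>
  have "(\<lambda>u. \<bar>exp u\<bar> *\<^sub>R f (exp u)) absolutely_integrable_on UNIV"
    using f_int
    by (subst absolutely_integrable_change_of_variables_real[where g = exp, symmetric])
       (auto simp: rng inj_on_def intro!: derivative_eq_intros)
  hence "integrable lebesgue (Kker a 0)"
    by (simp add: fK set_integrable_def)
  thus int: "integrable lborel (Kker a 0)"
    by (subst (asm) integrable_completion) auto
  have "(LBINT x=0..\<infinity>. f x) = (LBINT u=-\<infinity>..\<infinity>. exp u *\<^sub>R f (exp u))"
  proof (rule interval_integral_substitution_integrable)
    show "isCont f (exp x)" for x
      using cont by (auto simp: continuous_on_eq_continuous_at)
    show "((ereal \<circ> exp \<circ> real_of_ereal) \<longlongrightarrow> 0) (at_right (- \<infinity>))"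
      unfolding zero_ereal_def ereal_tendsto_simps by (rule exp_at_bot)
    show "((ereal \<circ> exp \<circ> real_of_ereal) \<longlongrightarrow> \<infinity>) (at_left \<infinity>)"
      unfolding ereal_tendsto_simps by (rule exp_at_top)
    show "set_integrable lborel (einterval 0 \<infinity>) f"
      using f_int2 by (simp add: einterval_def greaterThan_def)
    show "set_integrable lborel (einterval (-\<infinity>) \<infinity>) (\<lambda>x. exp x *\<^sub>R f (exp x))"
      using int by (simp add: fK set_integrable_def einterval_def)
  qed (auto intro!: derivative_eq_intros)
  also have "\<dots> = (\<integral>u. Kker a 0 u \<partial>lborel)"
    by (simp add: fK interval_lebesgue_integral_def set_lebesgue_integral_def)
  also have "(LBINT x=0..\<infinity>. f x) = (LBINT x:{0<..}. f x)"
    by (simp add: interval_lebesgue_integral_def einterval_def greaterThan_def)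
  also have "\<dots> = integral {0<..} f"
    by (rule set_borel_integral_eq_integral(2)[OF f_int2])
  also have "\<dots> = Gamma (- a)"
    using Gamma_integral_complex'[OF Re] by (simp add: f_def integral_unique)
  finally show "(\<integral>u. Kker a 0 u \<partial>lborel) = Gamma (- a)" ..
qed

lemma exp_neg_le_power:
  fixes y :: real
  assumes "y > 0"
  shows "exp (- y) \<le> fact n / y ^ n"
proof -
  have "y ^ n / fact n \<le> exp y"
    using sum_le_suminf[of "\<lambda>k. y ^ k /\<^sub>R fact k" "{n}"] assms summable_exp_generic[of y]
    by (simp add: exp_def field_simps)
  thus ?thesis using assms by (simp add: exp_minus field_simps)
qed

text \<open>The factor \<open>exp (- Re w * exp (- u))\<close> decays faster than any power of
  \<open>exp u\<close> as u tends to -infinity. Spending n powers of it lowers the order to a - n,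
  where the kernel at w = 0 is integrable as soon as n > Re a.\<close>

lemma integrable_Kker:
  assumes "Re w > 0"
  shows "integrable lborel (Kker a w)"
proof -
  obtain n :: nat where n: "real n > Re a" using reals_Archimedean2 by blast
  let ?C = "fact n / Re w ^ n"
  show ?thesis
  proof (rule Bochner_Integration.integrable_bound)
    show "integrable lborel (\<lambda>u. ?C * norm (Kker (a - of_nat n) 0 u))"
      using n by (intro integrable_mult_right integrable_norm integrable_Kker_0) auto
    show "AE u in lborel. norm (Kker a w u) \<le> norm (?C * norm (Kker (a - of_nat n) 0 u))"
    proof (rule AE_I2)
      fix u
      have "norm (Kker a w u) = exp (- (Re w * exp (- u))) * exp (- exp u - Re a * u)"
        by (simp add: norm_Kker flip: exp_add)
      also have "\<dots> \<le> (fact n / (Re w * exp (- u)) ^ n) * exp (- exp u - Re a * u)"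
        using assms by (intro mult_right_mono exp_neg_le_power) auto
      also have "\<dots> = ?C * (exp (n * u) * exp (- exp u - Re a * u))"
        by (simp add: power_mult_distrib exp_minus exp_of_nat_mult power_inverse divide_inverse)
      also have "exp (n * u) * exp (- exp u - Re a * u) = norm (Kker (a - of_nat n) 0 u)"
        by (simp add: norm_Kker algebra_simps flip: exp_add)
      finally show "norm (Kker a w u) \<le> norm (?C * norm (Kker (a - of_nat n) 0 u))"
        using abs_ge_self[of "?C * norm (Kker (a - of_nat n) 0 u)"]
        unfolding real_norm_def by (rule order_trans)
    qed
  qed auto
qed

lemma Kker_shift: "Kker a w u * of_real (exp (- u)) = Kker (a + 1) w u"
  by (simp add: Kker_def exp_of_real[symmetric] exp_add[symmetric] ring_distribs diff_diff_eq add_ac del: exp_of_real)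

lemma Kker_shift': "Kker a w u * of_real (exp u) = Kker (a - 1) w u"
  by (simp add: Kker_def exp_of_real[symmetric] exp_add[symmetric] algebra_simps del: exp_of_real)

text \<open>The kernel tends to 0 at both ends, so its u-derivative integrates to 0; that derivative
  is the combination \<open>g\<close> of three neighbouring orders.\<close>

lemma Khat_rec:
  assumes "Re w > 0"
  shows "Khat (a - 1) w = w * Khat (a + 1) w - a * Khat a w"
proof -
  define g where "g = (\<lambda>u. w * Kker (a + 1) w u - Kker (a - 1) w u - a * Kker a w u)"
  have g_int: "integrable lborel g"
    unfolding g_def using assms by (intro Bochner_Integration.integrable_diff integrable_mult_right integrable_Kker)
  have "(LBINT u=-\<infinity>..\<infinity>. g u) = 0 - 0"
  proof (rule interval_integral_FTC_integrable)
    show "(Kker a w has_vector_derivative g u) (at u)" for u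
    proof -
      have "((\<lambda>z. exp (- exp z - w * exp (- z) - a * z)) has_field_derivative
              (- exp z + w * exp (- z) - a) * exp (- exp z - w * exp (- z) - a * z)) (at z)" for z
        by (auto intro!: derivative_eq_intros simp: algebra_simps)
      from has_vector_derivative_real_field[OF this[of "of_real u"]]
      have "(Kker a w has_vector_derivative (- exp (of_real u) + w * exp (- of_real u) - a) * Kker a w u) (at u)"
        by (simp add: Kker_def[abs_def] exp_of_real[symmetric])
      also have "(- exp (of_real u) + w * exp (- of_real u) - a) * Kker a w u = g u"
        unfolding g_def Kker_shift[symmetric] Kker_shift'[symmetric]
        by (simp add: exp_of_real[symmetric] algebra_simps)
      finally show ?thesis .
    qed
    show "isCont g u" for u
      unfolding g_def Kker_def by (intro continuous_intros)
    show "set_integrable lborel (einterval (-\<infinity>) \<infinity>) g"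
      using g_int by (simp add: set_integrable_def einterval_def)
    show "((Kker a w \<circ> real_of_ereal) \<longlongrightarrow> 0) (at_right (- \<infinity>))"
      unfolding ereal_tendsto_simps
      by (rule tendsto_norm_zero_cancel, unfold norm_Kker) (use assms in real_asymp)
    show "((Kker a w \<circ> real_of_ereal) \<longlongrightarrow> 0) (at_left \<infinity>)"
      unfolding ereal_tendsto_simps
      by (rule tendsto_norm_zero_cancel, unfold norm_Kker) (use assms in real_asymp)
  qed auto
  hence "(\<integral>u. g u \<partial>lborel) = 0"
    by (simp add: interval_lebesgue_integral_def set_lebesgue_integral_def)
  also have "(\<integral>u. g u \<partial>lborel) = w * (\<integral>u. Kker (a + 1) w u \<partial>lborel)
      - (\<integral>u. Kker (a - 1) w u \<partial>lborel) - a * (\<integral>u. Kker a w u \<partial>lborel)"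
    unfolding g_def using assms by (simp add: integrable_Kker)
  finally show ?thesis
    by (simp add: Khat_def algebra_simps)
qed

text \<open>The reflection \<open>u \<mapsto> ln w - u\<close> interchanges the two exponentials of
  the kernel. For complex w it would move the path off the real line.\<close>

lemma Khat_sym:
  assumes "w > 0"
  shows "Khat (- a) (of_real w) = of_real w powr a * Khat a (of_real w)"
proof -
  have "(\<integral>u. Kker (-a) (of_real w) u \<partial>lborel) = \<bar>- 1\<bar> *\<^sub>R (\<integral>u. Kker (-a) (of_real w) (ln w + (- 1) * u) \<partial>lborel)"
    by (rule lborel_integral_real_affine) auto
  also have "(\<lambda>u. Kker (-a) (of_real w) (ln w + (- 1) * u)) = (\<lambda>u. of_real w powr a * Kker a (of_real w) u)"
  proof
    fix u
    have "exp (ln w - u) = w * exp (- u)" "w * exp (u - ln w) = exp u"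
      using assms by (simp_all add: exp_diff exp_minus divide_inverse)
    hence "Kker (-a) (of_real w) (ln w + (- 1) * u) = exp (- of_real (w * exp (- u)) - of_real (exp u) + a * of_real (ln w - u))"
      unfolding Kker_def by (simp del: exp_of_real flip: of_real_mult)
    also have "\<dots> = of_real w powr a * Kker a (of_real w) u"
      using assms by (simp add: Kker_def powr_def Ln_of_real algebra_simps flip: exp_add)
    finally show "Kker (-a) (of_real w) (ln w + (- 1) * u) = of_real w powr a * Kker a (of_real w) u" .
  qed
  finally show ?thesis by (simp add: Khat_def)
qed


text \<open>Differentiation under the integral with an explicit quadratic remainder. With q = exp (-
  u), the remainder of \<open>exp (- h * q)\<close> costs q^2, which raises the order by two, and
  \<open>exp (norm h * q)\<close>, which is absorbed by lowering w by r. The choice r = Re w / 2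
  keeps w - r in the half-plane.\<close>

lemma Khat_has_field_derivative:
  assumes "Re w > 0"
  shows "(Khat a has_field_derivative - Khat (a + 1) w) (at w)"
proof -
  define r where "r = Re w / 2"
  define M where "M = (\<integral>u. norm (Kker (a + 1 + 1) (w - of_real r) u) \<partial>lborel) / 2"
  have r: "r > 0" "Re (w - of_real r) > 0" using assms by (auto simp: r_def)
  have bnd: "norm ((Khat a (w + h) - Khat a w) / h + Khat (a + 1) w) \<le> M * norm h"
    if h: "norm h < r" "h \<noteq> 0" for h
  proof -
    have Re: "Re (w + h) > 0" using h(1) abs_Re_le_cmod[of h] r by (simp add: r_def)
    have pt: "norm (Kker a (w + h) u - Kker a w u + h * Kker (a + 1) w u) \<le> 
                 norm h ^ 2 * norm (Kker (a + 1 + 1) (w - of_real r) u)" for u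
    proof -
      define q where "q = exp (- u)"
      have q: "q > 0" by (simp add: q_def)
      have "Kker a (w + h) u - Kker a w u + h * Kker (a + 1) w u =
              Kker a w u * (exp (- h * q) - (1 + (- h * q)))"
        unfolding Kker_shift[symmetric]
        by (simp add: Kker_def q_def algebra_simps flip: exp_add)
      also have "norm \<dots> \<le> norm (Kker a w u) * (exp (norm (- h * q)) * (norm (- h * q))\<^sup>2)"
      proof -
        have "norm (exp (- h * q) - (\<Sum>k\<le>1. (- h * q) ^ k / fact k)) \<le> exp \<bar>Re (- h * q)\<bar> * norm (- h * q) ^ Suc 1 / fact 1"
          by (rule Taylor_exp)
        also have "\<dots> \<le> exp (norm (- h * q)) * (norm (- h * q))\<^sup>2"
          using abs_Re_le_cmod[of "- h * q"] by (simp add: power2_eq_square mult_right_mono)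
        finally show ?thesis unfolding norm_mult[of "Kker a w u"] by (intro mult_left_mono) auto
      qed
      also have "\<dots> = norm h ^ 2 * (norm (Kker a w u) * q * q * exp (norm h * q))"
        using q by (simp add: norm_mult power2_eq_square)
      also have "\<dots> \<le> norm h ^ 2 * (norm (Kker a w u) * q * q * exp (r * q))"
        using h q by (intro mult_left_mono) (auto intro!: mult_right_mono)
      also have "norm (Kker a w u) * q * q * exp (r * q) = norm (Kker (a + 1 + 1) (w - of_real r) u)"
        unfolding Kker_shift[symmetric] using q
        by (simp add: norm_Kker norm_mult q_def algebra_simps flip: exp_add)
      finally show ?thesis .
    qed
    have int: "integrable lborel (Kker a (w + h))" "integrable lborel (Kker a w)"
      "integrable lborel (Kker (a + 1) w)" "integrable lborel (Kker (a + 1 + 1) (w - of_real r))"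
      using Re assms r by (auto intro: integrable_Kker)
    have "norm (Khat a (w + h) - Khat a w + h * Khat (a + 1) w) =
       norm (\<integral>u. Kker a (w + h) u - Kker a w u + h * Kker (a + 1) w u \<partial>lborel) / 2"
      using int by (simp add: Khat_def norm_divide flip: diff_divide_distrib add_divide_distrib)
    also have "\<dots> \<le> (\<integral>u. norm h ^ 2 * norm (Kker (a + 1 + 1) (w - of_real r) u) \<partial>lborel) / 2"
      using int pt by (intro divide_right_mono Bochner_Integration.integral_norm_bound_integral) auto
    also have "\<dots> = norm h ^ 2 * M" by (simp add: M_def)
    finally have "norm (Khat a (w + h) - Khat a w + h * Khat (a + 1) w) \<le> norm h ^ 2 * M" .
    moreover have "(Khat a (w + h) - Khat a w) / h + Khat (a + 1) w = 
         (Khat a (w + h) - Khat a w + h * Khat (a + 1) w) / h" using h by (simp add: field_simps)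
    ultimately show ?thesis using h by (simp add: norm_divide field_simps power2_eq_square)
  qed
  have "((\<lambda>h. (Khat a (w + h) - Khat a w) / h + Khat (a + 1) w) \<longlongrightarrow> 0) (at 0)"
  proof (rule Lim_null_comparison)
    show "\<forall>\<^sub>F h in at 0. norm ((Khat a (w + h) - Khat a w) / h + Khat (a + 1) w) \<le> M * norm h"
      using bnd r by (auto simp: eventually_at intro!: exI[of _ r])
    show "((\<lambda>h. M * norm (h::complex)) \<longlongrightarrow> 0) (at 0)"
      by (auto intro!: tendsto_eq_intros)
  qed
  from tendsto_add[OF this tendsto_const[of "- Khat (a + 1) w"]] show ?thesis
    by (simp add: DERIV_def)
qed

lemma Khat_holomorphic: "Khat a holomorphic_on {w. Re w > 0}"
  by (rule holomorphic_onI, rule field_differentiable_at_within)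
     (auto simp: field_differentiable_def intro: Khat_has_field_derivative)

text \<open>Along a convergent sequence the orders are bounded by some B, and
  \<open>exp (- Re b * u)\<close> is at most the sum of its values for the orders B and -B, whatever
  the sign of u. This continuity yields K at integer order.\<close>

lemma isCont_Khat_order:
  assumes "Re w > 0"
  shows "isCont (\<lambda>b. Khat b w) a"
proof (rule continuous_at_sequentiallyI)
  fix b :: "nat \<Rightarrow> complex" assume b: "b \<longlonglongrightarrow> a"
  then obtain B where B: "\<And>n. norm (b n) \<le> B"
    using convergent_imp_Bseq[of b] unfolding convergent_def Bseq_def by blast
  have "(\<lambda>n. \<integral>u. Kker (b n) w u \<partial>lborel) \<longlonglongrightarrow> (\<integral>u. Kker a w u \<partial>lborel)"
  proof (rule integral_dominated_convergence)
    show "integrable lborel (\<lambda>u. norm (Kker (of_real B) w u) + norm (Kker (- of_real B) w u))"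
      using assms by (intro Bochner_Integration.integrable_add integrable_norm integrable_Kker)
    show "AE u in lborel. (\<lambda>n. Kker (b n) w u) \<longlonglongrightarrow> Kker a w u"
      unfolding Kker_def using b by (intro AE_I2 tendsto_intros)
    show "AE u in lborel. norm (Kker (b n) w u) \<le> 
            norm (Kker (of_real B) w u) + norm (Kker (- of_real B) w u)" for n
    proof (rule AE_I2)
      fix u
      have "\<bar>Re (b n)\<bar> \<le> B" using abs_Re_le_cmod[of "b n"] B[of n] by linarith
      hence "\<bar>Re (b n) * u\<bar> \<le> B * \<bar>u\<bar>" by (simp add: abs_mult mult_right_mono)
      hence "- (Re (b n) * u) \<le> - (B * u) \<or> - (Re (b n) * u) \<le> B * u"
        by (cases "u \<ge> 0") (simp_all add: abs_le_iff)
      thus "norm (Kker (b n) w u) \<le> norm (Kker (of_real B) w u) + norm (Kker (- of_real B) w u)"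
        unfolding norm_Kker by (auto intro: add_increasing add_increasing2)
    qed
  qed auto
  thus "(\<lambda>n. Khat (b n) w) \<longlonglongrightarrow> Khat a w"
    unfolding Khat_def by (intro tendsto_intros) auto
qed

lemma Khat_tendsto_0:
  assumes "Re a < 0"
  shows "((\<lambda>w. Khat a (of_real w)) \<longlongrightarrow> Gamma (- a) / 2) (at_right 0)"
  unfolding tendsto_at_iff_sequentially
proof safe
  fix X :: "nat \<Rightarrow> real" assume X: "\<forall>i. X i \<in> {0<..} - {0}" "X \<longlonglongrightarrow> 0"
  have "(\<lambda>n. \<integral>u. Kker a (of_real (X n)) u \<partial>lborel) \<longlonglongrightarrow> (\<integral>u. Kker a (of_real 0) u \<partial>lborel)"
  proof (rule integral_dominated_convergence)
    show "integrable lborel (\<lambda>u. norm (Kker a 0 u))"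
      using assms by (intro integrable_norm integrable_Kker_0)
    show "AE u in lborel. (\<lambda>n. Kker a (of_real (X n)) u) \<longlonglongrightarrow> Kker a (of_real 0) u"
      unfolding Kker_def using X by (intro AE_I2 tendsto_intros)
    show "AE u in lborel. norm (Kker a (of_real (X n)) u) \<le> norm (Kker a 0 u)" for n
      using X by (intro AE_I2) (auto simp: norm_Kker less_imp_le)
  qed auto
  thus "((\<lambda>w. Khat a (of_real w)) \<circ> X) \<longlonglongrightarrow> Gamma (- a) / 2"
    unfolding Khat_def o_def using integral_Kker_0[OF assms] by (intro tendsto_intros) auto
qed

text \<open>Since \<open>y * exp (- y) \<le> 1\<close> for y = w exp (- u), multiplication by w
  gains a factor exp u: w times the kernel of order a is dominated by the kernel of order a - 1 at w
  = 0, which is integrable for Re a < 1.\<close>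

lemma Khat_tendsto_0':
  assumes "Re a < 1"
  shows "((\<lambda>w. of_real w * Khat a (of_real w)) \<longlongrightarrow> 0) (at_right 0)"
  unfolding tendsto_at_iff_sequentially
proof safe
  fix X :: "nat \<Rightarrow> real" assume X: "\<forall>i. X i \<in> {0<..} - {0}" "X \<longlonglongrightarrow> 0"
  have "(\<lambda>n. \<integral>u. of_real (X n) * Kker a (of_real (X n)) u \<partial>lborel) \<longlonglongrightarrow> (\<integral>u. 0 \<partial>(lborel :: real measure))"
  proof (rule integral_dominated_convergence)
    show "integrable lborel (\<lambda>u. norm (Kker (a - 1) 0 u))"
      using assms by (intro integrable_norm integrable_Kker_0) auto
    have "(\<lambda>n. of_real (X n) * Kker a (of_real (X n)) u) \<longlonglongrightarrow> of_real 0 * Kker a (of_real 0) u" for u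
      unfolding Kker_def using X by (intro tendsto_intros)
    thus "AE u in lborel. (\<lambda>n. of_real (X n) * Kker a (of_real (X n)) u) \<longlonglongrightarrow> 0"
      by simp
    show "AE u in lborel. norm (of_real (X n) * Kker a (of_real (X n)) u) \<le> norm (Kker (a - 1) 0 u)" for n
    proof (rule AE_I2)
      fix u
      have Xn: "X n > 0" using X by auto
      have "norm (of_real (X n) * Kker a (of_real (X n)) u) = 
         ((X n * exp (-u)) * exp (- (X n * exp (- u)))) * exp (- exp u - (Re a - 1) * u)"
        using Xn by (simp add: norm_mult norm_Kker algebra_simps flip: exp_add)
      also have "(X n * exp (-u)) * exp (- (X n * exp (- u))) \<le> 1"
        using exp_ge_add_one_self[of "X n * exp (-u)"] Xn
        by (simp add: exp_minus[of "_ * _"] field_simps del: exp_ge_add_one_self)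
      finally show "norm (of_real (X n) * Kker a (of_real (X n)) u) \<le> norm (Kker (a - 1) 0 u)"
        by (simp add: norm_Kker)
    qed
  qed auto
  thus "((\<lambda>w. of_real w * Khat a (of_real w)) \<circ> X) \<longlonglongrightarrow> 0"
    unfolding Khat_def o_def by (simp add: tendsto_divide_zero)
qed

section \<open>The power series and the Wronskians\<close>

definition Ihat :: "complex \<Rightarrow> complex \<Rightarrow> complex" where
  "Ihat a w = (\<Sum>n. (rGamma (of_nat n + a + 1) / fact n) * w ^ n)"

lemma Itilde_conv_Ihat: "Itilde a z = Ihat a ((z / 2)\<^sup>2)"
  unfolding Itilde_def Ihat_def by (simp only: power_mult) (simp add: mult_ac)

text \<open>Each coefficient is expressed through the next one by
  \<open>rGamma z = z * rGamma (z + 1)\<close>, which holds at the zeros of rGamma as well. N is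
  chosen so that \<open>norm z \<ge> 2 * norm w\<close> from there on, which gives the ratio
  1/2.\<close>

lemma summable_Ihat: "summable (\<lambda>n. (rGamma (of_nat n + a + 1) / fact n) * (w::complex) ^ n)"
proof -
  define f where "f = (\<lambda>n. (rGamma (of_nat n + a + 1) / fact n) * w ^ n)"
  obtain N :: nat where N: "real N \<ge> 1 + norm a + 2 * norm w" using real_arch_simple by blast
  have "summable f"
  proof (rule summable_ratio_test)
    show "(1/2 :: real) < 1" by simp
    fix n assume n: "n \<ge> N"
    define z where "z = of_nat n + a + 1"
    have "real n \<le> norm z + norm a + 1"
      using norm_triangle_ineq4[of z "a + 1"] norm_triangle_ineq[of a 1] by (simp add: z_def)
    hence z: "norm z \<ge> 2 * norm w" using n N by linarith
    have "rGamma z = z * rGamma (z + 1)" by (simp add: rGamma_plus1)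
    hence f_n: "f n = z * (of_nat (Suc n)) * rGamma (z + 1) / fact (Suc n) * w ^ n"
      by (simp add: f_def z_def[symmetric] del: of_nat_Suc)
    have "norm (f (Suc n)) = norm w * (norm (rGamma (z + 1) / fact (Suc n)) * norm w ^ n)"
      by (simp add: f_def z_def norm_mult norm_power norm_divide add_ac)
    also have "\<dots> \<le> 1 / 2 * (norm z * real (Suc n)) * (norm (rGamma (z + 1) / fact (Suc n)) * norm w ^ n)"
    proof (rule mult_right_mono)
      have "2 * norm w * 1 \<le> norm z * real (Suc n)"
        using z by (intro mult_mono) auto
      thus "norm w \<le> 1 / 2 * (norm z * real (Suc n))" by simp
    qed auto
    also have "\<dots> = 1 / 2 * norm (f n)"
      unfolding f_n by (simp add: norm_mult norm_power norm_divide del: of_nat_Suc)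
    finally show "norm (f (Suc n)) \<le> 1 / 2 * norm (f n)" .
  qed
  thus ?thesis by (simp add: f_def)
qed

lemma Ihat_sums: "(\<lambda>n. (rGamma (of_nat n + a + 1) / fact n) * w ^ n) sums Ihat a w"
  unfolding Ihat_def using summable_Ihat by (rule summable_sums)

lemma Ihat_0 [simp]: "Ihat a 0 = rGamma (a + 1)"
proof -
  have "Ihat a 0 = (\<Sum>n\<in>{0}. (rGamma (of_nat n + a + 1) / fact n) * 0 ^ n)"
    unfolding Ihat_def by (rule suminf_finite) auto
  thus ?thesis by simp
qed

lemma Ihat_has_field_derivative: "(Ihat a has_field_derivative Ihat (a + 1) w) (at w)"
proof -
  let ?c = "\<lambda>n. rGamma (of_nat n + a + 1) / fact n"
  have "((\<lambda>w. \<Sum>n. ?c n * w ^ n) has_field_derivative (\<Sum>n. diffs ?c n * w ^ n)) (at w)"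
    by (rule termdiffs_strong_converges_everywhere[OF summable_Ihat])
  also have "(\<lambda>w. \<Sum>n. ?c n * w ^ n) = Ihat a" by (simp only: Ihat_def[abs_def])
  also have "diffs ?c = (\<lambda>n. rGamma (of_nat n + (a + 1) + 1) / fact n)"
    by (simp add: diffs_def fun_eq_iff add_ac del: of_nat_Suc) (simp add: add_ac)
  finally show ?thesis by (simp only: Ihat_def[of "a + 1"])
qed

text \<open>Multiplying the series of order a + 1 by w gives the series of order a with an extra
  factor n. Adding a times the latter produces n + a, and
  \<open>(n + a) * rGamma (n + a + 1) = rGamma (n + a)\<close>.\<close>

lemma Ihat_rec: "Ihat (a - 1) w = w * Ihat (a + 1) w + a * Ihat a w"
proof -
  let ?c = "\<lambda>n. rGamma (of_nat n + a + 1) / fact n"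
  have "(\<lambda>n. w * ((rGamma (of_nat n + (a + 1) + 1) / fact n) * w ^ n)) sums (w * Ihat (a + 1) w)"
    by (intro sums_mult Ihat_sums)
  hence "(\<lambda>n. of_nat (Suc n) * (?c (Suc n) * w ^ Suc n)) sums (w * Ihat (a + 1) w)"
    by (simp add: add_ac mult_ac divide_simps del: of_nat_Suc) (simp add: add_ac)
  hence "(\<lambda>n. of_nat n * (?c n * w ^ n)) sums (w * Ihat (a + 1) w)"
    by (subst (asm) sums_Suc_iff) simp
  from sums_add[OF this sums_mult[OF Ihat_sums[of a w], of a]]
  have "(\<lambda>n. (of_nat n + a) * (?c n * w ^ n)) sums (w * Ihat (a + 1) w + a * Ihat a w)"
    by (simp only: ring_distribs)
  also have "(\<lambda>n. (of_nat n + a) * (?c n * w ^ n)) = (\<lambda>n. rGamma (of_nat n + (a - 1) + 1) / fact n * w ^ n)"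
  proof
    fix n
    have "rGamma (of_nat n + a) = (of_nat n + a) * rGamma (of_nat n + a + 1)" by (simp add: rGamma_plus1)
    thus "(of_nat n + a) * (?c n * w ^ n) = rGamma (of_nat n + (a - 1) + 1) / fact n * w ^ n" by simp
  qed
  finally show ?thesis using Ihat_sums sums_unique2 by blast
qed

lemma isCont_Ihat [continuous_intros]: "isCont (Ihat a) w"
  using Ihat_has_field_derivative by (rule DERIV_isCont)

lemma rGamma_reflection: "rGamma (- a) * rGamma (a + 1) = - sin (of_real pi * a) / of_real pi" for a :: complex
proof -
  have "rGamma (- a) * rGamma (1 - (- a)) = sin (of_real pi * (- a)) / of_real pi"
    by (rule rGamma_reflection_complex)
  thus ?thesis by (simp add: add_ac)
qed

text \<open>Up to the factor \<open>w powr (- a - 1)\<close> this is the Wronskian of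
  \<open>Ihat a w\<close> and the second solution \<open>w powr (- a) * Ihat (- a) w\<close>.
  Without that factor the expression is entire, so the constant can be read off at w = 0, where the
  reflection formula evaluates it.\<close>

lemma Ihat_wronskian:
  "Ihat (- a - 1) w * Ihat a w - w * Ihat (a + 1) w * Ihat (- a) w = - sin (of_real pi * a) / of_real pi"
proof -
  let ?W = "\<lambda>w. Ihat (- a - 1) w * Ihat a w - w * Ihat (a + 1) w * Ihat (- a) w"
  have "\<exists>c. \<forall>w\<in>UNIV. ?W w = c"
  proof (rule has_field_derivative_zero_constant)
    fix w :: complex
    have r1: "Ihat a w = w * Ihat (a + 1 + 1) w + (a + 1) * Ihat (a + 1) w"
      using Ihat_rec[of "a + 1" w] by simp
    have r2: "Ihat (- a - 1) w = w * Ihat (- a + 1) w - a * Ihat (- a) w"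
      using Ihat_rec[of "- a" w] by simp
    have d: "(Ihat (- a - 1) has_field_derivative Ihat (- a) w) (at w)"
      using Ihat_has_field_derivative[of "- a - 1" w] by simp
    have "(?W has_field_derivative (Ihat (- a) w * Ihat a w + Ihat (a + 1) w * Ihat (- a - 1) w)
            - ((1 * Ihat (a + 1) w + Ihat (a + 1 + 1) w * w) * Ihat (- a) w
               + Ihat (- a + 1) w * (w * Ihat (a + 1) w))) (at w)"
      by (intro DERIV_diff DERIV_mult DERIV_ident d Ihat_has_field_derivative)
    also have "(Ihat (- a) w * Ihat a w + Ihat (a + 1) w * Ihat (- a - 1) w)
            - ((1 * Ihat (a + 1) w + Ihat (a + 1 + 1) w * w) * Ihat (- a) w
               + Ihat (- a + 1) w * (w * Ihat (a + 1) w)) = 0"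
      unfolding r1 r2 by algebra
    finally show "(?W has_field_derivative 0) (at w within UNIV)" .
  qed auto
  then obtain c where c: "\<And>w. ?W w = c" by blast
  have "c = rGamma (- a) * rGamma (a + 1)" using c[of 0] by simp
  with c[of w] show ?thesis by (simp add: rGamma_reflection)
qed

text \<open>The Wronskian is invariant under $a \mapsto a + 1$, so its limit at $w = 0$ is needed only for
Re $a < 0$, where $\hat K_a$ is bounded.\<close>

lemma Khat_Ihat_wronskian_step:
  assumes "Re w > 0"
  shows "Khat (a + 1) w * Ihat (- a - 1 - 1) w + w * Khat (a + 1 + 1) w * Ihat (- a - 1) w =
         Khat a w * Ihat (- a - 1) w + w * Khat (a + 1) w * Ihat (- a) w"
proof -
  have r1: "w * Khat (a + 1 + 1) w = Khat a w + (a + 1) * Khat (a + 1) w"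
    using Khat_rec[OF assms, of "a + 1"] by simp
  have r2: "Ihat (- a - 1 - 1) w = w * Ihat (- a) w - (a + 1) * Ihat (- a - 1) w"
    using Ihat_rec[of "- a - 1" w] by (simp add: algebra_simps)
  show ?thesis unfolding r1 r2 by (simp add: algebra_simps)
qed

text \<open>The same second solution, now paired with \<open>Khat a\<close>. As w tends to 0 the
  second product disappears because Re (a + 1) < 1, and the first one tends to
  \<open>Gamma (- a) / 2 * rGamma (- a)\<close>.\<close>

lemma Khat_Ihat_wronskian_neg:
  assumes "Re a < 0" "w > 0"
  shows "Khat a (of_real w) * Ihat (- a - 1) (of_real w) +
         of_real w * Khat (a + 1) (of_real w) * Ihat (- a) (of_real w) = 1 / 2"
proof -
  let ?W = "\<lambda>w. Khat a w * Ihat (- a - 1) w + w * Khat (a + 1) w * Ihat (- a) w"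
  have "\<exists>c. \<forall>w\<in>{w. Re w > 0}. ?W w = c"
  proof (rule has_field_derivative_zero_constant)
    fix w :: complex assume "w \<in> {w. Re w > 0}"
    hence w: "Re w > 0" by simp
    have r1: "Khat a w = w * Khat (a + 1 + 1) w - (a + 1) * Khat (a + 1) w"
      using Khat_rec[OF w, of "a + 1"] by simp
    have r2: "Ihat (- a - 1) w = w * Ihat (- a + 1) w - a * Ihat (- a) w"
      using Ihat_rec[of "- a" w] by simp
    have d: "(Ihat (- a - 1) has_field_derivative Ihat (- a) w) (at w)"
      using Ihat_has_field_derivative[of "- a - 1" w] by simp
    have "(?W has_field_derivative (- Khat (a + 1) w * Ihat (- a - 1) w + Ihat (- a) w * Khat a w)
            + ((1 * Khat (a + 1) w + - Khat (a + 1 + 1) w * w) * Ihat (- a) w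
               + Ihat (- a + 1) w * (w * Khat (a + 1) w))) (at w)"
      by (intro DERIV_add DERIV_mult DERIV_ident d Ihat_has_field_derivative Khat_has_field_derivative w)
    also have "(- Khat (a + 1) w * Ihat (- a - 1) w + Ihat (- a) w * Khat a w)
            + ((1 * Khat (a + 1) w + - Khat (a + 1 + 1) w * w) * Ihat (- a) w
               + Ihat (- a + 1) w * (w * Khat (a + 1) w)) = 0"
      unfolding r1 r2 by algebra
    finally have "(?W has_field_derivative 0) (at w)" .
    thus "(?W has_field_derivative 0) (at w within {w. Re w > 0})"
      by (rule has_field_derivative_at_within)
  qed (rule convex_halfspace_Re_gt)
  then obtain c where c: "\<And>w. Re w > 0 \<Longrightarrow> ?W w = c" by blast
  have I: "((\<lambda>w. Ihat b (of_real w)) \<longlongrightarrow> rGamma (b + 1)) (at_right 0)" for b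
  proof -
    have "((\<lambda>w. Ihat b (of_real w)) \<longlongrightarrow> Ihat b (of_real 0)) (at_right (0::real))"
      by (intro isCont_tendsto_compose[OF isCont_Ihat] tendsto_intros)
    thus ?thesis by simp
  qed
  have "((\<lambda>w. ?W (of_real w)) \<longlongrightarrow> Gamma (- a) / 2 * rGamma (- a - 1 + 1) + 0 * rGamma (- a + 1)) (at_right (0::real))"
    using assms by (intro tendsto_intros I Khat_tendsto_0 Khat_tendsto_0') auto
  also have "?this \<longleftrightarrow> ((\<lambda>_. c) \<longlongrightarrow> Gamma (- a) / 2 * rGamma (- a - 1 + 1) + 0 * rGamma (- a + 1)) (at_right (0::real))"
    by (intro filterlim_cong refl) (auto simp: eventually_at_filter c)
  finally have "c = Gamma (- a) / 2 * rGamma (- a - 1 + 1) + 0 * rGamma (- a + 1)"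
    by (simp add: tendsto_const_iff)
  also have "\<dots> = (Gamma (- a) * rGamma (- a)) / 2" by simp
  also have "Gamma (- a) * rGamma (- a) = 1"
  proof -
    have "- a \<notin> \<int>\<^sub>\<le>\<^sub>0"
      using assms by (auto elim!: nonpos_Ints_cases dest!: arg_cong[where f = Re])
    thus ?thesis by (simp add: rGamma_inverse_Gamma Gamma_eq_zero_iff)
  qed
  finally show ?thesis using c[of "of_real w"] assms by simp
qed

lemma Khat_Ihat_wronskian:
  assumes "w > 0"
  shows "Khat a (of_real w) * Ihat (- a - 1) (of_real w) +
         of_real w * Khat (a + 1) (of_real w) * Ihat (- a) (of_real w) = 1 / 2"
proof -
  \<comment> \<open>At order a - n the real part is negative and the constant is known; n steps of
    the invariance lead back to a.\<close>
  obtain n :: nat where n: "real n > Re a" using reals_Archimedean2 by blast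
  let ?W = "\<lambda>a. Khat a (of_real w) * Ihat (- a - 1) (of_real w) +
         of_real w * Khat (a + 1) (of_real w) * Ihat (- a) (of_real w)"
  have "?W (a - of_nat n + of_nat k) = 1 / 2" for k
  proof (induction k)
    case 0
    show ?case using Khat_Ihat_wronskian_neg[of "a - of_nat n + of_nat 0" w] n assms by simp
  next
    case (Suc k)
    have "?W (a - of_nat n + of_nat (Suc k)) = ?W (a - of_nat n + of_nat k)"
      using Khat_Ihat_wronskian_step[of "of_real w" "a - of_nat n + of_nat k"] assms
      by (simp add: algebra_simps)
    with Suc.IH show ?case by simp
  qed
  from this[of n] show ?thesis by simp
qed

text \<open>The preceding identity at order - a - 1, with \<open>Khat_sym\<close> applied to both K
  factors, becomes the Wronskian against \<open>Ihat a\<close> itself.\<close>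

lemma Khat_Ihat_wronskian':
  assumes "w > 0"
  shows "of_real w powr (a + 1) * (Khat a (of_real w) * Ihat (a + 1) (of_real w) +
         Khat (a + 1) (of_real w) * Ihat a (of_real w)) = 1 / 2"
proof -
  have s: "Khat (- a - 1) (of_real w) = of_real w powr (a + 1) * Khat (a + 1) (of_real w)"
    using Khat_sym[OF assms, of "a + 1"] by (simp add: minus_diff_commute)
  show ?thesis
    using Khat_Ihat_wronskian[OF assms, of "- a - 1"] Khat_sym[OF assms, of a] assms
    by (simp add: s powr_add algebra_simps)
qed

text \<open>Cramer's rule: the two Wronskians are linear equations for \<open>Khat a\<close> and
  \<open>Khat (a + 1)\<close>, and their determinant is a multiple of sin (pi a), which is nonzero
  off the integers.\<close>

lemma Khat_eq_real:
  assumes "a \<notin> \<int>" "w > 0"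
  shows "Khat a (of_real w) = of_real pi / 2 / sin (of_real pi * a) *
           (of_real w powr (- a) * Ihat (- a) (of_real w) - Ihat a (of_real w))"
proof -
  define W where "W = complex_of_real w"
  define P where "P = W powr (a + 1)"
  have W: "W \<noteq> 0" using assms by (simp add: W_def)
  have P: "P \<noteq> 0" using W by (simp add: P_def)
  have sin: "sin (of_real pi * a) \<noteq> 0"
  proof
    assume "sin (of_real pi * a) = 0"
    then obtain n :: int where "of_real pi * a = of_real (n * pi)" by (auto simp: sin_eq_0)
    hence "a = of_int n" by simp
    thus False using assms by simp
  qed
  note 1 = Khat_Ihat_wronskian[OF assms(2), of a, folded W_def]
  note 2 = Khat_Ihat_wronskian'[OF assms(2), of a, folded W_def, folded P_def]
  note 3 = Ihat_wronskian[of a W]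
  have "Khat a W * (Ihat (- a - 1) W * Ihat a W - W * Ihat (a + 1) W * Ihat (- a) W) =
     Ihat a W * (Khat a W * Ihat (- a - 1) W + W * Khat (a + 1) W * Ihat (- a) W)
     - W * Ihat (- a) W * ((P * (Khat a W * Ihat (a + 1) W + Khat (a + 1) W * Ihat a W)) / P)"
    using P by (simp add: field_simps)
  also have "\<dots> = 1 / 2 * (Ihat a W - W / P * Ihat (- a) W)"
    unfolding 1 2 by (simp add: algebra_simps)
  also have "W / P = W powr (- a)"
    using W by (simp add: P_def powr_add powr_minus field_simps)
  finally show ?thesis
    unfolding 3 W_def[symmetric] using sin by (simp add: field_simps)
qed

text \<open>Identity theorem: both sides are holomorphic in the right half-plane and agree on the
  positive axis, which accumulates at 1.\<close>

lemma Khat_eq: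
  assumes "a \<notin> \<int>" "Re w > 0"
  shows "Khat a w = of_real pi / 2 / sin (of_real pi * a) * (w powr (- a) * Ihat (- a) w - Ihat a w)"
proof -
  define f where "f = (\<lambda>w. Khat a w - of_real pi / 2 / sin (of_real pi * a) * (w powr (- a) * Ihat (- a) w - Ihat a w))"
  have I: "Ihat b holomorphic_on A" for b A
    by (rule holomorphic_onI, rule field_differentiable_at_within)
       (auto simp: field_differentiable_def intro: Ihat_has_field_derivative)
  have "f w = 0"
  proof (rule analytic_continuation[where f = f and w = w and S = "{w. Re w > 0}" and U = "of_real ` {0<..}" and \<xi> = 1])
    show "f holomorphic_on {w. Re w > 0}"
      unfolding f_def by (intro holomorphic_intros I Khat_holomorphic) (auto simp: complex_nonpos_Reals_iff)
    show "open {w. Re w > 0}" by (rule open_halfspace_Re_gt)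
    show "connected {w. Re w > 0}" by (intro convex_connected convex_halfspace_Re_gt)
    show "\<And>z. z \<in> of_real ` {0<..} \<Longrightarrow> f z = 0"
      using Khat_eq_real[OF assms(1)] by (auto simp: f_def)
    show "(1::complex) islimpt of_real ` {0<..}"
      unfolding islimpt_sequential
    proof (intro exI conjI allI)
      show "of_real (1 + inverse (real (Suc n))) \<in> complex_of_real ` {0<..} - {1}" for n
      proof -
        define y where "y = 1 + inverse (real (Suc n))"
        have "y > 1" unfolding y_def by simp
        thus ?thesis unfolding y_def[symmetric] by auto
      qed
      show "(\<lambda>n. complex_of_real (1 + inverse (real (Suc n)))) \<longlonglongrightarrow> 1"
        using tendsto_of_real[OF LIMSEQ_inverse_real_of_nat_add[of 1], where 'a = complex] by simp
    qed
  qed (use assms in auto)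
  thus ?thesis by (simp add: f_def)
qed


section \<open>Identification with the principal-branch definition of K\<close>

text \<open>The power is kept as \<open>(z / 2) powr (- 2 * a)\<close>, not as a power of (z/2)^2,
  and in this form the identity holds for every nonzero z. That range matters for G_3 and G_4, where
  the argument t x / (1 - t) runs around 0 and leaves every half-plane.\<close>

lemma Ktilde_nonint:
  assumes "a \<notin> \<int>" "z \<noteq> 0"
  shows "Ktilde a z = of_real pi / 2 / sin (of_real pi * a) *
           ((z / 2) powr (- 2 * a) * Ihat (- a) ((z / 2)\<^sup>2) - Ihat a ((z / 2)\<^sup>2))"
proof -
  define p where "p = (z / 2) powr a"
  have p: "p \<noteq> 0" "(z / 2) powr (- a) = inverse p" "(z / 2) powr (- 2 * a) = inverse p * inverse p"
    using assms powr_add[of "z / 2" "- a" "- a"] by (simp_all add: p_def powr_minus)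
  define A B S where "A = Ihat (- a) ((z / 2)\<^sup>2)" and "B = Ihat a ((z / 2)\<^sup>2)" and "S = sin (of_real pi * a)"
  have "Ktilde a z = inverse p * (of_real pi / 2 * (inverse p * A - p * B) / S)"
    unfolding Ktilde_def besselK_def besselK_aux_def besselI_def Itilde_conv_Ihat p(2)
    using assms by (simp add: p_def A_def B_def S_def mult.commute[of _ "of_real pi"])
  also have "\<dots> = of_real pi / 2 / S * (inverse p * inverse p * A - (inverse p * p) * B)"
  proof -
    have "x * (c * (x * A - y * B) / S) = c / S * (x * x * A - x * y * B)" for x y c
      by (simp add: algebra_simps diff_divide_distrib)
    thus ?thesis .
  qed
  finally show ?thesis
    unfolding p(3) using p(1) by (simp add: A_def B_def S_def)
qed

text \<open>In the right half-plane the argument of z stays below pi/2 in modulus, so doubling it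
  does not cross the branch cut.\<close>

lemma powr_square:
  assumes "Re z > 0"
  shows "(z\<^sup>2) powr b = z powr (2 * b)"
proof -
  have z: "z \<noteq> 0" using assms by auto
  have "\<bar>Im (Ln z)\<bar> < pi / 2"
    using assms z by (subst Re_Ln_pos_lt) auto
  hence "Ln (z\<^sup>2) = 2 * Ln z"
    using z by (intro Ln_unique) (auto simp: exp_double)
  thus ?thesis using z by (simp add: powr_def mult_ac)
qed

lemma besselK_aux_eq_Khat:
  assumes "b \<notin> \<int>" "Re z > 0" "Re ((z / 2)\<^sup>2) > 0"
  shows "besselK_aux b z = (z / 2) powr b * Khat b ((z / 2)\<^sup>2)"
proof -
  have z: "z \<noteq> 0" using assms by auto
  have "Khat b ((z / 2)\<^sup>2) = Ktilde b z"
    using Ktilde_nonint[OF assms(1) z] Khat_eq[OF assms(1,3)] powr_square[of "z / 2" "- b"] assms(2)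
    by simp
  also have "\<dots> = (z / 2) powr (- b) * besselK_aux b z"
    using assms by (simp add: Ktilde_def besselK_def)
  finally show ?thesis using z by (simp add: powr_minus)
qed

text \<open>The integers are discrete, so near an integer the limit that defines K only sees orders
  for which the formula is already known; continuity of the integral in the order then gives its
  value.\<close>

lemma Ktilde_eq_Khat:
  assumes "Re z > 0" "Re ((z / 2)\<^sup>2) > 0"
  shows "Ktilde a z = Khat a ((z / 2)\<^sup>2)"
proof -
  have z: "z \<noteq> 0" using assms by auto
  have "besselK a z = (z / 2) powr a * Khat a ((z / 2)\<^sup>2)"
  proof (cases "a \<in> \<int>")
    case False
    thus ?thesis using assms by (simp add: besselK_def besselK_aux_eq_Khat)
  next
    case True
    have "((\<lambda>b. (z / 2) powr b * Khat b ((z / 2)\<^sup>2)) \<longlongrightarrow> (z / 2) powr a * Khat a ((z / 2)\<^sup>2)) (at a)"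
      using isCont_Khat_order[OF assms(2), of a] z
      by (intro tendsto_mult) (auto simp: isCont_def powr_def intro!: tendsto_intros)
    also have "?this \<longleftrightarrow> ((\<lambda>b. besselK_aux b z) \<longlongrightarrow> (z / 2) powr a * Khat a ((z / 2)\<^sup>2)) (at a)"
    proof (intro filterlim_cong refl)
      have "\<forall>\<^sub>F b in at a. b \<notin> \<int>"
      proof -
        have "x = y" if "x \<in> \<int>" "y \<in> \<int>" "dist x y < 1" for x y :: complex
          using that by (auto simp: dist_norm elim!: Ints_cases simp flip: of_int_diff)
        hence "\<not> a islimpt \<int>"
          by (intro discrete_imp_not_islimpt[of 1]) (auto simp: dist_commute)
        thus ?thesis by (simp add: islimpt_iff_eventually)
      qed
      thus "\<forall>\<^sub>F b in at a. (z / 2) powr b * Khat b ((z / 2)\<^sup>2) = besselK_aux b z"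
        by eventually_elim (use assms in \<open>simp add: besselK_aux_eq_Khat\<close>)
    qed
    finally have "Lim (at a) (\<lambda>b. besselK_aux b z) = (z / 2) powr a * Khat a ((z / 2)\<^sup>2)"
      by (intro tendsto_Lim) auto
    thus ?thesis using True by (simp add: besselK_def)
  qed
  thus ?thesis using z by (simp add: Ktilde_def powr_minus)
qed

section \<open>Behaviour at infinity\<close>

text \<open>Real-valued copies of both functions, because the estimates at infinity rest on
  inequalities between different orders.\<close>

definition Khat_real :: "real \<Rightarrow> real \<Rightarrow> real" where
  "Khat_real a w = (\<integral>u. exp (- exp u - w * exp (- u) - a * u) \<partial>lborel) / 2"

definition Ihat_real :: "real \<Rightarrow> real \<Rightarrow> real" where
  "Ihat_real a w = (\<Sum>n. (rGamma (of_nat n + a + 1) / fact n) * w ^ n)"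

lemma Kker_of_real: "Kker (of_real a) (of_real (w::real)) u = of_real (exp (- exp u - w * exp (- u) - a * u))"
  by (simp add: Kker_def exp_of_real[symmetric])

lemma Khat_of_real: "Khat (of_real a) (of_real w) = of_real (Khat_real a w)"
  by (simp add: Khat_def Khat_real_def Kker_of_real)

lemma integrable_Khat_real: "w > 0 \<Longrightarrow> integrable lborel (\<lambda>u. exp (- exp u - w * exp (- u) - a * u))"
  for w a :: real
  using integrable_norm[OF integrable_Kker[of "of_real w" "of_real a"]]
  by (simp add: norm_Kker)

lemma rGamma_of_nat_plus: 
  "rGamma (of_nat n + complex_of_real a + 1) = of_real (rGamma (of_nat n + a + 1))"
  using rGamma_complex_of_real[of "of_nat n + a + 1"] by simp

lemma Ihat_real_sums: "(\<lambda>n. (rGamma (of_nat n + a + 1) / fact n) * w ^ n) sums Ihat_real a w" for a w :: real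
proof -
  have "summable (\<lambda>n. complex_of_real ((rGamma (of_nat n + a + 1) / fact n) * w ^ n))"
    using summable_Ihat[of "of_real a" "of_real w"] by (simp add: rGamma_of_nat_plus)
  thus ?thesis unfolding Ihat_real_def summable_complex_of_real by (rule summable_sums)
qed

lemma Ihat_of_real: "Ihat (of_real a) (of_real w) = of_real (Ihat_real a w)"
proof -
  have "(\<lambda>n. complex_of_real ((rGamma (of_nat n + a + 1) / fact n) * w ^ n)) sums of_real (Ihat_real a w)"
    by (intro sums_of_real Ihat_real_sums)
  hence "(\<lambda>n. rGamma (of_nat n + complex_of_real a + 1) / fact n * of_real w ^ n) sums of_real (Ihat_real a w)"
    by (simp add: rGamma_of_nat_plus)
  thus ?thesis using Ihat_sums sums_unique2 by blast
qed

lemma Khat_real_rec: "w > 0 \<Longrightarrow> w * Khat_real (a + 1) w = Khat_real (a - 1) w + a * Khat_real a w"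
proof -
  assume "w > 0"
  hence "complex_of_real (w * Khat_real (a + 1) w) = of_real (Khat_real (a - 1) w + a * Khat_real a w)"
    using Khat_rec[of "of_real w" "of_real a"] unfolding of_real_mult of_real_add Khat_of_real[symmetric]
    by simp
  thus ?thesis unfolding of_real_eq_iff .
qed

lemma Ihat_real_rec: "Ihat_real (a - 1) w = w * Ihat_real (a + 1) w + a * Ihat_real a w"
proof -
  have "complex_of_real (Ihat_real (a - 1) w) = of_real (w * Ihat_real (a + 1) w + a * Ihat_real a w)"
    using Ihat_rec[of "of_real a" "of_real w"] unfolding of_real_mult of_real_add Ihat_of_real[symmetric]
    by simp
  thus ?thesis unfolding of_real_eq_iff .
qed

lemma Khat_real_sym: "w > 0 \<Longrightarrow> Khat_real (- a) w = w powr a * Khat_real a w"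
proof -
  assume "w > 0"
  hence "complex_of_real (Khat_real (- a) w) = of_real (w powr a * Khat_real a w)"
    using Khat_sym[of w "of_real a"] unfolding of_real_mult Khat_of_real[symmetric]
    by (simp add: powr_of_real)
  thus ?thesis unfolding of_real_eq_iff .
qed

lemma Khat_real_Ihat_real_wronskian:
  assumes "w > 0"
  shows "w powr (a + 1) * (Khat_real a w * Ihat_real (a + 1) w + Khat_real (a + 1) w * Ihat_real a w) = 1 / 2"
proof -
  have "complex_of_real (w powr (a + 1) * (Khat_real a w * Ihat_real (a + 1) w + Khat_real (a + 1) w * Ihat_real a w)) = of_real (1 / 2)"
    using Khat_Ihat_wronskian'[of w "of_real a"] assms
    unfolding of_real_mult of_real_add Khat_of_real[symmetric] Ihat_of_real[symmetric]
    by (simp add: powr_of_real[symmetric])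
  thus ?thesis unfolding of_real_eq_iff .
qed

lemma Khat_real_has_field_derivative:
  assumes "w > 0"
  shows "(Khat_real a has_real_derivative - Khat_real (a + 1) w) (at w)"
proof -
  have "((\<lambda>w. Khat (of_real a) (of_real w)) has_vector_derivative - Khat (of_real a + 1) (of_real w)) (at w)"
    using assms by (intro has_vector_derivative_real_field Khat_has_field_derivative) simp
  also have "complex_of_real a + 1 = of_real (a + 1)" by simp
  finally show ?thesis
    using bounded_linear.has_vector_derivative[OF bounded_linear_Re]
    unfolding Khat_of_real has_real_derivative_iff_has_vector_derivative by fastforce
qed

lemma Khat_real_tendsto_0:
  assumes "a < 0"
  shows "(Khat_real a \<longlongrightarrow> Gamma (- a) / 2) (at_right 0)"
proof -
  have "((\<lambda>w. Re (Khat (of_real a) (of_real w))) \<longlongrightarrow> Re (Gamma (- of_real a) / 2)) (at_right 0)"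
    using assms by (intro tendsto_intros Khat_tendsto_0) auto
  thus ?thesis by (simp add: Khat_of_real Gamma_complex_of_real flip: of_real_minus)
qed

section \<open>The classical K_a(x) and I_a(x) for real order\<close>

definition macdonald :: "real \<Rightarrow> real \<Rightarrow> real" where "macdonald a x = (x / 2) powr a * Khat_real a ((x / 2)\<^sup>2)"
definition modified_bessel :: "real \<Rightarrow> real \<Rightarrow> real" where "modified_bessel a x = (x / 2) powr a * Ihat_real a ((x / 2)\<^sup>2)"

lemma powr_sq: "s > 0 \<Longrightarrow> (s\<^sup>2) powr a = s powr a * s powr a" for s :: real
  by (simp add: power2_eq_square powr_mult)

lemma macdonald_rec:
  assumes "x > 0"
  shows "macdonald (a + 1) x = macdonald (a - 1) x + 2 * a / x * macdonald a x"
proof -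
  define s where "s = x / 2"
  have s: "s > 0" "x = 2 * s" using assms by (auto simp: s_def)
  have "macdonald (a + 1) x = s powr (a - 1) * (s\<^sup>2 * Khat_real (a + 1) (s\<^sup>2))"
    using s by (simp add: macdonald_def powr_add powr_diff power2_eq_square)
  also have "\<dots> = macdonald (a - 1) x + 2 * a / x * macdonald a x"
    using s by (subst Khat_real_rec) (auto simp: macdonald_def powr_diff field_simps)
  finally show ?thesis .
qed

lemma modified_bessel_rec:
  assumes "x > 0"
  shows "modified_bessel (a - 1) x = modified_bessel (a + 1) x + 2 * a / x * modified_bessel a x"
proof -
  define s where "s = x / 2"
  have s: "s > 0" "x = 2 * s" using assms by (auto simp: s_def)
  show ?thesis
    unfolding modified_bessel_def Ihat_real_rec using s
    by (simp add: powr_diff powr_add field_simps power2_eq_square)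
qed

lemma macdonald_sym: "x > 0 \<Longrightarrow> macdonald (- a) x = macdonald a x"
  by (simp add: macdonald_def Khat_real_sym powr_sq powr_minus)

lemma macdonald_modified_bessel_wronskian:
  assumes "x > 0"
  shows "x * (macdonald a x * modified_bessel (a + 1) x + macdonald (a + 1) x * modified_bessel a x) = 1"
proof -
  define s where "s = x / 2"
  have s: "s > 0" "x = 2 * s" using assms by (auto simp: s_def)
  have "x * (macdonald a x * modified_bessel (a + 1) x + macdonald (a + 1) x * modified_bessel a x) = 2 * ((s\<^sup>2) powr (a + 1) *
           (Khat_real a (s\<^sup>2) * Ihat_real (a + 1) (s\<^sup>2) + Khat_real (a + 1) (s\<^sup>2) * Ihat_real a (s\<^sup>2)))"
    unfolding macdonald_def modified_bessel_def s_def[symmetric] powr_sq[OF s(1)] powr_add[of s a 1]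
    using s by (simp add: algebra_simps)
  also have "\<dots> = 1"
    using s by (subst Khat_real_Ihat_real_wronskian) auto
  finally show ?thesis .
qed

text \<open>Averaging the integrals for a and - a makes the integrand even in a. With u = ln (x/2) +
  t this is the classical K_a(x), the integral of exp (- x cosh t) cosh (a t) over t > 0. The order
  enters only through cosh, so orders can be compared pointwise.\<close>

lemma macdonald_cosh:
  assumes "x > 0"
  shows "macdonald a x = (\<integral>u. exp (- exp u - (x / 2)\<^sup>2 * exp (- u)) * cosh (a * (u - ln (x / 2))) \<partial>lborel) / 2"
    and "integrable lborel (\<lambda>u. exp (- exp u - (x / 2)\<^sup>2 * exp (- u)) * cosh (a * (u - ln (x / 2))))"
proof -
  define s where "s = x / 2"
  have s: "s > 0" "x = 2 * s" using assms by (auto simp: s_def)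
  let ?k = "\<lambda>a u. exp (- exp u - s\<^sup>2 * exp (- u) - a * u)"
  have int: "integrable lborel (?k a)" for a
    using s by (intro integrable_Khat_real) auto
  have eq: "exp (- exp u - s\<^sup>2 * exp (- u)) * cosh (a * (u - ln s)) = 
              (s powr a * ?k a u + s powr (- a) * ?k (- a) u) / 2" for u
    using s by (simp add: cosh_def powr_def algebra_simps flip: exp_add)
  show "integrable lborel (\<lambda>u. exp (- exp u - (x / 2)\<^sup>2 * exp (- u)) * cosh (a * (u - ln (x / 2))))"
    unfolding s_def[symmetric] eq
    by (intro Bochner_Integration.integrable_divide Bochner_Integration.integrable_add integrable_mult_right int)
  have "macdonald a x = (macdonald a x + macdonald (- a) x) / 2"
    using assms by (simp add: macdonald_sym)
  also have "\<dots> = (\<integral>u. (s powr a * ?k a u + s powr (- a) * ?k (- a) u) / 2 \<partial>lborel) / 2"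
    using int[of a] int[of "- a"] by (simp add: macdonald_def Khat_real_def s_def[symmetric])
  finally show "macdonald a x = (\<integral>u. exp (- exp u - (x / 2)\<^sup>2 * exp (- u)) * cosh (a * (u - ln (x / 2))) \<partial>lborel) / 2"
    unfolding s_def[symmetric] eq .
qed

lemma macdonald_mono:
  assumes "x > 0" "\<bar>a\<bar> \<le> \<bar>b\<bar>"
  shows "macdonald a x \<le> macdonald b x"
  unfolding macdonald_cosh(1)[OF assms(1)]
proof (intro divide_right_mono integral_mono macdonald_cosh(2)[OF assms(1)] mult_left_mono)
  fix u
  have "cosh (\<bar>a * (u - ln (x / 2))\<bar>) \<le> cosh (\<bar>b * (u - ln (x / 2))\<bar>)"
    using assms(2) by (subst cosh_real_nonneg_le_iff) (auto simp: abs_mult intro: mult_right_mono)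
  thus "cosh (a * (u - ln (x / 2))) \<le> cosh (b * (u - ln (x / 2)))" by simp
qed auto

text \<open>The orders -1/2 and 1/2 are linked twice: \<open>Khat_real (- 1 / 2)\<close> has the
  derivative \<open>- Khat_real (1 / 2)\<close>, and by reflection it equals sqrt w times
  \<open>Khat_real (1 / 2)\<close>. Hence \<open>f\<close> is constant, and its value is the limit
  at 0, Gamma (1/2) / 2.\<close>

lemma macdonald_half:
  assumes "x > 0"
  shows "macdonald (1 / 2) x = sqrt (pi / 2) * (x powr (- 1 / 2) * exp (- x))"
proof -
  define f where "f = (\<lambda>x. exp x * Khat_real (- 1 / 2) ((x / 2)\<^sup>2))"
  have "\<exists>c. \<forall>x\<in>{0<..}. f x = c"
  proof (rule has_field_derivative_zero_constant)
    fix x :: real assume "x \<in> {0<..}"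
    hence x: "x > 0" by simp
    have "(f has_real_derivative exp x * Khat_real (- 1 / 2) ((x / 2)\<^sup>2) + 
       exp x * (- Khat_real (- 1 / 2 + 1) ((x / 2)\<^sup>2) * (x / 2))) (at x)"
      unfolding f_def using x
      by (auto intro!: derivative_eq_intros DERIV_chain2[OF Khat_real_has_field_derivative])
    also have "Khat_real (- 1 / 2) ((x / 2)\<^sup>2) = x / 2 * Khat_real (1 / 2) ((x / 2)\<^sup>2)"
      using Khat_real_sym[of "(x / 2)\<^sup>2" "1 / 2"] x by (simp add: powr_half_sqrt real_sqrt_divide)
    also have "exp x * (x / 2 * Khat_real (1 / 2) ((x / 2)\<^sup>2)) + 
       exp x * (- Khat_real (- 1 / 2 + 1) ((x / 2)\<^sup>2) * (x / 2)) = 0" by simp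
    finally have "(f has_real_derivative 0) (at x)" .
    thus "(f has_real_derivative 0) (at x within {0<..})"
      by (rule has_field_derivative_at_within)
  qed auto
  then obtain c where c: "\<And>x. x > 0 \<Longrightarrow> f x = c" by blast
  have "(Khat_real (- 1 / 2) \<longlongrightarrow> Gamma (1 / 2) / 2) (at_right 0)"
    using Khat_real_tendsto_0[of "- 1 / 2"] by simp
  moreover have "filterlim (\<lambda>x::real. (x / 2)\<^sup>2) (at_right 0) (at_right 0)"
    by real_asymp
  ultimately have "((\<lambda>x. Khat_real (- 1 / 2) ((x / 2)\<^sup>2)) \<longlongrightarrow> Gamma (1 / 2) / 2) (at_right 0)"
    by (rule filterlim_compose)
  hence "(f \<longlongrightarrow> exp 0 * (Gamma (1 / 2) / 2)) (at_right 0)"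
    unfolding f_def by (intro tendsto_intros)
  also have "?this \<longleftrightarrow> ((\<lambda>_. c) \<longlongrightarrow> exp 0 * (Gamma (1 / 2) / 2)) (at_right (0::real))"
    by (intro filterlim_cong refl) (auto simp: eventually_at_filter c)
  finally have "c = sqrt pi / 2"
    by (simp add: tendsto_const_iff Gamma_one_half_real)
  with c[OF assms] have half: "Khat_real (- 1 / 2) ((x / 2)\<^sup>2) = sqrt pi / 2 * exp (- x)"
    by (simp add: f_def exp_minus field_simps)
  have "macdonald (1 / 2) x = (x / 2) powr (- 1 / 2) * Khat_real (- 1 / 2) ((x / 2)\<^sup>2)"
    using macdonald_sym[OF assms, of "1 / 2"] by (simp add: macdonald_def[of "- (1 / 2)"])
  also note half
  also have "(x / 2) powr (- 1 / 2) = x powr (- 1 / 2) * sqrt 2"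
    using assms by (simp add: powr_divide powr_minus powr_half_sqrt field_simps)
  finally have *: "macdonald (1 / 2) x = x powr (- 1 / 2) * sqrt 2 * (sqrt pi / 2 * exp (- x))" .
  have "sqrt (pi / 2) = sqrt 2 * (sqrt pi / 2)" by (simp add: real_sqrt_divide divide_simps)
  with * show ?thesis by (simp only: mult_ac)
qed

text \<open>Term n of \<open>s * Ihat_real (a + 1)\<close> lies below the mean of the terms n and n
  + 1 of \<open>Ihat_real a\<close>. The sum of these means takes every term of
  \<open>Ihat_real a\<close> with total weight 1, except the first, which is nonnegative and has
  weight 1/2.\<close>

lemma modified_bessel_mono:
  assumes "x > 0" "a \<ge> 0"
  shows "modified_bessel (a + 1) x \<le> modified_bessel a x"
proof -
  define s where "s = x / 2"
  have s: "s > 0" "x = 2 * s" using assms by (auto simp: s_def)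
  define c where "c = (\<lambda>a n. rGamma (of_nat n + a + 1) / fact n :: real)"
  have c_nonneg: "c b n \<ge> 0" if "b \<ge> 0" for b n
    using that unfolding c_def by (auto simp: rGamma_inverse_Gamma intro!: Gamma_real_nonneg divide_nonneg_pos)
  have sums: "(\<lambda>n. c b n * (s\<^sup>2) ^ n) sums Ihat_real b (s\<^sup>2)" for b
    unfolding c_def by (rule Ihat_real_sums)
  have "(\<lambda>n. c a (Suc n) * (s\<^sup>2) ^ Suc n) sums (Ihat_real a (s\<^sup>2) - c a 0)"
    using sums[of a] by (subst sums_Suc_iff) simp
  from sums_divide[OF sums_add[OF sums[of a] this], of 2]
  have 1: "(\<lambda>n. (c a n * (s\<^sup>2) ^ n + c a (Suc n) * (s\<^sup>2) ^ Suc n) / 2) sums 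
          ((Ihat_real a (s\<^sup>2) + (Ihat_real a (s\<^sup>2) - c a 0)) / 2)" .
  have 2: "(\<lambda>n. s * (c (a + 1) n * (s\<^sup>2) ^ n)) sums (s * Ihat_real (a + 1) (s\<^sup>2))"
    by (intro sums_mult sums)
  have "s * Ihat_real (a + 1) (s\<^sup>2) \<le> (Ihat_real a (s\<^sup>2) + (Ihat_real a (s\<^sup>2) - c a 0)) / 2"
  proof (rule sums_le[OF _ 2 1])
    fix n
    define d where "d = c (a + 1) n * (s\<^sup>2) ^ n"
    have d: "d \<ge> 0" using c_nonneg[of "a + 1" n] assms by (simp add: d_def)
    define l where "l = real (Suc n)"
    have l: "l > 0" by (simp add: l_def)
    have "rGamma (real n + a + 1) = (real n + a + 1) * rGamma (real n + a + 1 + 1)"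
      using rGamma_plus1[of "real n + a + 1"] by simp
    hence c1: "c a n = (l + a) * c (a + 1) n"
      by (simp add: c_def l_def algebra_simps)
    have c2: "c a (Suc n) = c (a + 1) n / l"
      by (simp add: c_def add_ac l_def divide_simps)
    \<comment> \<open>termwise AM-GM\<close>
    have "s \<le> (l + s\<^sup>2 / l) / 2"
      using l zero_le_power2[of "s - l"] by (simp add: field_simps power2_eq_square)
    also have "\<dots> \<le> (l + a + s\<^sup>2 / l) / 2"
      using assms by simp
    finally have "s * d \<le> (l + a + s\<^sup>2 / l) / 2 * d"
      using d by (rule mult_right_mono)
    also have "\<dots> = (c a n * (s\<^sup>2) ^ n + c a (Suc n) * (s\<^sup>2) ^ Suc n) / 2"
      unfolding c1 c2 d_def by (simp add: field_simps)
    finally show "s * (c (a + 1) n * (s\<^sup>2) ^ n) \<le> (c a n * (s\<^sup>2) ^ n + c a (Suc n) * (s\<^sup>2) ^ Suc n) / 2"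
      by (simp add: d_def)
  qed
  also have "\<dots> \<le> Ihat_real a (s\<^sup>2)"
    using c_nonneg[OF assms(2), of 0] by simp
  finally have "s powr a * (s * Ihat_real (a + 1) (s\<^sup>2)) \<le> s powr a * Ihat_real a (s\<^sup>2)"
    by (intro mult_left_mono) auto
  thus ?thesis using s by (simp add: modified_bessel_def powr_add mult_ac)
qed

lemma macdonald_nonneg: "x > 0 \<Longrightarrow> macdonald a x \<ge> 0"
  unfolding macdonald_cosh(1) by (intro divide_nonneg_pos integral_nonneg) auto

lemma macdonald_half_pos: "x > 0 \<Longrightarrow> macdonald (1 / 2) x > 0"
  by (simp add: macdonald_half)

text \<open>If I_a(x) were not positive, monotonicity in the order would make I_{a+1}(x) nonpositive
  too. Both products in the Wronskian would then be nonpositive, although their sum is 1/x.\<close>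

lemma modified_bessel_pos:
  assumes "x > 0" "a \<ge> 0"
  shows "modified_bessel a x > 0"
proof (rule ccontr)
  assume "\<not> modified_bessel a x > 0"
  with modified_bessel_mono[OF assms] have "modified_bessel (a + 1) x \<le> 0" "modified_bessel a x \<le> 0" by auto
  hence "macdonald a x * modified_bessel (a + 1) x + macdonald (a + 1) x * modified_bessel a x \<le> 0"
    using macdonald_nonneg[OF assms(1)] by (intro add_nonpos_nonpos mult_nonneg_nonpos) auto
  hence "x * (macdonald a x * modified_bessel (a + 1) x + macdonald (a + 1) x * modified_bessel a x) \<le> 0"
    using assms by (intro mult_nonneg_nonpos) auto
  with macdonald_modified_bessel_wronskian[OF assms(1), of a] show False by simp
qed

section \<open>Asymptotics at infinity relative to K_{1/2}\<close>

text \<open>The shape 1 + O(1/x) survives one step of a three-term recurrence. As c may have any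
  sign, the step can go up or down in the order.\<close>

lemma asymp_one_add:
  fixes f g :: "real \<Rightarrow> real"
  assumes "(\<lambda>x. f x - 1) \<in> O(\<lambda>x. 1 / x)" "(\<lambda>x. g x - 1) \<in> O(\<lambda>x. 1 / x)"
  shows "(\<lambda>x. f x + c / x * g x - 1) \<in> O(\<lambda>x. 1 / x)"
proof -
  have "(\<lambda>x::real. 1 / x) \<in> O(\<lambda>_. 1 :: real)" by real_asymp
  with assms(2) have "(\<lambda>x. g x - 1) \<in> O(\<lambda>_. 1)" by (rule landau_o.big_trans)
  hence "(\<lambda>x. (g x - 1) + 1) \<in> O(\<lambda>_. 1)" by (rule sum_in_bigo(1)) simp
  moreover have "(\<lambda>x. c / x) \<in> O(\<lambda>x. 1 / x)"
    by (rule bigoI[where c = "\<bar>c\<bar>"]) simp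
  ultimately have "(\<lambda>x. c / x * g x) \<in> O(\<lambda>x. 1 / x * 1)" by (intro landau_o.big.mult) auto
  hence "(\<lambda>x. (f x - 1) + c / x * g x) \<in> O(\<lambda>x. 1 / x)"
    by (intro sum_in_bigo(1)[OF assms(1)]) simp
  thus ?thesis by (simp add: algebra_simps)
qed

lemma asymp_one_cong:
  fixes f g :: "real \<Rightarrow> real"
  assumes "(\<lambda>x. f x - 1) \<in> O(\<lambda>x. 1 / x)" "\<And>x. x > 0 \<Longrightarrow> f x = g x"
  shows "(\<lambda>x. g x - 1) \<in> O(\<lambda>x. 1 / x)"
proof -
  have "eventually (\<lambda>x. f x - 1 = g x - 1) at_top"
    using eventually_gt_at_top[of 0] by eventually_elim (use assms in auto)
  from landau_o.big.in_cong[OF this] assms(1) show ?thesis by simp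
qed

text \<open>K_{1/2} has a closed form; measuring every order against it postpones all constants and
  powers of x to \<open>K_scale\<close> and \<open>I_scale\<close>.\<close>

abbreviation K_norm where "K_norm a x \<equiv> macdonald a x / macdonald (1 / 2) x"

lemma K_norm_rec: 
  assumes "x > 0"
  shows "K_norm (a + 1) x = K_norm (a - 1) x + (2 * a) / x * K_norm a x"
  using assms by (simp add: macdonald_rec add_divide_distrib)

text \<open>Two consecutive orders are carried along because the recurrence needs both. They start
  at 1/2 and -1/2, where the ratio is exactly 1.\<close>

lemma K_norm_half_int: 
  "(\<lambda>x. K_norm (real n + 1 / 2) x - 1) \<in> O(\<lambda>x. 1 / x) \<and>
   (\<lambda>x. K_norm (real n - 1 / 2) x - 1) \<in> O(\<lambda>x. 1 / x)"
proof (induction n)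
  case 0
  have "(\<lambda>_::real. (1::real) - 1) \<in> O(\<lambda>x. 1 / x)" by simp
  hence "(\<lambda>x. K_norm (1 / 2) x - 1) \<in> O(\<lambda>x. 1 / x)"
    by (rule asymp_one_cong) (use macdonald_half_pos in force)
  moreover from this have "(\<lambda>x. K_norm (- (1 / 2)) x - 1) \<in> O(\<lambda>x. 1 / x)"
    by (rule asymp_one_cong) (simp add: macdonald_sym)
  ultimately show ?case by simp
next
  case (Suc n)
  have "(\<lambda>x. K_norm (real n + 1 / 2 - 1) x + (2 * (real n + 1 / 2)) / x * K_norm (real n + 1 / 2) x - 1) \<in> O(\<lambda>x. 1 / x)"
    using Suc.IH by (intro asymp_one_add) simp_all
  hence "(\<lambda>x. K_norm (real n + 1 / 2 + 1) x - 1) \<in> O(\<lambda>x. 1 / x)"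
    by (rule asymp_one_cong) (simp only: K_norm_rec)
  thus ?case using Suc.IH by (simp add: algebra_simps)
qed

text \<open>Monotonicity in the order squeezes K_a between K_{1/2} and K_{n+1/2}, and both bounds
  are known.\<close>

lemma K_norm_asymp_ge:
  assumes "a \<ge> 1 / 2"
  shows "(\<lambda>x. K_norm a x - 1) \<in> O(\<lambda>x. 1 / x)"
proof -
  obtain n :: nat where n: "real n > a" using reals_Archimedean2 by blast
  have "eventually (\<lambda>x. norm (K_norm a x - 1) \<le> norm (K_norm (real n + 1 / 2) x - 1)) at_top"
    using eventually_gt_at_top[of 0]
  proof eventually_elim
    case (elim x)
    have "macdonald (1 / 2) x \<le> macdonald a x" "macdonald a x \<le> macdonald (real n + 1 / 2) x"
      using n assms elim by (auto intro!: macdonald_mono)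
    thus ?case using macdonald_half_pos[OF elim] by (simp add: abs_if field_simps)
  qed
  hence "(\<lambda>x. K_norm a x - 1) \<in> O(\<lambda>x. K_norm (real n + 1 / 2) x - 1)"
    by (rule landau_o.big_mono)
  also have "(\<lambda>x. K_norm (real n + 1 / 2) x - 1) \<in> O(\<lambda>x. 1 / x)"
    using K_norm_half_int by blast
  finally show ?thesis .
qed

text \<open>Orders between 0 and 1/2 are reached downwards from a + 1 and a + 2 by the recurrence,
  negative orders by evenness in the order.\<close>

lemma K_norm_asymp: "(\<lambda>x. K_norm a x - 1) \<in> O(\<lambda>x. 1 / x)"
proof -
  have *: "(\<lambda>x. K_norm a x - 1) \<in> O(\<lambda>x. 1 / x)" if "a \<ge> 0" for a
  proof -
    have "(\<lambda>x. K_norm (a + 1 + 1) x + (- (2 * (a + 1))) / x * K_norm (a + 1) x - 1) \<in> O(\<lambda>x. 1 / x)"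
      using that by (intro asymp_one_add K_norm_asymp_ge) auto
    thus ?thesis
      by (rule asymp_one_cong) (subst K_norm_rec, simp, simp only: minus_divide_left[symmetric] mult_minus_left, simp)
  qed
  show ?thesis
  proof (cases "a \<ge> 0")
    case False
    hence "(\<lambda>x. K_norm (- a) x - 1) \<in> O(\<lambda>x. 1 / x)" by (intro *) auto
    thus ?thesis by (rule asymp_one_cong) (simp add: macdonald_sym)
  qed (use * in auto)
qed

text \<open>The product 2 x I_a(x) K_b(x) tends to 1, so 1 / (2 x K_{1/2}(x)) is the natural size of
  I_a(x).\<close>

abbreviation I_norm where "I_norm a x \<equiv> modified_bessel a x * (2 * x * macdonald (1 / 2) x)"

text \<open>Divided by I_a and K_{1/2}, the Wronskian reads \<open>I_norm a x * D x = 1\<close> with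
  r = I_{a+1}/I_a, so everything reduces to r = 1 + O(1/x). The bound r \<le> 1 is monotonicity. The
  lower bound comes from the recurrence for I_a, with I_{a+2} replaced by the larger I_{a+1} and the
  other I_{a+1} by the larger I_a.\<close>

lemma I_norm_asymp_nonneg:
  assumes "a \<ge> 0"
  shows "(\<lambda>x. I_norm a x - 1) \<in> O(\<lambda>x. 1 / x)"
proof -
  define r where "r = (\<lambda>x. modified_bessel (a + 1) x / modified_bessel a x)"
  define D where "D = (\<lambda>x. (K_norm a x * r x + K_norm (a + 1) x) / 2)"
  have r: "r x \<le> 1" "r x \<ge> 1 - 2 * (a + 1) / x" "r x \<ge> 0" if "x > 0" for x
  proof -
    have pos: "modified_bessel a x > 0" "modified_bessel (a + 1) x > 0"
      using that assms by (auto intro!: modified_bessel_pos)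
    have mono: "modified_bessel (a + 1 + 1) x \<le> modified_bessel (a + 1) x"
      using that assms by (intro modified_bessel_mono) auto
    show "r x \<le> 1" "r x \<ge> 0" using pos modified_bessel_mono[OF that assms] by (auto simp: r_def)
    have "modified_bessel a x = modified_bessel (a + 1 + 1) x + 2 * (a + 1) / x * modified_bessel (a + 1) x"
      using modified_bessel_rec[OF that, of "a + 1"] by simp
    also have "\<dots> \<le> modified_bessel (a + 1) x + 2 * (a + 1) / x * modified_bessel a x"
      using pos modified_bessel_mono[OF that assms] that assms by (intro add_mono mult_left_mono mono) auto
    finally have "modified_bessel a x / modified_bessel a x \<le> (modified_bessel (a + 1) x + 2 * (a + 1) / x * modified_bessel a x) / modified_bessel a x"
      using pos by (intro divide_right_mono) auto
    thus "r x \<ge> 1 - 2 * (a + 1) / x"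
      using pos by (simp add: r_def add_divide_distrib)
  qed
  have r1: "(\<lambda>x. r x - 1) \<in> O(\<lambda>x. 1 / x)"
  proof (rule bigoI[where c = "2 * (a + 1)"])
    show "eventually (\<lambda>x. norm (r x - 1) \<le> 2 * (a + 1) * norm (1 / x)) at_top"
      using eventually_gt_at_top[of 0]
    proof eventually_elim
      case (elim x)
      thus ?case using r[OF elim] by simp
    qed
  qed
  have r2: "r \<in> O(\<lambda>_. 1)"
  proof (rule bigoI[where c = 1])
    show "eventually (\<lambda>x. norm (r x) \<le> 1 * norm (1::real)) at_top"
      using eventually_gt_at_top[of 0] by eventually_elim (use r in auto)
  qed
  have "(\<lambda>x. (K_norm a x - 1) * r x + (r x - 1) + (K_norm (a + 1) x - 1)) \<in> O(\<lambda>x. 1 / x)"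
    using landau_o.big.mult[OF K_norm_asymp r2] by (intro sum_in_bigo r1 K_norm_asymp) auto
  hence "(\<lambda>x. ((K_norm a x - 1) * r x + (r x - 1) + (K_norm (a + 1) x - 1)) / 2) \<in> O(\<lambda>x. 1 / x)"
    by simp
  hence D1: "(\<lambda>x. D x - 1) \<in> O(\<lambda>x. 1 / x)"
    by (simp add: D_def algebra_simps add_divide_distrib diff_divide_distrib)
  have "(\<lambda>x::real. 1 / x) \<in> o(\<lambda>_. 1 :: real)" by real_asymp
  with D1 have "(\<lambda>x. D x - 1) \<in> o(\<lambda>_. 1)" by (rule landau_o.big_small_trans)
  hence "((\<lambda>x. D x - 1) \<longlongrightarrow> 0) at_top" by (auto dest: smalloD_tendsto)
  hence Dlim: "(D \<longlongrightarrow> 1) at_top" by (simp add: LIM_zero_iff)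
  have "((\<lambda>x. inverse (D x)) \<longlongrightarrow> inverse 1) at_top"
    by (intro tendsto_intros Dlim) auto
  hence Dinv: "(\<lambda>x. inverse (D x)) \<in> O(\<lambda>_. 1)"
    by (intro bigoI_tendsto[where c = 1]) auto
  \<comment> \<open>This is 1/D - 1 in factored form; 1/D is bounded because D tends to 1.\<close>
  have "(\<lambda>x. - (D x - 1) * inverse (D x)) \<in> O(\<lambda>x. 1 / x * 1)"
    by (intro landau_o.big.mult Dinv) (unfold landau_o.big.uminus_in_iff, rule D1)
  moreover have "eventually (\<lambda>x. - (D x - 1) * inverse (D x) = I_norm a x - 1) at_top"
    using eventually_gt_at_top[of 0]
  proof eventually_elim
    case (elim x)
    have K: "macdonald (1 / 2) x > 0" and I: "modified_bessel a x > 0" using macdonald_half_pos[OF elim] modified_bessel_pos[OF elim assms] by auto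
    have "I_norm a x * D x = x * (macdonald a x * modified_bessel (a + 1) x + macdonald (a + 1) x * modified_bessel a x)"
      using K I by (simp add: D_def r_def field_simps)
    also have "\<dots> = 1" using elim by (rule macdonald_modified_bessel_wronskian)
    finally show ?case by (auto simp: divide_simps algebra_simps)
  qed
  ultimately show ?thesis using landau_o.big.in_cong by fastforce
qed

lemma I_norm_asymp: "(\<lambda>x. I_norm a x - 1) \<in> O(\<lambda>x. 1 / x)"
proof -
  have "(\<lambda>x. I_norm a x - 1) \<in> O(\<lambda>x. 1 / x)" if "a \<ge> - real n" for n a
    using that
  proof (induction n arbitrary: a)
    case 0
    thus ?case by (intro I_norm_asymp_nonneg) auto
  next
    case (Suc n)
    have "(\<lambda>x. I_norm (a + 1 + 1) x + 2 * (a + 1) / x * I_norm (a + 1) x - 1) \<in> O(\<lambda>x. 1 / x)"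
      using Suc.prems by (intro asymp_one_add Suc.IH) auto
    thus ?case
      by (rule asymp_one_cong) (use modified_bessel_rec[of _ "a + 1"] in \<open>simp add: algebra_simps\<close>)
  qed
  moreover obtain n :: nat where "a \<ge> - real n" using real_arch_simple[of "- a"] by (auto simp: minus_le_iff)
  ultimately show ?thesis by blast
qed

section \<open>Laurent coefficients\<close>

text \<open>The sum is known only off t = 0, so the comparison passes through Laurent expansions,
  which ignore the value at the centre.\<close>

lemma fps_eq_of_sums:
  fixes C :: "nat \<Rightarrow> complex"
  assumes F: "f has_fps_expansion F" and "r > 0"
    and sums: "\<And>t. t \<noteq> 0 \<Longrightarrow> norm t < r \<Longrightarrow> (\<lambda>n. C n * t ^ n) sums f t"
  shows "Abs_fps C = F"
proof -
  define H where "H = Abs_fps C"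
  have "fps_conv_radius H > 0"
  proof -
    have "summable (\<lambda>n. fps_nth H n * of_real (r / 2) ^ n)"
      using sums[of "of_real (r / 2)"] \<open>r > 0\<close> by (auto simp: H_def sums_iff)
    hence "fps_conv_radius H \<ge> norm (complex_of_real (r / 2))"
      unfolding fps_conv_radius_def by (rule conv_radius_geI)
    thus ?thesis using \<open>r > 0\<close> by (auto simp: zero_ereal_def elim!: order.strict_trans2[rotated])
  qed
  hence "eval_fps H has_laurent_expansion fps_to_fls H"
    using eval_fps_has_fps_expansion has_laurent_expansion_fps by blast
  also have "?this \<longleftrightarrow> f has_laurent_expansion fps_to_fls H"
  proof (intro has_laurent_expansion_cong refl)
    have "eval_fps H t = f t" if "t \<noteq> 0" "norm t < r" for t
      using sums[OF that] by (simp add: eval_fps_def H_def sums_iff)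
    thus "eventually (\<lambda>t. eval_fps H t = f t) (at 0)"
      using \<open>r > 0\<close> by (auto simp: eventually_at dist_norm)
  qed
  finally have "fps_to_fls H = fps_to_fls F"
    using F has_laurent_expansion_fps has_laurent_expansion_unique by blast
  thus ?thesis by (simp add: H_def)
qed

text \<open>The definite description requires uniqueness among all representations, whose pole bound
  M and radius are arbitrary. Multiplication by t^(N + M) turns both representations into power
  series of one function.\<close>

lemma laurent_coeff_eq:
  assumes F: "f has_fps_expansion F"
    and g: "eventually (\<lambda>t. g t = t powi (- int N) * f t) (at 0)"
  shows "laurent_coeff g = (\<lambda>j. if j < - int N then 0 else fps_nth F (nat (j + int N)))"
proof -
  define c where "c = (\<lambda>j. if j < - int N then 0 else fps_nth F (nat (j + int N)))"
  obtain r1 where r1: "r1 > 0" "\<And>t. t \<noteq> 0 \<Longrightarrow> norm t < r1 \<Longrightarrow> g t = t powi (- int N) * f t"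
    using g by (auto simp: eventually_at dist_norm)
  obtain r2 where r2: "r2 > 0" "\<And>t. norm t < r2 \<Longrightarrow> eval_fps F t = f t"
    using F by (auto simp: has_fps_expansion_def eventually_nhds_metric dist_norm)
  obtain r3 where r3: "r3 > 0" "\<And>t::complex. norm t < r3 \<Longrightarrow> ereal (norm t) < fps_conv_radius F"
  proof -
    have "0 < fps_conv_radius F" using F by (simp add: has_fps_expansion_def)
    then obtain q where "0 < ereal q" "ereal q < fps_conv_radius F" using ereal_dense2 by blast
    thus ?thesis by (intro that[of q]) (auto intro: order.strict_trans[of _ "ereal q"])
  qed
  have fsums: "(\<lambda>n. fps_nth F n * t ^ n) sums f t" if "norm t < min r2 r3" for t
    using sums_eval_fps[OF r3(2), of t] r2(2)[of t] that by simp
  have "laurent_coeff g = c"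
    unfolding laurent_coeff_def
  proof (rule the_equality)
    show "\<exists>N. \<exists>r>0. (\<forall>j < - int N. c j = 0) \<and> (\<forall>t. 0 < norm t \<and> norm t < r \<longrightarrow>
         (\<lambda>n. c (int n - int N) * t powi (int n - int N)) sums g t)"
    proof (intro exI[of _ N] exI[of _ "min r1 (min r2 r3)"] conjI allI impI)
      fix t :: complex assume t: "0 < norm t \<and> norm t < min r1 (min r2 r3)"
      have "(\<lambda>n. t powi (- int N) * (fps_nth F n * t ^ n)) sums (t powi (- int N) * f t)"
        using t by (intro sums_mult fsums) auto
      also have "t powi (- int N) * f t = g t" using t r1 by auto
      also have "(\<lambda>n. t powi (- int N) * (fps_nth F n * t ^ n)) = (\<lambda>n. c (int n - int N) * t powi (int n - int N))"
        using t by (auto simp: c_def power_int_diff power_int_minus field_simps)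
      finally show "(\<lambda>n. c (int n - int N) * t powi (int n - int N)) sums g t" .
    qed (use r1 r2 r3 in \<open>auto simp: c_def\<close>)
  next
    fix c' assume "\<exists>N. \<exists>r>0. (\<forall>j < - int N. c' j = 0) \<and> (\<forall>t. 0 < norm t \<and> norm t < r \<longrightarrow>
         (\<lambda>n. c' (int n - int N) * t powi (int n - int N)) sums g t)"
    then obtain M r where M: "r > 0" "\<And>j. j < - int M \<Longrightarrow> c' j = 0"
      "\<And>t. t \<noteq> 0 \<Longrightarrow> norm t < r \<Longrightarrow> (\<lambda>n. c' (int n - int M) * t powi (int n - int M)) sums g t"
      by auto
    \<comment> \<open>The coefficients of t^(N + M) g(t), which equals t^M f(t). They begin with N
      zeros because c' starts at index -M.\<close>
    define C where "C = (\<lambda>n. if n < N then 0 else c' (int n - int N - int M))"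
    have "Abs_fps C = fps_X ^ M * F"
    proof (rule fps_eq_of_sums)
      show "(\<lambda>t. t ^ M * f t) has_fps_expansion fps_X ^ M * F"
        by (intro fps_expansion_intros F)
      show "min r r1 > 0" using M r1 by auto
      fix t :: complex assume t: "t \<noteq> 0" "norm t < min r r1"
      have "(\<lambda>n. t ^ (N + M) * (c' (int n - int M) * t powi (int n - int M))) sums (t ^ (N + M) * g t)"
        using t by (intro sums_mult M) auto
      also have "t ^ (N + M) * g t = t ^ M * f t"
        using t r1 by (simp add: power_add power_int_minus)
      also have "(\<lambda>n. t ^ (N + M) * (c' (int n - int M) * t powi (int n - int M))) = (\<lambda>n. C (n + N) * t ^ (n + N))"
        using t by (auto simp: C_def power_add power_int_diff field_simps)
      finally have "(\<lambda>n. C (n + N) * t ^ (n + N)) sums (t ^ M * f t)" .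
      moreover have "(\<Sum>n<N. C n * t ^ n) = 0" by (simp add: C_def)
      ultimately show "(\<lambda>n. C n * t ^ n) sums (t ^ M * f t)"
        using sums_iff_shift[of "\<lambda>n. C n * t ^ n" N] by simp
    qed
    hence C: "C n = (if n < M then 0 else fps_nth F (n - M))" for n
      by (metis fps_X_power_mult_nth fps_nth_Abs_fps)
    show "c' = c"
    proof
      fix j
      show "c' j = c j"
      proof (cases "j + int N + int M < 0")
        case True
        hence "j < - int M" "j < - int N" by auto
        thus ?thesis using M(2) by (simp add: c_def)
      next
        case False
        define n where "n = nat (j + int N + int M)"
        have n: "int n = j + int N + int M" using False by (simp add: n_def)
        have "nat (j + int N) = n - M" "int n - int N - int M = j" using n by auto
        thus ?thesis
          using C[of n] n M(2)[of j] unfolding C_def c_def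
          by (auto split: if_splits)
      qed
    qed
  qed
  thus ?thesis by (simp add: c_def)
qed

section \<open>Taylor expansion of the generating functions\<close>

definition neg_binomial_fps :: "complex \<Rightarrow> complex fps" where
  "neg_binomial_fps s = Abs_fps (\<lambda>n. pochhammer s n / fact n)"

lemma has_fps_expansion_neg_binomial:
  "(\<lambda>t. (1 - t) powr (- s)) has_fps_expansion neg_binomial_fps s"
proof -
  have "((\<lambda>x. (1 + x) powr (- s)) \<circ> (\<lambda>t. - t)) has_fps_expansion (fps_binomial (- s) oo - fps_X)"
    by (intro has_fps_expansion_compose has_fps_expansion_binomial_complex fps_expansion_intros) auto
  also have "fps_binomial (- s) oo - fps_X = neg_binomial_fps s"
    by (simp add: fps_eq_iff neg_binomial_fps_def fps_compose_uminus' gbinomial_pochhammer)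
  finally show ?thesis by (simp add: o_def)
qed

definition sq_fps :: "complex fps" where "sq_fps = neg_binomial_fps 2"

lemma has_fps_expansion_sq_fps: "(\<lambda>t. 1 / (1 - t)\<^sup>2) has_fps_expansion sq_fps"
proof -
  have "(1 - t) powr (- 2) = 1 / (1 - t)\<^sup>2" if "t \<noteq> 1" for t :: complex
    using that by (simp add: powr_minus divide_inverse)
  moreover have "eventually (\<lambda>t. t \<in> - {1}) (nhds (0::complex))"
    by (intro eventually_nhds_in_open) auto
  ultimately have "eventually (\<lambda>t. (1 - t) powr (- 2) = 1 / (1 - t)\<^sup>2) (nhds (0::complex))"
    by (auto elim: eventually_mono)
  from has_fps_expansion_cong[OF this refl] show ?thesis
    using has_fps_expansion_neg_binomial[of 2] by (simp add: sq_fps_def)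
qed

text \<open>The coefficient of $t^j$ in $(1-t)^{-s}\,(t/(1-t))^{2n}\,((1-t)^{-2}-1)^k$.\<close>

definition G_coeff :: "complex \<Rightarrow> nat \<Rightarrow> nat \<Rightarrow> nat \<Rightarrow> complex" where
  "G_coeff s n k j = fps_nth (neg_binomial_fps s * (fps_X ^ 2 * sq_fps) ^ n * (sq_fps - 1) ^ k) j"

lemma G_coeff_0: "G_coeff s 0 0 j = pochhammer s j / fact j"
  by (simp add: G_coeff_def neg_binomial_fps_def)

text \<open>Both t^2/(1-t)^2 and (1-t)^(-2) - 1 vanish at 0, to the orders 2 and 1 and with leading
  coefficients 1 and 2. Hence the product starts with 2^k t^(2n+k).\<close>

lemma
  shows G_coeff_eq_0: "2 * n + k > j \<Longrightarrow> G_coeff s n k j = 0"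
    and G_coeff_top: "2 * n + k = j \<Longrightarrow> G_coeff s n k j = 2 ^ k"
proof -
  define V where "V = fps_shift 1 (sq_fps - 1)"
  have 0: "fps_nth (sq_fps - 1) 0 = 0" and 1: "fps_nth V 0 = 2"
    by (simp_all add: sq_fps_def neg_binomial_fps_def V_def)
  have "sq_fps - 1 = fps_X * V"
    unfolding V_def using 0 by (simp add: fps_eq_iff)
  hence "neg_binomial_fps s * (fps_X ^ 2 * sq_fps) ^ n * (sq_fps - 1) ^ k =
     fps_X ^ (2 * n + k) * (neg_binomial_fps s * sq_fps ^ n * V ^ k)"
    unfolding power_mult_distrib power_add power_mult by (simp only: power_mult_distrib mult_ac)
  hence eq: "G_coeff s n k j = fps_nth (fps_X ^ (2 * n + k) * (neg_binomial_fps s * sq_fps ^ n * V ^ k)) j"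
    by (simp only: G_coeff_def)
  show "2 * n + k > j \<Longrightarrow> G_coeff s n k j = 0"
    unfolding eq by (simp add: fps_X_power_mult_nth)
  show "2 * n + k = j \<Longrightarrow> G_coeff s n k j = 2 ^ k"
    unfolding eq fps_X_power_mult_nth
    by (simp add: fps_mult_nth_0 fps_power_zeroth 1) (simp add: sq_fps_def neg_binomial_fps_def)
qed

lemma fps_mult_nth_cong:
  assumes "\<And>i. i \<le> j \<Longrightarrow> fps_nth f i = fps_nth f' i" "\<And>i. i \<le> j \<Longrightarrow> fps_nth g i = fps_nth g' i"
  shows "fps_nth (f * g) j = fps_nth (f' * g') j"
  unfolding fps_mult_nth by (intro sum.cong) (use assms in auto)

text \<open>The index set is the whole square n, k \<le> j; pairs with 2n + k > j contribute 0 by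
  \<open>G_coeff_eq_0\<close>.\<close>

definition G_coeff_sum :: "complex \<Rightarrow> (nat \<Rightarrow> complex) \<Rightarrow> (nat \<Rightarrow> complex) \<Rightarrow> complex \<Rightarrow> nat \<Rightarrow> complex" where
  "G_coeff_sum s A B w j = (\<Sum>n\<le>j. \<Sum>k\<le>j. A n * B k * w ^ (n + k) * G_coeff s n k j)"

lemma fps_compose_trunc:
  fixes U :: "complex fps"
  assumes "fps_nth U 0 = 0" "i \<le> j"
  shows "fps_nth (Abs_fps A oo (fps_const w * U)) i = fps_nth (\<Sum>n\<le>j. fps_const (A n * w ^ n) * U ^ n) i"
proof -
  have "fps_nth (\<Sum>n\<le>j. fps_const (A n * w ^ n) * U ^ n) i = (\<Sum>n\<le>j. A n * w ^ n * fps_nth (U ^ n) i)"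
    by (simp add: fps_sum_nth)
  also have "\<dots> = (\<Sum>n\<le>i. A n * w ^ n * fps_nth (U ^ n) i)"
    using assms by (intro sum.mono_neutral_right) (use startsby_zero_power_prefix[OF assms(1)] in \<open>auto simp: not_le\<close>)
  also have "\<dots> = fps_nth (Abs_fps A oo (fps_const w * U)) i"
    by (simp add: fps_compose_nth power_mult_distrib fps_const_power atLeast0AtMost mult_ac)
  finally show ?thesis ..
qed

text \<open>At t = 0 the arguments of F1 and F2 are 0 and w, so F1 is expanded at 0 and F2 at w. The
  inner series then have zero constant term, and a coefficient of t^j involves only the terms up to
  j of each outer series.\<close>

lemma G_has_fps_expansion:
  assumes F1: "F1 has_fps_expansion Abs_fps A"
    and F2: "(\<lambda>h. F2 (w + h)) has_fps_expansion Abs_fps B"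
  shows "(\<lambda>t. (1 - t) powr (- s) * F1 (w * (t\<^sup>2 * (1 / (1 - t)\<^sup>2))) * F2 (w * (1 / (1 - t)\<^sup>2)))
           has_fps_expansion Abs_fps (G_coeff_sum s A B w)"
proof -
  let ?U = "fps_X ^ 2 * sq_fps" and ?V = "sq_fps - 1"
  have V0: "fps_nth ?V 0 = 0" by (simp add: sq_fps_def neg_binomial_fps_def)
  have 1: "(F1 \<circ> (\<lambda>t. w * (t\<^sup>2 * (1 / (1 - t)\<^sup>2)))) has_fps_expansion (Abs_fps A oo (fps_const w * ?U))"
    by (intro has_fps_expansion_compose F1 fps_expansion_intros has_fps_expansion_sq_fps) auto
  have 2: "((\<lambda>h. F2 (w + h)) \<circ> (\<lambda>t. w * (1 / (1 - t)\<^sup>2 - 1))) has_fps_expansion (Abs_fps B oo (fps_const w * ?V))"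
    by (intro has_fps_expansion_compose F2 fps_expansion_intros has_fps_expansion_sq_fps) (use V0 in auto)
  let ?G = "neg_binomial_fps s * (Abs_fps A oo (fps_const w * ?U)) * (Abs_fps B oo (fps_const w * ?V))"
  have "(\<lambda>t. (1 - t) powr (- s) * F1 (w * (t\<^sup>2 * (1 / (1 - t)\<^sup>2))) * F2 (w * (1 / (1 - t)\<^sup>2))) has_fps_expansion ?G"
    using has_fps_expansion_mult[OF has_fps_expansion_mult[OF has_fps_expansion_neg_binomial[of s] 1] 2]
    by (simp add: o_def algebra_simps)
  moreover have "?G = Abs_fps (G_coeff_sum s A B w)"
  proof (rule fps_ext)
    fix j
    have "fps_nth ?G j = fps_nth (neg_binomial_fps s * (\<Sum>n\<le>j. fps_const (A n * w ^ n) * ?U ^ n) *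
             (\<Sum>k\<le>j. fps_const (B k * w ^ k) * ?V ^ k)) j"
      by (intro fps_mult_nth_cong fps_compose_trunc refl V0) auto
    also have "neg_binomial_fps s * (\<Sum>n\<le>j. fps_const (A n * w ^ n) * ?U ^ n) *
             (\<Sum>k\<le>j. fps_const (B k * w ^ k) * ?V ^ k) =
       (\<Sum>n\<le>j. \<Sum>k\<le>j. fps_const (A n * B k * w ^ (n + k)) * (neg_binomial_fps s * ?U ^ n * ?V ^ k))"
      unfolding mult.assoc sum_product unfolding sum_distrib_left
      by (intro sum.cong refl) (simp add: power_add mult_ac flip: fps_const_mult)
    also have "fps_nth \<dots> j = G_coeff_sum s A B w j"
      by (simp add: fps_sum_nth G_coeff_sum_def G_coeff_def)
    finally show "fps_nth ?G j = fps_nth (Abs_fps (G_coeff_sum s A B w)) j" by simp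
  qed
  ultimately show ?thesis by simp
qed

text \<open>The sign \<sigma> lets one argument serve both families: 1 for \<open>Ihat\<close>, - 1
  for \<open>Khat\<close>.\<close>

lemma higher_deriv_shift:
  fixes F :: "complex \<Rightarrow> complex \<Rightarrow> complex"
  assumes "open S" "w \<in> S"
    and F: "\<And>a w. w \<in> S \<Longrightarrow> (F a has_field_derivative \<sigma> * F (a + 1) w) (at w)"
  shows "(deriv ^^ k) (F a) w = \<sigma> ^ k * F (a + of_nat k) w"
  using \<open>w \<in> S\<close>
proof (induction k arbitrary: w)
  case (Suc k)
  have "eventually (\<lambda>z. z \<in> S) (nhds w)"
    using Suc.prems \<open>open S\<close> by (intro eventually_nhds_in_open)
  hence "eventually (\<lambda>z. (deriv ^^ k) (F a) z = \<sigma> ^ k * F (a + of_nat k) z) (nhds w)"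
    by eventually_elim (rule Suc.IH)
  hence "deriv ((deriv ^^ k) (F a)) w = deriv (\<lambda>z. \<sigma> ^ k * F (a + of_nat k) z) w"
    by (intro deriv_cong_ev refl)
  also have "\<dots> = \<sigma> ^ k * (\<sigma> * F (a + of_nat k + 1) w)"
    using Suc.prems by (intro DERIV_imp_deriv DERIV_cmult F)
  finally show ?case by (simp add: algebra_simps)
qed simp

lemma has_fps_expansion_shift:
  fixes F :: "complex \<Rightarrow> complex \<Rightarrow> complex"
  assumes "open S" "w \<in> S"
    and F: "\<And>a w. w \<in> S \<Longrightarrow> (F a has_field_derivative \<sigma> * F (a + 1) w) (at w)"
  shows "(\<lambda>h. F a (w + h)) has_fps_expansion Abs_fps (\<lambda>k. \<sigma> ^ k * F (a + of_nat k) w / fact k)"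
proof -
  have "F a holomorphic_on S"
    by (rule holomorphic_onI, rule field_differentiable_at_within)
       (auto simp: field_differentiable_def intro: F)
  hence "F a analytic_on {w}"
    using assms by (auto simp: analytic_at)
  hence "(\<lambda>h. F a (w + h)) has_fps_expansion fps_expansion (F a) w"
    by (rule analytic_at_imp_has_fps_expansion)
  also have "fps_expansion (F a) w = Abs_fps (\<lambda>k. \<sigma> ^ k * F (a + of_nat k) w / fact k)"
    unfolding fps_expansion_def using higher_deriv_shift[of S w F, OF assms(1,2) F] by simp
  finally show ?thesis .
qed

definition Ihat_coeff :: "complex \<Rightarrow> nat \<Rightarrow> complex" where
  "Ihat_coeff \<mu> n = rGamma (of_nat n + \<mu> / 2 + 1) / fact n"

lemma Ihat_has_fps_expansion: "Ihat (\<mu> / 2) has_fps_expansion Abs_fps (Ihat_coeff \<mu>)"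
  using has_fps_expansion_shift[of UNIV 0 Ihat 1 "\<mu> / 2"] Ihat_has_field_derivative
  by (simp add: Ihat_coeff_def[abs_def] add_ac)

definition sqhalf :: "real \<Rightarrow> complex" where "sqhalf x = of_real ((x / 2)\<^sup>2)"

definition Lambda_sum :: "complex \<Rightarrow> (complex \<Rightarrow> complex \<Rightarrow> complex) \<Rightarrow> complex \<Rightarrow> real \<Rightarrow> nat \<Rightarrow> real \<Rightarrow> complex" where
  "Lambda_sum \<sigma> F \<mu> \<nu> j x = G_coeff_sum ((\<mu> + of_real \<nu> + 2) / 2) (Ihat_coeff \<mu>)
     (\<lambda>k. \<sigma> ^ k * F (of_real \<nu> / 2 + of_nat k) (sqhalf x) / fact k) (sqhalf x) j"

definition G_product :: "(complex \<Rightarrow> complex \<Rightarrow> complex) \<Rightarrow> complex \<Rightarrow> real \<Rightarrow> real \<Rightarrow> complex \<Rightarrow> complex" where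
  "G_product F \<mu> \<nu> x t = (1 - t) powr (- ((\<mu> + of_real \<nu> + 2) / 2)) * Ihat (\<mu> / 2) (sqhalf x * (t\<^sup>2 * (1 / (1 - t)\<^sup>2))) *
      F (of_real \<nu> / 2) (sqhalf x * (1 / (1 - t)\<^sup>2))"

lemma G_product_has_fps_expansion:
  assumes "x > 0" and F: "\<And>a w. Re w > 0 \<Longrightarrow> (F a has_field_derivative \<sigma> * F (a + 1) w) (at w)"
  shows "G_product F \<mu> \<nu> x has_fps_expansion Abs_fps (\<lambda>j. Lambda_sum \<sigma> F \<mu> \<nu> j x)"
  unfolding G_product_def[abs_def] Lambda_sum_def
  by (rule G_has_fps_expansion[OF Ihat_has_fps_expansion has_fps_expansion_shift[where S = "{w. Re w > 0}"]])
     (use assms in \<open>auto simp: sqhalf_def open_halfspace_Re_gt\<close>)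

lemma G_product_Ihat: "x > 0 \<Longrightarrow> G_product Ihat \<mu> \<nu> x has_fps_expansion Abs_fps (\<lambda>j. Lambda_sum 1 Ihat \<mu> \<nu> j x)"
  by (rule G_product_has_fps_expansion) (auto simp: Ihat_has_field_derivative)

lemma G_product_Khat: "x > 0 \<Longrightarrow> G_product Khat \<mu> \<nu> x has_fps_expansion Abs_fps (\<lambda>j. Lambda_sum (- 1) Khat \<mu> \<nu> j x)"
  by (rule G_product_has_fps_expansion) (auto simp: Khat_has_field_derivative)

lemma sqhalf_eq:
  shows "((complex_of_real x / (1 - t)) / 2)\<^sup>2 = sqhalf x * (1 / (1 - t)\<^sup>2)"
    and "((t * complex_of_real x / (1 - t)) / 2)\<^sup>2 = sqhalf x * (t\<^sup>2 * (1 / (1 - t)\<^sup>2))"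
  unfolding sqhalf_def power_divide power_mult_distrib of_real_power of_real_divide by (simp_all add: mult_ac)

text \<open>Near t = 0 the point x/(1-t) is close to x > 0, so it and the square of its half have
  positive real part, as the identification with the integral requires.\<close>

lemma eventually_Ktilde:
  assumes "x > 0"
  shows "eventually (\<lambda>t. Ktilde a (of_real x / (1 - t)) = Khat a (sqhalf x * (1 / (1 - t)\<^sup>2))) (at 0)"
proof -
  have "((\<lambda>t. Re (complex_of_real x / (1 - t))) \<longlongrightarrow> Re (complex_of_real x / (1 - 0))) (at 0)"
    by (intro tendsto_intros) auto
  hence "eventually (\<lambda>t. Re (complex_of_real x / (1 - t)) > 0) (at 0)"
    by (rule order_tendstoD) (use assms in auto)
  moreover have "((\<lambda>t. Re (((complex_of_real x / (1 - t)) / 2)\<^sup>2)) \<longlongrightarrow> Re (((complex_of_real x / (1 - 0)) / 2)\<^sup>2)) (at 0)"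
    by (intro tendsto_intros) auto
  hence "eventually (\<lambda>t. Re (((complex_of_real x / (1 - t)) / 2)\<^sup>2) > 0) (at 0)"
    by (rule order_tendstoD) (use assms in \<open>auto simp: power2_eq_square\<close>)
  ultimately show ?thesis
    by eventually_elim (simp only: Ktilde_eq_Khat sqhalf_eq)
qed

lemma Lambda_1:
  assumes "x > 0" "j \<ge> 0"
  shows "Lambda 1 \<mu> \<nu> j x = Lambda_sum 1 Ihat \<mu> \<nu> (nat j) x"
proof -
  have "Gfun 1 \<mu> \<nu> t x = t powi (- int 0) * G_product Ihat \<mu> \<nu> x t" for t
    unfolding Gfun_def G_product_def Let_def Itilde_conv_Ihat sqhalf_eq by simp
  hence "laurent_coeff (\<lambda>t. Gfun 1 \<mu> \<nu> t x) =
     (\<lambda>j. if j < - int 0 then 0 else fps_nth (Abs_fps (\<lambda>j. Lambda_sum 1 Ihat \<mu> \<nu> j x)) (nat (j + int 0)))"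
    by (intro laurent_coeff_eq[OF G_product_Ihat]) (use assms in auto)
  thus ?thesis using assms by (simp add: Lambda_def)
qed

lemma Lambda_2:
  assumes "x > 0" "j \<ge> 0"
  shows "Lambda 2 \<mu> \<nu> j x = Lambda_sum (- 1) Khat \<mu> \<nu> (nat j) x"
proof -
  have "eventually (\<lambda>t. Gfun 2 \<mu> \<nu> t x = t powi (- int 0) * G_product Khat \<mu> \<nu> x t) (at 0)"
    using eventually_Ktilde[OF assms(1), of "of_real \<nu> / 2"]
    unfolding Gfun_def G_product_def Let_def Itilde_conv_Ihat sqhalf_eq by eventually_elim simp
  hence "laurent_coeff (\<lambda>t. Gfun 2 \<mu> \<nu> t x) =
     (\<lambda>j. if j < - int 0 then 0 else fps_nth (Abs_fps (\<lambda>j. Lambda_sum (- 1) Khat \<mu> \<nu> j x)) (nat (j + int 0)))"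
    by (intro laurent_coeff_eq[OF G_product_Khat]) (use assms in auto)
  thus ?thesis using assms by (simp add: Lambda_def)
qed

section \<open>Odd \<mu>: Laurent expansions of G_3 and G_4\<close>

lemma half_odd_not_Ints:
  assumes "odd m"
  shows "of_nat m / 2 \<notin> (\<int> :: complex set)"
proof
  assume "of_nat m / 2 \<in> (\<int> :: complex set)"
  then obtain i where "of_nat m / 2 = (of_int i :: complex)" by (auto elim: Ints_cases)
  hence "(of_int (int m) :: complex) = of_int (2 * i)" by (simp add: field_simps)
  hence "int m = 2 * i" by (simp only: of_int_eq_iff)
  thus False using assms by presburger
qed

text \<open>At order m/2 the power in \<open>Ktilde_nonint\<close> is the integer power (z/2)^(-m),
  which gives a pole in t instead of a branch point. Its factor (1-t)^m changes the exponent of the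
  prefactor from that of \<mu> = m to that of \<mu> = -m, so the first series becomes a generating
  function for -m. The second Bessel factor enters only as \<open>y\<close>.\<close>

lemma Ktilde_half_odd:
  assumes "odd m" "x > 0" "t \<noteq> 0" "t \<noteq> 1"
  defines "c \<equiv> of_real pi / 2 / sin (of_real pi * (of_nat m / 2)) :: complex"
  shows "(1 - t) powr (- ((of_nat m + of_real \<nu> + 2) / 2)) * Ktilde (of_nat m / 2) (t * of_real x / (1 - t)) * y =
     t powi (- int m) * (c * (of_real ((x / 2) powr (- real m)) *
       ((1 - t) powr (- ((- of_nat m + of_real \<nu> + 2) / 2)) * Ihat (- of_nat m / 2) (sqhalf x * (t\<^sup>2 * (1 / (1 - t)\<^sup>2))) * y)
       - t ^ m * ((1 - t) powr (- ((of_nat m + of_real \<nu> + 2) / 2)) * Ihat (of_nat m / 2) (sqhalf x * (t\<^sup>2 * (1 / (1 - t)\<^sup>2))) * y)))"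
proof -
  define z where "z = t * of_real x / (1 - t)"
  define p where "p = (1 - t) powr (- ((of_nat m + of_real \<nu> + 2) / 2))"
  define A B where "A = Ihat (- of_nat m / 2) (sqhalf x * (t\<^sup>2 * (1 / (1 - t)\<^sup>2)))"
    and "B = Ihat (of_nat m / 2) (sqhalf x * (t\<^sup>2 * (1 / (1 - t)\<^sup>2)))"
  have z: "z \<noteq> 0" using assms by (simp add: z_def)
  have zW: "(z / 2)\<^sup>2 = sqhalf x * (t\<^sup>2 * (1 / (1 - t)\<^sup>2))" unfolding z_def by (rule sqhalf_eq)
  have zp: "(z / 2) powr (- 2 * (of_nat m / 2)) = inverse ((z / 2) ^ m)"
    using z by (simp add: powr_minus powr_nat')
  have K: "Ktilde (of_nat m / 2) z = c * (inverse ((z / 2) ^ m) * A - B)"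
    unfolding Ktilde_nonint[OF half_odd_not_Ints[OF assms(1)] z] zp zW c_def A_def B_def by simp
  have p': "(1 - t) powr (- ((- of_nat m + of_real \<nu> + 2) / 2)) = p * (1 - t) ^ m"
  proof -
    have "- ((- of_nat m + of_real \<nu> + 2) / 2 :: complex) = - ((of_nat m + of_real \<nu> + 2) / 2) + of_nat m"
      by (simp add: field_simps)
    hence "(1 - t) powr (- ((- of_nat m + of_real \<nu> + 2) / 2)) = p * (1 - t) powr (of_nat m)"
      unfolding p_def powr_add[symmetric] by (rule arg_cong)
    thus ?thesis using assms(4) by (simp add: powr_nat')
  qed
  define q where "q = complex_of_real ((x / 2) ^ m)"
  have zq: "(z / 2) ^ m = t ^ m * q / (1 - t) ^ m"
    unfolding z_def q_def power_divide power_mult_distrib by (simp add: power_divide)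
  have "complex_of_real ((x / 2) powr (- real m)) = inverse q"
    using assms(2) by (simp add: q_def powr_minus powr_realpow)
  hence i: "inverse ((z / 2) ^ m) = (1 - t) ^ m * of_real ((x / 2) powr (- real m)) * inverse (t ^ m)"
    unfolding zq by (simp only: divide_inverse inverse_mult_distrib inverse_inverse_eq mult_ac)
  have ti: "t powi (- int m) = inverse (t ^ m)" by (simp add: power_int_minus)
  have "p * Ktilde (of_nat m / 2) z * y = inverse (t ^ m) * (c * (of_real ((x / 2) powr (- real m)) *
       (p * (1 - t) ^ m * A * y) - t ^ m * (p * B * y)))"
    unfolding K i using assms(3) by (simp add: field_simps)
  thus ?thesis unfolding p' ti z_def[symmetric] p_def[symmetric] A_def[symmetric] B_def[symmetric] .
qed

text \<open>The product for -m carries t^(-m), which shifts its index by m; the product for m has no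
  pole and starts at j = 0.\<close>

definition Lambda_odd :: "complex \<Rightarrow> (complex \<Rightarrow> complex \<Rightarrow> complex) \<Rightarrow> nat \<Rightarrow> real \<Rightarrow> int \<Rightarrow> real \<Rightarrow> complex" where
  "Lambda_odd \<sigma> F m \<nu> j x = of_real pi / 2 / sin (of_real pi * (of_nat m / 2)) *
     (of_real ((x / 2) powr (- real m)) * Lambda_sum \<sigma> F (- of_nat m) \<nu> (nat (j + int m)) x
      - (if j < 0 then 0 else Lambda_sum \<sigma> F (of_nat m) \<nu> (nat j) x))"

lemma laurent_coeff_Lambda_odd:
  assumes "x > 0" "j \<ge> - int m"
    and G: "\<And>\<mu>. G_product F \<mu> \<nu> x has_fps_expansion Abs_fps (\<lambda>j. Lambda_sum \<sigma> F \<mu> \<nu> j x)"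
    and g: "eventually (\<lambda>t. g t = t powi (- int m) * (of_real pi / 2 / sin (of_real pi * (of_nat m / 2)) *
       (of_real ((x / 2) powr (- real m)) * G_product F (- of_nat m) \<nu> x t - t ^ m * G_product F (of_nat m) \<nu> x t))) (at 0)"
  shows "laurent_coeff g j = Lambda_odd \<sigma> F m \<nu> j x"
proof -
  let ?c = "of_real pi / 2 / sin (of_real pi * (of_nat m / 2)) :: complex"
  let ?F = "fps_const ?c * (fps_const (of_real ((x / 2) powr (- real m))) * Abs_fps (\<lambda>j. Lambda_sum \<sigma> F (- of_nat m) \<nu> j x)
               - fps_X ^ m * Abs_fps (\<lambda>j. Lambda_sum \<sigma> F (of_nat m) \<nu> j x))"
  have "laurent_coeff g = (\<lambda>j. if j < - int m then 0 else fps_nth ?F (nat (j + int m)))"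
    by (rule laurent_coeff_eq[OF _ g]) (intro fps_expansion_intros G)
  moreover have "fps_nth (fps_X ^ m * Abs_fps (\<lambda>j. Lambda_sum \<sigma> F (of_nat m) \<nu> j x)) (nat (j + int m)) =
     (if j < 0 then 0 else Lambda_sum \<sigma> F (of_nat m) \<nu> (nat j) x)"
    using assms(2) by (auto simp: fps_X_power_mult_nth nat_add_distrib nat_less_iff)
  ultimately show ?thesis
    using assms(2) by (simp add: Lambda_odd_def)
qed

lemma Lambda_3:
  assumes "odd m" "x > 0" "j \<ge> - int m"
  shows "Lambda 3 (of_nat m) \<nu> j x = Lambda_odd 1 Ihat m \<nu> j x"
  unfolding Lambda_def
proof (rule laurent_coeff_Lambda_odd[OF assms(2,3) G_product_Ihat[OF assms(2)]])
  have "eventually (\<lambda>t::complex. t \<in> - {1} - {0}) (at 0)"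
    by (intro eventually_at_in_open) auto
  thus "eventually (\<lambda>t. Gfun 3 (of_nat m) \<nu> t x = t powi (- int m) * (of_real pi / 2 / sin (of_real pi * (of_nat m / 2)) *
       (of_real ((x / 2) powr (- real m)) * G_product Ihat (- of_nat m) \<nu> x t - t ^ m * G_product Ihat (of_nat m) \<nu> x t))) (at 0)"
  proof eventually_elim
    case (elim t)
    hence t: "t \<noteq> 0" "t \<noteq> 1" by auto
    have "Gfun 3 (of_nat m) \<nu> t x = (1 - t) powr (- ((of_nat m + of_real \<nu> + 2) / 2)) *
       Ktilde (of_nat m / 2) (t * of_real x / (1 - t)) * Ihat (of_real \<nu> / 2) (sqhalf x * (1 / (1 - t)\<^sup>2))"
      unfolding Gfun_def Let_def Itilde_conv_Ihat sqhalf_eq by simp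
    thus ?case unfolding Ktilde_half_odd[OF assms(1,2) t] G_product_def .
  qed
qed

lemma Lambda_4:
  assumes "odd m" "x > 0" "j \<ge> - int m"
  shows "Lambda 4 (of_nat m) \<nu> j x = Lambda_odd (- 1) Khat m \<nu> j x"
  unfolding Lambda_def
proof (rule laurent_coeff_Lambda_odd[OF assms(2,3) G_product_Khat[OF assms(2)]])
  have "eventually (\<lambda>t::complex. t \<in> - {1} - {0}) (at 0)"
    by (intro eventually_at_in_open) auto
  thus "eventually (\<lambda>t. Gfun 4 (of_nat m) \<nu> t x = t powi (- int m) * (of_real pi / 2 / sin (of_real pi * (of_nat m / 2)) *
       (of_real ((x / 2) powr (- real m)) * G_product Khat (- of_nat m) \<nu> x t - t ^ m * G_product Khat (of_nat m) \<nu> x t))) (at 0)"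
    using eventually_Ktilde[OF assms(2), of "of_real \<nu> / 2"]
  proof eventually_elim
    case (elim t)
    hence t: "t \<noteq> 0" "t \<noteq> 1" by auto
    have "Gfun 4 (of_nat m) \<nu> t x = (1 - t) powr (- ((of_nat m + of_real \<nu> + 2) / 2)) *
       Ktilde (of_nat m / 2) (t * of_real x / (1 - t)) * Khat (of_real \<nu> / 2) (sqhalf x * (1 / (1 - t)\<^sup>2))"
      unfolding Gfun_def Let_def elim(2) by simp
    thus ?case unfolding Ktilde_half_odd[OF assms(1,2) t] G_product_def .
  qed
qed

section \<open>Behaviour of the coefficients at zero\<close>

lemma Khat_real_lim_pos:
  assumes "a > 0"
  shows "((\<lambda>w. w powr a * Khat_real a w) \<longlongrightarrow> Gamma a / 2) (at_right 0)"
proof -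
  have "(Khat_real (- a) \<longlongrightarrow> Gamma a / 2) (at_right 0)"
    using Khat_real_tendsto_0[of "- a"] assms by simp
  also have "?this \<longleftrightarrow> ?thesis"
    by (intro filterlim_cong refl) (auto simp: eventually_at_filter Khat_real_sym)
  finally show ?thesis .
qed

text \<open>L'Hopital's rule: the derivatives of the two functions are - Khat_1 and - 1/w, and w
  Khat_1(w) tends to Gamma 1 / 2.\<close>

lemma Khat_real_lim_0: "((\<lambda>w. Khat_real 0 w / ln w) \<longlongrightarrow> - 1 / 2) (at_right 0)"
proof -
  have pos: "eventually (\<lambda>w::real. w > 0) (at_right 0)" by (simp add: eventually_at_filter)
  have "((\<lambda>w. Khat_real 0 w / (- ln w)) \<longlongrightarrow> 1 / 2) (at_right 0)"
  proof (rule lhopital_right_0_at_top)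
    show "LIM w at_right 0. - ln w :> (at_top :: real filter)" by real_asymp
    show "eventually (\<lambda>w::real. - inverse w \<noteq> 0) (at_right 0)"
      using pos by eventually_elim auto
    show "eventually (\<lambda>w. DERIV (Khat_real 0) w :> - Khat_real 1 w) (at_right 0)"
      using pos by eventually_elim (use Khat_real_has_field_derivative[of _ 0] in simp)
    show "eventually (\<lambda>w. DERIV (\<lambda>w. - ln w) w :> - inverse w) (at_right (0::real))"
      using pos by eventually_elim (auto intro!: derivative_eq_intros simp: divide_inverse)
    have "((\<lambda>w. w powr 1 * Khat_real 1 w) \<longlongrightarrow> Gamma 1 / 2) (at_right 0)"
      by (rule Khat_real_lim_pos) simp
    also have "?this \<longleftrightarrow> ((\<lambda>w. - Khat_real 1 w / - inverse w) \<longlongrightarrow> 1 / 2) (at_right 0)"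
    proof (intro filterlim_cong refl)
      show "eventually (\<lambda>w. w powr 1 * Khat_real 1 w = - Khat_real 1 w / - inverse w) (at_right 0)"
        using pos by eventually_elim (simp add: divide_inverse)
    qed simp_all
    finally show "((\<lambda>w. - Khat_real 1 w / - inverse w) \<longlongrightarrow> 1 / 2) (at_right 0)" .
  qed
  from tendsto_minus[OF this] show ?thesis by simp
qed

text \<open>The cases are the three regimes of K at 0: bounded, logarithmic, and of size w^(-a). The
  factor w^k beats each of them. For \<nu> < 0 this disposes of the terms with k > 0.\<close>

lemma Khat_real_power_lim_0:
  assumes "k > 0" "a < real k"
  shows "((\<lambda>w. w ^ k * Khat_real a w) \<longlongrightarrow> 0) (at_right 0)"
proof -
  have pos: "eventually (\<lambda>w::real. w > 0) (at_right 0)" by (simp add: eventually_at_filter)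
  have k: "((\<lambda>w::real. w ^ k) \<longlongrightarrow> 0) (at_right 0)"
    using assms(1) by (auto intro!: tendsto_eq_intros)
  consider "a < 0" | "a = 0" | "a > 0" by linarith
  thus ?thesis
  proof cases
    case 1
    from tendsto_mult[OF k Khat_real_tendsto_0[OF 1]] show ?thesis by simp
  next
    case 2
    have "((\<lambda>w::real. w ^ k * ln w) \<longlongrightarrow> 0) (at_right 0)"
    proof -
      have "((\<lambda>w::real. w * ln w) \<longlongrightarrow> 0) (at_right 0)" by real_asymp
      moreover have "((\<lambda>w::real. w ^ (k - 1)) \<longlongrightarrow> 0 ^ (k - 1)) (at_right 0)"
        by (intro tendsto_intros)
      ultimately have "((\<lambda>w::real. w ^ (k - 1) * (w * ln w)) \<longlongrightarrow> 0 ^ (k - 1) * 0) (at_right 0)"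
        by (intro tendsto_mult)
      moreover have "(\<lambda>w::real. w ^ (k - 1) * (w * ln w)) = (\<lambda>w. w ^ k * ln w)"
        using assms(1) by (cases k) (auto simp: fun_eq_iff)
      ultimately show ?thesis by (simp only: mult_zero_right)
    qed
    from tendsto_mult[OF this Khat_real_lim_0]
    have "((\<lambda>w. w ^ k * ln w * (Khat_real 0 w / ln w)) \<longlongrightarrow> 0) (at_right 0)" by simp
    also have "?this \<longleftrightarrow> ((\<lambda>w. w ^ k * Khat_real a w) \<longlongrightarrow> 0) (at_right 0)"
    proof (intro filterlim_cong refl)
      have "eventually (\<lambda>w::real. w \<in> {0<..<1}) (at_right 0)" by (rule eventually_at_right_real) simp
      thus "eventually (\<lambda>w. w ^ k * ln w * (Khat_real 0 w / ln w) = w ^ k * Khat_real a w) (at_right 0)"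
        by eventually_elim (use 2 in auto)
    qed
    finally show ?thesis .
  next
    case 3
    have "((\<lambda>w. w powr (real k - a)) \<longlongrightarrow> 0) (at_right 0)"
      using assms by real_asymp
    from tendsto_mult[OF this Khat_real_lim_pos[OF 3]]
    have "((\<lambda>w. w powr (real k - a) * (w powr a * Khat_real a w)) \<longlongrightarrow> 0) (at_right 0)" by simp
    also have "?this \<longleftrightarrow> ?thesis"
    proof (intro filterlim_cong refl)
      show "eventually (\<lambda>w. w powr (real k - a) * (w powr a * Khat_real a w) = w ^ k * Khat_real a w) (at_right 0)"
        using pos
      proof eventually_elim
        case (elim w)
        have "w powr (real k - a) * w powr a = w ^ k"
          using elim by (simp add: powr_realpow flip: powr_add)
        thus ?case by (simp flip: mult.assoc)
      qed
    qed
    finally show ?thesis .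
  qed
qed

lemma filterlim_sq_half: "filterlim (\<lambda>x::real. (x / 2)\<^sup>2) (at_right 0) (at_right 0)"
  by real_asymp

lemma sqhalf_Khat: "sqhalf x ^ k * Khat (of_real \<nu> / 2 + of_nat k) (sqhalf x) = 
    of_real (((x / 2)\<^sup>2) ^ k * Khat_real (\<nu> / 2 + real k) ((x / 2)\<^sup>2))"
  using Khat_of_real[of "\<nu> / 2 + real k" "(x / 2)\<^sup>2"] by (simp add: sqhalf_def)

text \<open>T is the scale of comparison and l k the limit of the k-th term relative to it; the
  \<sigma>-weighted sum of the limits is evaluated separately in each case.\<close>

lemma Lambda_sum_lim_0:
  assumes l: "\<And>k. ((\<lambda>x. sqhalf x ^ k * F (of_real \<nu> / 2 + of_nat k) (sqhalf x) / T x) \<longlongrightarrow> l k) (at_right 0)"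
  shows "((\<lambda>x. Lambda_sum \<sigma> F \<mu> \<nu> j x / T x) \<longlongrightarrow> 
     Ihat_coeff \<mu> 0 * (\<Sum>k\<le>j. \<sigma> ^ k * l k / fact k * G_coeff ((\<mu> + of_real \<nu> + 2) / 2) 0 k j)) (at_right 0)"
proof -
  let ?c = "\<lambda>n k. G_coeff ((\<mu> + of_real \<nu> + 2) / 2) n k j"
  have "(sqhalf \<longlongrightarrow> of_real ((0 / 2)\<^sup>2)) (at_right 0)"
    unfolding sqhalf_def by (intro tendsto_intros) auto
  hence W0: "(sqhalf \<longlongrightarrow> 0) (at_right 0)" by simp
  have "((\<lambda>x. \<Sum>n\<le>j. \<Sum>k\<le>j. Ihat_coeff \<mu> n * sqhalf x ^ n * (\<sigma> ^ k / fact k * ?c n k) * 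
            (sqhalf x ^ k * F (of_real \<nu> / 2 + of_nat k) (sqhalf x) / T x)) \<longlongrightarrow>
         (\<Sum>n\<le>j. \<Sum>k\<le>j. Ihat_coeff \<mu> n * 0 ^ n * (\<sigma> ^ k / fact k * ?c n k) * l k)) (at_right 0)"
    by (intro tendsto_intros W0 l)
  also have "(\<lambda>x. \<Sum>n\<le>j. \<Sum>k\<le>j. Ihat_coeff \<mu> n * sqhalf x ^ n * (\<sigma> ^ k / fact k * ?c n k) * 
            (sqhalf x ^ k * F (of_real \<nu> / 2 + of_nat k) (sqhalf x) / T x)) = (\<lambda>x. Lambda_sum \<sigma> F \<mu> \<nu> j x / T x)"
    by (simp add: Lambda_sum_def G_coeff_sum_def sum_divide_distrib power_add mult_ac)
  also have "(\<Sum>n\<le>j. \<Sum>k\<le>j. Ihat_coeff \<mu> n * 0 ^ n * (\<sigma> ^ k / fact k * ?c n k) * l k) =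
     (\<Sum>n\<in>{0}. \<Sum>k\<le>j. Ihat_coeff \<mu> n * 0 ^ n * (\<sigma> ^ k / fact k * ?c n k) * l k)"
    by (intro sum.mono_neutral_right) (auto simp: power_0_left)
  also have "\<dots> = Ihat_coeff \<mu> 0 * (\<Sum>k\<le>j. \<sigma> ^ k * l k / fact k * ?c 0 k)"
    by (simp add: sum_distrib_left mult_ac)
  finally show ?thesis .
qed

text \<open>The case in which the terms with k > 0 are small against the scale. It covers I for
  every \<nu> and K for \<nu> \<le> 0.\<close>

lemma Lambda_sum_lim_0_single:
  assumes l: "((\<lambda>x. F (of_real \<nu> / 2) (sqhalf x) / T x) \<longlongrightarrow> l) (at_right 0)"
    and 0: "\<And>k. k > 0 \<Longrightarrow> ((\<lambda>x. sqhalf x ^ k * F (of_real \<nu> / 2 + of_nat k) (sqhalf x) / T x) \<longlongrightarrow> 0) (at_right 0)"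
  shows "((\<lambda>x. Lambda_sum \<sigma> F \<mu> \<nu> j x / T x) \<longlongrightarrow> 
     pochhammer ((\<mu> + of_real \<nu> + 2) / 2) j * rGamma ((\<mu> + 2) / 2) / fact j * l) (at_right 0)"
proof -
  let ?l = "\<lambda>k. if k = 0 then l else 0"
  have "((\<lambda>x. sqhalf x ^ k * F (of_real \<nu> / 2 + of_nat k) (sqhalf x) / T x) \<longlongrightarrow> ?l k) (at_right 0)" for k
    using l 0 by (cases "k = 0") auto
  from Lambda_sum_lim_0[OF this]
  have "((\<lambda>x. Lambda_sum \<sigma> F \<mu> \<nu> j x / T x) \<longlongrightarrow> 
     Ihat_coeff \<mu> 0 * (\<Sum>k\<le>j. \<sigma> ^ k * ?l k / fact k * G_coeff ((\<mu> + of_real \<nu> + 2) / 2) 0 k j)) (at_right 0)" .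
  also have "(\<Sum>k\<le>j. \<sigma> ^ k * ?l k / fact k * G_coeff ((\<mu> + of_real \<nu> + 2) / 2) 0 k j) =
     (\<Sum>k\<in>{0}. \<sigma> ^ k * ?l k / fact k * G_coeff ((\<mu> + of_real \<nu> + 2) / 2) 0 k j)"
    by (intro sum.mono_neutral_right) auto
  finally show ?thesis
    by (simp add: G_coeff_0 Ihat_coeff_def add_divide_distrib mult_ac)
qed

lemma Lambda_sum_Ihat_lim_0:
  "((\<lambda>x. Lambda_sum \<sigma> Ihat \<mu> \<nu> j x / 1) \<longlongrightarrow> 
     pochhammer ((\<mu> + of_real \<nu> + 2) / 2) j * rGamma ((\<mu> + 2) / 2) / fact j * rGamma ((of_real \<nu> + 2) / 2)) (at_right 0)"
proof -
  have sqhalf: "(sqhalf \<longlongrightarrow> of_real ((0 / 2)\<^sup>2)) (at_right 0)"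
    unfolding sqhalf_def by (intro tendsto_intros) auto
  have I: "((\<lambda>x. Ihat a (sqhalf x)) \<longlongrightarrow> Ihat a (of_real ((0 / 2)\<^sup>2))) (at_right 0)" for a
    by (intro isCont_tendsto_compose[OF isCont_Ihat] sqhalf)
  show ?thesis
  proof (rule Lambda_sum_lim_0_single)
    show "((\<lambda>x. Ihat (of_real \<nu> / 2) (sqhalf x) / 1) \<longlongrightarrow> rGamma ((of_real \<nu> + 2) / 2)) (at_right 0)"
      using I[of "of_real \<nu> / 2"] by (simp add: add_divide_distrib)
    fix k :: nat assume "k > 0"
    have "((\<lambda>x. sqhalf x ^ k * Ihat (of_real \<nu> / 2 + of_nat k) (sqhalf x)) \<longlongrightarrow>
        of_real ((0 / 2)\<^sup>2) ^ k * Ihat (of_real \<nu> / 2 + of_nat k) (of_real ((0 / 2)\<^sup>2))) (at_right 0)"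
      by (intro tendsto_intros I sqhalf)
    thus "((\<lambda>x. sqhalf x ^ k * Ihat (of_real \<nu> / 2 + of_nat k) (sqhalf x) / 1) \<longlongrightarrow> 0) (at_right 0)"
      using \<open>k > 0\<close> by (simp add: power_0_left)
  qed
qed

lemma Lambda_sum_Khat_lim_neg:
  assumes "\<nu> < 0"
  shows "((\<lambda>x. Lambda_sum \<sigma> Khat \<mu> \<nu> j x / 1) \<longlongrightarrow> 
     pochhammer ((\<mu> - of_real \<bar>\<nu>\<bar> + 2) / 2) j * rGamma ((\<mu> + 2) / 2) / fact j * (1 / 2 * Gamma (- of_real \<nu> / 2))) (at_right 0)"
proof -
  have *: "((\<lambda>x. complex_of_real (((x / 2)\<^sup>2) ^ k * Khat_real (\<nu> / 2 + real k) ((x / 2)\<^sup>2))) \<longlongrightarrow> of_real L) (at_right 0)"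
    if "((\<lambda>w. w ^ k * Khat_real (\<nu> / 2 + real k) w) \<longlongrightarrow> L) (at_right 0)" for k L
    by (intro tendsto_of_real filterlim_compose[OF that filterlim_sq_half])
  have "((\<lambda>x. Lambda_sum \<sigma> Khat \<mu> \<nu> j x / 1) \<longlongrightarrow> 
     pochhammer ((\<mu> + of_real \<nu> + 2) / 2) j * rGamma ((\<mu> + 2) / 2) / fact j * (of_real (Gamma (- (\<nu> / 2)) / 2))) (at_right 0)"
  proof (rule Lambda_sum_lim_0_single)
    show "((\<lambda>x. Khat (of_real \<nu> / 2) (sqhalf x) / 1) \<longlongrightarrow> of_real (Gamma (- (\<nu> / 2)) / 2)) (at_right 0)"
      using *[of 0 "Gamma (- (\<nu> / 2)) / 2"] Khat_real_tendsto_0[of "\<nu> / 2"] assms sqhalf_Khat[of _ 0 \<nu>] by simp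
    fix k :: nat assume "k > 0"
    thus "((\<lambda>x. sqhalf x ^ k * Khat (of_real \<nu> / 2 + of_nat k) (sqhalf x) / 1) \<longlongrightarrow> 0) (at_right 0)"
      using *[OF Khat_real_power_lim_0, of k] assms unfolding sqhalf_Khat by simp
  qed
  thus ?thesis using assms by (simp add: Gamma_complex_of_real[symmetric])
qed

text \<open>For k > 0 the terms w^k Khat_k(w) stay bounded, hence are negligible against the
  logarithm. For k = 0 the relation ln w = 2 ln (x/2) turns the limit -1/2 into -1.\<close>

lemma Lambda_sum_Khat_lim_zero:
  "((\<lambda>x. Lambda_sum \<sigma> Khat \<mu> 0 j x / of_real (ln (x / 2))) \<longlongrightarrow> 
     pochhammer ((\<mu> - of_real \<bar>0\<bar> + 2) / 2) j * rGamma ((\<mu> + 2) / 2) / fact j * (- 1)) (at_right 0)"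
proof -
  have "((\<lambda>x. Lambda_sum \<sigma> Khat \<mu> 0 j x / of_real (ln (x / 2))) \<longlongrightarrow> 
     pochhammer ((\<mu> + of_real 0 + 2) / 2) j * rGamma ((\<mu> + 2) / 2) / fact j * (- 1)) (at_right 0)"
  proof (rule Lambda_sum_lim_0_single)
    have "((\<lambda>x. Khat_real 0 ((x / 2)\<^sup>2) / ln ((x / 2)\<^sup>2) * 2) \<longlongrightarrow> - 1 / 2 * 2) (at_right 0)"
      by (intro tendsto_intros filterlim_compose[OF Khat_real_lim_0 filterlim_sq_half])
    also have "?this \<longleftrightarrow> ((\<lambda>x. Khat_real 0 ((x / 2)\<^sup>2) / ln (x / 2)) \<longlongrightarrow> - 1) (at_right 0)"
      by (intro filterlim_cong) (auto simp: eventually_at_filter ln_realpow)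
    finally have "((\<lambda>x. complex_of_real (Khat_real 0 ((x / 2)\<^sup>2) / ln (x / 2))) \<longlongrightarrow> of_real (- 1)) (at_right 0)"
      by (rule tendsto_of_real)
    thus "((\<lambda>x. Khat (of_real 0 / 2) (sqhalf x) / of_real (ln (x / 2))) \<longlongrightarrow> - 1) (at_right 0)"
      using sqhalf_Khat[of _ 0 0] by simp
    fix k :: nat assume k: "k > 0"
    have "((\<lambda>w. w powr real k * Khat_real (real k) w) \<longlongrightarrow> Gamma (real k) / 2) (at_right 0)"
      using k by (intro Khat_real_lim_pos) auto
    hence "((\<lambda>x. ((x / 2)\<^sup>2) powr real k * Khat_real (real k) ((x / 2)\<^sup>2)) \<longlongrightarrow> Gamma (real k) / 2) (at_right 0)"
      by (rule filterlim_compose[OF _ filterlim_sq_half])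
    moreover have "((\<lambda>x::real. inverse (ln (x / 2))) \<longlongrightarrow> 0) (at_right 0)" by real_asymp
    ultimately have "((\<lambda>x. (((x / 2)\<^sup>2) powr real k * Khat_real (real k) ((x / 2)\<^sup>2)) * inverse (ln (x / 2))) \<longlongrightarrow>
           Gamma (real k) / 2 * 0) (at_right 0)"
      by (rule tendsto_mult)
    also have "?this \<longleftrightarrow> ((\<lambda>x. ((x / 2)\<^sup>2) ^ k * Khat_real (real k) ((x / 2)\<^sup>2) / ln (x / 2)) \<longlongrightarrow> 0) (at_right 0)"
    proof (intro filterlim_cong refl)
      have "eventually (\<lambda>x::real. x > 0) (at_right 0)" by (simp add: eventually_at_filter)
      thus "eventually (\<lambda>x. (((x / 2)\<^sup>2) powr real k * Khat_real (real k) ((x / 2)\<^sup>2)) * inverse (ln (x / 2)) =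
              ((x / 2)\<^sup>2) ^ k * Khat_real (real k) ((x / 2)\<^sup>2) / ln (x / 2)) (at_right 0)"
      proof eventually_elim
        case (elim x)
        have "((x / 2)\<^sup>2) powr real k = ((x / 2)\<^sup>2) ^ k"
          using elim by (intro powr_realpow) auto
        thus ?case by (simp only: divide_inverse)
      qed
    qed simp_all
    finally have "((\<lambda>x. complex_of_real (((x / 2)\<^sup>2) ^ k * Khat_real (real k) ((x / 2)\<^sup>2) / ln (x / 2))) \<longlongrightarrow> of_real 0) (at_right 0)"
      by (rule tendsto_of_real)
    thus "((\<lambda>x. sqhalf x ^ k * Khat (of_real 0 / 2 + of_nat k) (sqhalf x) / of_real (ln (x / 2))) \<longlongrightarrow> 0) (at_right 0)"
      unfolding sqhalf_Khat by simp
  qed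
  thus ?thesis by simp
qed

text \<open>This compares coefficients in the expansion of the generating function with F1 = 1, F2 =
  \<open>\<lambda>z. z powr (- a)\<close> and w = 1, where the product collapses to
  \<open>(1 - t) powr (- (s - 2 * a))\<close>. With a = \<nu>/2 it is the origin of the argument
  (\<mu> - \<nu> + 2)/2 in the Pochhammer symbol.\<close>

lemma G_coeff_binomial_sum:
  "(\<Sum>k\<le>j. ((- a) gchoose k) * G_coeff s 0 k j) = pochhammer (s - 2 * a) j / fact j"
proof -
  have exp: "(\<lambda>t. (1 - t) powr (- s) * (\<lambda>_. 1) (1 * (t\<^sup>2 * (1 / (1 - t)\<^sup>2))) * (\<lambda>z. z powr (- a)) (1 * (1 / (1 - t)\<^sup>2)))
           has_fps_expansion Abs_fps (G_coeff_sum s (\<lambda>n. if n = 0 then 1 else 0) (\<lambda>k. (- a) gchoose k) 1)"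
  proof (rule G_has_fps_expansion)
    show "(\<lambda>_::complex. 1 :: complex) has_fps_expansion Abs_fps (\<lambda>n. if n = 0 then 1 else 0)"
    proof -
      have "Abs_fps (\<lambda>n. if n = 0 then 1 else 0) = (1 :: complex fps)" by (simp add: fps_eq_iff)
      thus ?thesis by simp
    qed
    show "(\<lambda>h. (1 + h) powr (- a)) has_fps_expansion Abs_fps (\<lambda>k. (- a) gchoose k)"
      using has_fps_expansion_binomial_complex[of "- a"] by (simp add: fps_binomial_def)
  qed
  have ev: "eventually (\<lambda>t. (1 - t) powr (- s) * (\<lambda>_. 1) (1 * (t\<^sup>2 * (1 / (1 - t)\<^sup>2))) * (\<lambda>z. z powr (- a)) (1 * (1 / (1 - t)\<^sup>2))
         = (1 - t) powr (- (s - 2 * a))) (nhds 0)"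
  proof -
    have "eventually (\<lambda>t. t \<in> ball (0::complex) 1) (nhds 0)"
      by (intro eventually_nhds_in_open) auto
    thus ?thesis
    proof eventually_elim
      case (elim t)
      have t: "t \<noteq> 1" using elim by auto
      have Re: "Re (1 - t) > 0" using elim abs_Re_le_cmod[of t] by (auto simp: dist_norm)
      have Re': "Re (inverse (1 - t)) > 0"
        unfolding inverse_complex.sel using Re by (intro divide_pos_pos add_pos_nonneg) auto
      have "1 / (1 - t)\<^sup>2 = (inverse (1 - t))\<^sup>2" by (simp only: power_inverse inverse_eq_divide[symmetric])
      also have "\<dots> powr (- a) = inverse (1 - t) powr (2 * (- a))"
        by (rule powr_square[OF Re'])
      also have "\<dots> = (1 - t) powr (2 * a)"
      proof -
        have "1 - t \<notin> \<real>\<^sub>\<le>\<^sub>0" using Re by (auto simp: complex_nonpos_Reals_iff)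
        thus ?thesis using t by (simp add: powr_def Ln_inverse)
      qed
      finally show ?case by (simp add: powr_diff powr_minus powr_add field_simps)
    qed
  qed
  have "(\<lambda>t. (1 - t) powr (- (s - 2 * a))) has_fps_expansion Abs_fps (G_coeff_sum s (\<lambda>n. if n = 0 then 1 else 0) (\<lambda>k. (- a) gchoose k) 1)"
    by (rule iffD1[OF has_fps_expansion_cong[OF ev refl] exp])
  hence "Abs_fps (G_coeff_sum s (\<lambda>n. if n = 0 then 1 else 0) (\<lambda>k. (- a) gchoose k) 1) = neg_binomial_fps (s - 2 * a)"
    using has_fps_expansion_neg_binomial fps_expansion_unique_complex by blast
  hence "G_coeff_sum s (\<lambda>n. if n = 0 then 1 else 0) (\<lambda>k. (- a) gchoose k) 1 j = pochhammer (s - 2 * a) j / fact j"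
    by (simp add: neg_binomial_fps_def fps_eq_iff)
  moreover have "G_coeff_sum s (\<lambda>n. if n = 0 then 1 else 0) (\<lambda>k. (- a) gchoose k) 1 j =
     (\<Sum>n\<in>{0}. \<Sum>k\<le>j. (if n = 0 then 1 else 0) * ((- a) gchoose k) * G_coeff s n k j)"
    unfolding G_coeff_sum_def by (subst sum.mono_neutral_right[of "{..j}" "{0}"]) auto
  ultimately show ?thesis by simp
qed

text \<open>For \<nu> > 0 the terms w^k Khat_{\<nu>/2+k}(w) all have the size w^(-\<nu>/2), with
  limits proportional to Gamma (\<nu>/2 + k). With the sign (-1)^k and divided by k! these are
  multiples of the binomial coefficients of -\<nu>/2, and \<open>G_coeff_binomial_sum\<close> adds
  them up.\<close>

lemma Lambda_sum_Khat_lim_pos: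
  assumes "\<nu> > 0"
  shows "((\<lambda>x. Lambda_sum (- 1) Khat \<mu> \<nu> j x / of_real (x powr (- \<nu>))) \<longlongrightarrow> 
     pochhammer ((\<mu> - of_real \<bar>\<nu>\<bar> + 2) / 2) j * rGamma ((\<mu> + 2) / 2) / fact j *
      (2 powr (of_real \<nu> - 1) * Gamma (of_real \<nu> / 2))) (at_right 0)"
proof -
  let ?s = "(\<mu> + of_real \<nu> + 2) / 2"
  define l where "l = (\<lambda>k. 2 powr \<nu> / 2 * Gamma (\<nu> / 2 + real k))"
  have "((\<lambda>x. sqhalf x ^ k * Khat (of_real \<nu> / 2 + of_nat k) (sqhalf x) / of_real (x powr (- \<nu>))) \<longlongrightarrow> of_real (l k)) (at_right 0)" for k
  proof -
    have "((\<lambda>w. w powr (\<nu> / 2 + real k) * Khat_real (\<nu> / 2 + real k) w) \<longlongrightarrow> Gamma (\<nu> / 2 + real k) / 2) (at_right 0)"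
      using assms by (intro Khat_real_lim_pos) auto
    hence "((\<lambda>x. ((x / 2)\<^sup>2) powr (\<nu> / 2 + real k) * Khat_real (\<nu> / 2 + real k) ((x / 2)\<^sup>2)) \<longlongrightarrow> Gamma (\<nu> / 2 + real k) / 2) (at_right 0)"
      by (rule filterlim_compose[OF _ filterlim_sq_half])
    hence "((\<lambda>x. 2 powr \<nu> * (((x / 2)\<^sup>2) powr (\<nu> / 2 + real k) * Khat_real (\<nu> / 2 + real k) ((x / 2)\<^sup>2))) \<longlongrightarrow> 2 powr \<nu> * (Gamma (\<nu> / 2 + real k) / 2)) (at_right 0)"
      by (intro tendsto_intros)
    also have "?this \<longleftrightarrow> ((\<lambda>x. ((x / 2)\<^sup>2) ^ k * Khat_real (\<nu> / 2 + real k) ((x / 2)\<^sup>2) / x powr (- \<nu>)) \<longlongrightarrow> l k) (at_right 0)"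
    proof (intro filterlim_cong refl)
      have "eventually (\<lambda>x::real. x > 0) (at_right 0)" by (simp add: eventually_at_filter)
      thus "eventually (\<lambda>x. 2 powr \<nu> * (((x / 2)\<^sup>2) powr (\<nu> / 2 + real k) * Khat_real (\<nu> / 2 + real k) ((x / 2)\<^sup>2)) =
          ((x / 2)\<^sup>2) ^ k * Khat_real (\<nu> / 2 + real k) ((x / 2)\<^sup>2) / x powr (- \<nu>)) (at_right 0)"
      proof eventually_elim
        case (elim x)
        have "((x / 2)\<^sup>2) powr (\<nu> / 2 + real k) = (x / 2) powr \<nu> * ((x / 2)\<^sup>2) ^ k"
        proof -
          have "((x / 2)\<^sup>2) powr (\<nu> / 2) = (x / 2) powr \<nu>"
            using elim powr_sq[of "x / 2" "\<nu> / 2"] powr_add[of "x / 2" "\<nu> / 2" "\<nu> / 2"] by simp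
          moreover have "((x / 2)\<^sup>2) powr real k = ((x / 2)\<^sup>2) ^ k"
            using elim by (intro powr_realpow) auto
          ultimately show ?thesis by (simp only: powr_add)
        qed
        thus ?case using elim by (simp add: powr_divide powr_minus field_simps)
      qed
    qed (simp_all add: l_def)
    finally have "((\<lambda>x. complex_of_real (((x / 2)\<^sup>2) ^ k * Khat_real (\<nu> / 2 + real k) ((x / 2)\<^sup>2) / x powr (- \<nu>))) \<longlongrightarrow> of_real (l k)) (at_right 0)"
      by (rule tendsto_of_real)
    thus ?thesis unfolding sqhalf_Khat by simp
  qed
  from Lambda_sum_lim_0[OF this]
  have "((\<lambda>x. Lambda_sum (- 1) Khat \<mu> \<nu> j x / of_real (x powr (- \<nu>))) \<longlongrightarrow> 
     Ihat_coeff \<mu> 0 * (\<Sum>k\<le>j. (- 1) ^ k * of_real (l k) / fact k * G_coeff ?s 0 k j)) (at_right 0)" .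
  also have "(\<Sum>k\<le>j. (- 1) ^ k * complex_of_real (l k) / fact k * G_coeff ?s 0 k j) =
     of_real (l 0) * (\<Sum>k\<le>j. ((- (of_real \<nu> / 2)) gchoose k) * G_coeff ?s 0 k j)"
    unfolding sum_distrib_left
  proof (intro sum.cong refl)
    fix k
    have "l k = l 0 * pochhammer (\<nu> / 2) k"
    proof -
      have "\<nu> / 2 \<notin> \<int>\<^sub>\<le>\<^sub>0" using assms by (auto elim!: nonpos_Ints_cases)
      thus ?thesis using assms by (simp add: l_def pochhammer_Gamma Gamma_eq_zero_iff)
    qed
    hence "complex_of_real (l k) = of_real (l 0) * pochhammer (of_real \<nu> / 2) k"
      by (simp add: pochhammer_of_real[symmetric])
    thus "(- 1) ^ k * complex_of_real (l k) / fact k * G_coeff ?s 0 k j =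
        of_real (l 0) * (((- (of_real \<nu> / 2)) gchoose k) * G_coeff ?s 0 k j)"
      by (simp add: gbinomial_pochhammer)
  qed
  also have "(\<Sum>k\<le>j. ((- (of_real \<nu> / 2)) gchoose k) * G_coeff ?s 0 k j) = pochhammer ((\<mu> - of_real \<bar>\<nu>\<bar> + 2) / 2) j / fact j"
    unfolding G_coeff_binomial_sum using assms by (simp add: field_simps)
  also have "complex_of_real (l 0) = 2 powr (of_real \<nu> - 1) * Gamma (of_real \<nu> / 2)"
  proof -
    have "complex_of_real (2 powr (\<nu> - 1) * Gamma (\<nu> / 2)) = 2 powr (of_real \<nu> - 1) * Gamma (of_real \<nu> / 2)"
      using powr_of_real[of 2 "\<nu> - 1"] by (simp add: Gamma_complex_of_real[symmetric])
    moreover have "l 0 = 2 powr (\<nu> - 1) * Gamma (\<nu> / 2)"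
      by (simp add: l_def powr_diff)
    ultimately show ?thesis by simp
  qed
  finally show ?thesis by (simp add: Ihat_coeff_def add_divide_distrib mult_ac)
qed

section \<open>Behaviour of the coefficients at infinity\<close>

definition leading_const :: "complex \<Rightarrow> complex \<Rightarrow> nat \<Rightarrow> complex" where
  "leading_const \<sigma> \<mu> j = (\<Sum>n\<le>j. \<Sum>k\<le>j. if 2 * n + k = j then Ihat_coeff \<mu> n * (\<sigma> ^ k / fact k) * 2 ^ k else 0)"

text \<open>These constants are the coefficients of $e^{2\sigma s}\hat I_{\mu/2}(s^2)$, and the recurrence is the differential
equation of this function.\<close>

lemma leading_const_rec:
  assumes "\<sigma> ^ 2 = 1"
  shows "of_nat (j + 1) * (of_nat j + \<mu> + 1) * leading_const \<sigma> \<mu> (Suc j) = 2 * \<sigma> * (2 * of_nat j + \<mu> + 1) * leading_const \<sigma> \<mu> j"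
proof -
  \<comment> \<open>The expansion of \<open>Ihat (\<mu> / 2) (s^2)\<close> in powers of s, hence
    supported on even indices.\<close>
  define E where "E = Abs_fps (\<lambda>i. if even i then Ihat_coeff \<mu> (i div 2) else 0)"
  define c where "c = 2 * \<sigma>"
  define X where "X = fps_exp c"
  define g where "g = X * E"
  have c2: "c * c = 4" using assms by (simp add: c_def power2_eq_square)
  have S: "leading_const \<sigma> \<mu> j = fps_nth g j" for j
  proof -
    have "leading_const \<sigma> \<mu> j = (\<Sum>k\<le>j. \<Sum>n\<le>j. if 2 * n + k = j then Ihat_coeff \<mu> n * (\<sigma> ^ k / fact k) * 2 ^ k else 0)"
      unfolding leading_const_def by (rule sum.swap)
    also have "\<dots> = (\<Sum>k\<le>j. fps_nth X k * fps_nth E (j - k))"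
    proof (intro sum.cong refl)
      fix k assume k: "k \<in> {..j}"
      show "(\<Sum>n\<le>j. if 2 * n + k = j then Ihat_coeff \<mu> n * (\<sigma> ^ k / fact k) * 2 ^ k else 0) = fps_nth X k * fps_nth E (j - k)"
      proof (cases "even (j - k)")
        case True
        hence "2 * n + k = j \<longleftrightarrow> n = (j - k) div 2" for n using k by auto
        moreover have "(j - k) div 2 \<le> j" by simp
        ultimately show ?thesis
          using True by (simp add: X_def c_def E_def power_mult_distrib mult_ac)
      next
        case False
        hence "2 * n + k \<noteq> j" for n by auto
        thus ?thesis using False by (simp add: E_def)
      qed
    qed
    also have "\<dots> = fps_nth g j"
      by (simp add: g_def fps_mult_nth atLeast0AtMost)
    finally show ?thesis .
  qed
  \<comment> \<open>The modified Bessel equation for E in the variable s: s E'' + (\<mu> + 1) E' = 4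
    s E.\<close>
  have ode: "fps_X * fps_deriv (fps_deriv E) + fps_const (\<mu> + 1) * fps_deriv E = fps_const 4 * (fps_X * E)"
  proof (rule fps_ext)
    fix i
    have "of_nat i * (of_nat (i + 1) * fps_nth E (i + 1)) + (\<mu> + 1) * (of_nat (i + 1) * fps_nth E (i + 1)) =
            4 * (if i = 0 then 0 else fps_nth E (i - 1))"
    proof (cases "even i")
      case True
      thus ?thesis by (cases i) (auto simp: E_def)
    next
      case False
      then obtain p where p: "i = 2 * p + 1" by (auto elim: oddE)
      have e: "fps_nth E (i + 1) = Ihat_coeff \<mu> (Suc p)" "fps_nth E (i - 1) = Ihat_coeff \<mu> p"
        by (auto simp: E_def p)
      have "rGamma (of_nat p + \<mu> / 2 + 1) = (of_nat p + \<mu> / 2 + 1) * rGamma (of_nat p + \<mu> / 2 + 1 + 1)"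
        by (simp only: rGamma_plus1)
      hence H: "Ihat_coeff \<mu> p = (of_nat p + \<mu> / 2 + 1) * of_nat (Suc p) * Ihat_coeff \<mu> (Suc p)"
        unfolding Ihat_coeff_def by (simp add: add_ac del: of_nat_Suc) (simp add: add_ac)
      have A4: "4 * Ihat_coeff \<mu> p = (2 * of_nat p + \<mu> + 2) * (2 * of_nat p + 2) * Ihat_coeff \<mu> (Suc p)"
        unfolding H by (simp add: field_simps)
      have "i \<noteq> 0" by (simp add: p)
      hence "4 * (if i = 0 then 0 else fps_nth E (i - 1)) = 4 * Ihat_coeff \<mu> p" using e by simp
      also note A4
      also have "(2 * of_nat p + \<mu> + 2) * (2 * of_nat p + 2) * Ihat_coeff \<mu> (Suc p) =
          of_nat i * (of_nat (i + 1) * fps_nth E (i + 1)) + (\<mu> + 1) * (of_nat (i + 1) * fps_nth E (i + 1))"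
        unfolding e using p by (simp add: algebra_simps)
      finally show ?thesis ..
    qed
    thus "fps_nth (fps_X * fps_deriv (fps_deriv E) + fps_const (\<mu> + 1) * fps_deriv E) i = fps_nth (fps_const 4 * (fps_X * E)) i"
      by (cases i) auto
  qed
  have dX: "fps_deriv X = fps_const c * X" by (simp add: X_def)
  have d1: "fps_deriv g = fps_const c * g + X * fps_deriv E"
    by (simp add: g_def dX algebra_simps)
  have d2: "fps_deriv (fps_deriv g) = fps_const c * fps_deriv g + fps_const c * (X * fps_deriv E) + X * fps_deriv (fps_deriv E)"
  proof -
    have "fps_deriv (fps_deriv g) = fps_deriv (fps_const c * g + X * fps_deriv E)" by (simp only: d1)
    also have "\<dots> = fps_const c * fps_deriv g + fps_const c * (X * fps_deriv E) + X * fps_deriv (fps_deriv E)"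
      by (simp add: dX algebra_simps)
    finally show ?thesis .
  qed
  have cc: "fps_const c * fps_const c = fps_const 4" using c2 by simp
  \<comment> \<open>For g = exp (c s) E the term 4 s g from the equation cancels against c^2 s g,
    since c^2 = 4. Without a multiple of s g only neighbouring coefficients are coupled, so the
    recurrence has two terms.\<close>
  have "fps_X * fps_deriv (fps_deriv g) + fps_const (\<mu> + 1) * fps_deriv g =
     X * (fps_X * fps_deriv (fps_deriv E) + fps_const (\<mu> + 1) * fps_deriv E) + 2 * fps_const c * (fps_X * fps_deriv g)
      - (fps_const c * fps_const c) * (fps_X * g) + fps_const (\<mu> + 1) * (fps_const c * g)"
    unfolding d2 unfolding d1 by (simp add: algebra_simps)
  also have "\<dots> = 2 * fps_const c * (fps_X * fps_deriv g) + fps_const (\<mu> + 1) * (fps_const c * g)"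
    unfolding ode cc by (simp add: g_def algebra_simps)
  finally have "fps_nth (fps_X * fps_deriv (fps_deriv g) + fps_const (\<mu> + 1) * fps_deriv g) j =
      fps_nth (2 * fps_const c * (fps_X * fps_deriv g) + fps_const (\<mu> + 1) * (fps_const c * g)) j" by simp
  also have "2 * fps_const c = fps_const (2 * c)" by (simp add: numeral_fps_const)
  finally have "of_nat j * (of_nat (j + 1) * fps_nth g (j + 1)) + (\<mu> + 1) * (of_nat (j + 1) * fps_nth g (j + 1)) =
     2 * c * (of_nat j * fps_nth g j) + (\<mu> + 1) * (c * fps_nth g j)"
    by (cases j) auto
  thus ?thesis unfolding S c_def by (simp add: algebra_simps)
qed

text \<open>The excluded values of \<mu> split in two: the even ones would annihilate the starting
  value 1 / Gamma (\<mu>/2 + 1), the odd ones a factor 2j + \<mu> + 1 of the recurrence.\<close>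

lemma leading_const_nonzero:
  assumes hmu: "\<forall>k::nat. k \<ge> 1 \<longrightarrow> \<mu> \<noteq> - of_nat k" and "\<sigma> ^ 2 = 1"
  shows "leading_const \<sigma> \<mu> j \<noteq> 0"
proof (induction j)
  case 0
  have "\<mu> / 2 + 1 \<notin> \<int>\<^sub>\<le>\<^sub>0"
  proof
    assume "\<mu> / 2 + 1 \<in> \<int>\<^sub>\<le>\<^sub>0"
    then obtain n :: nat where "\<mu> / 2 + 1 = - of_nat n" by (auto elim: nonpos_Ints_cases')
    moreover have "\<mu> = 2 * (\<mu> / 2 + 1) - 2" by simp
    ultimately have "\<mu> = - of_nat (2 * n + 2)" by simp
    with hmu show False by (auto dest: spec[of _ "2 * n + 2"])
  qed
  thus ?case by (simp add: leading_const_def Ihat_coeff_def rGamma_eq_zero_iff)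
next
  case (Suc j)
  have "\<mu> \<noteq> - of_nat (2 * j + 1)" using hmu by (auto dest: spec[of _ "2 * j + 1"])
  hence "2 * of_nat j + \<mu> + 1 \<noteq> 0"
    by (simp add: eq_neg_iff_add_eq_0 algebra_simps)
  moreover have "\<sigma> \<noteq> 0" using assms(2) by auto
  ultimately have "of_nat (j + 1) * (of_nat j + \<mu> + 1) * leading_const \<sigma> \<mu> (Suc j) \<noteq> 0"
    unfolding leading_const_rec[OF assms(2)] using Suc.IH by simp
  thus ?case by auto
qed

section \<open>From Bessel asymptotics to the finite sums\<close>

lemma bigo_cong_ev:
  "f \<in> O[F](g) \<Longrightarrow> eventually (\<lambda>x. f x = f' x) F \<Longrightarrow> f' \<in> O[F](g)"
  by (simp add: landau_o.big.in_cong)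

lemma bigo_cmult:
  fixes c :: complex
  shows "f \<in> O[F](g) \<Longrightarrow> (\<lambda>x. c * f x) \<in> O[F](g)"
  by (cases "c = 0") auto

lemma cancel_frac:
  fixes A b c d f s u z :: complex
  assumes "b \<noteq> 0"
  shows "A * (s * z / f) * (u * b) * c / (d * b) = A * (s / f) * c * (u * z / d)"
proof -
  have "A * (s * z / f) * (u * b) * c / (d * b) = (A * (s * z / f) * u * c) * b / (d * b)"
    by (simp only: mult_ac)
  also have "\<dots> = A * (s * z / f) * u * c / d"
    using assms by (rule nonzero_mult_divide_mult_cancel_right)
  also have "\<dots> = A * (s / f) * c * (u * z / d)"
    by (simp only: divide_inverse mult_ac)
  finally show ?thesis .
qed

text \<open>D is a common scale for all (x/2)^k F_{\<nu>/2+k}. As w = (x/2)^2, the term with indices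
  n, k has size (x/2)^(2n+k) D. Relative to (x/2)^j D it is O(1/x) if 2n + k < j, tends to a
  constant if 2n + k = j, and is identically 0 beyond.\<close>

lemma Lambda_sum_asymp_inf:
  fixes D :: "real \<Rightarrow> real"
  assumes F: "\<And>k. (\<lambda>x. of_real ((x / 2) ^ k) * F (of_real \<nu> / 2 + of_nat k) (sqhalf x) / of_real (D x) - 1) 
                    \<in> O[at_top](\<lambda>x. of_real (1 / x))"
  shows "(\<lambda>x. Lambda_sum \<sigma> F \<mu> \<nu> j x / of_real (D x * (x / 2) ^ j) - leading_const \<sigma> \<mu> j) \<in> O[at_top](\<lambda>x. of_real (1 / x))"
proof -
  let ?s = "(\<mu> + of_real \<nu> + 2) / 2"
  define r where "r = (\<lambda>k x. of_real ((x / 2) ^ k) * F (of_real \<nu> / 2 + of_nat k) (sqhalf x) / of_real (D x))"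
  define T where "T = (\<lambda>n k x. Ihat_coeff \<mu> n * (\<sigma> ^ k * F (of_real \<nu> / 2 + of_nat k) (sqhalf x) / fact k) * sqhalf x ^ (n + k) * G_coeff ?s n k j
      / of_real (D x * (x / 2) ^ j))"
  have r1: "(\<lambda>x. r k x - 1) \<in> O[at_top](\<lambda>x. of_real (1 / x))" for k
    using F by (simp add: r_def)
  have inv1: "(\<lambda>x. complex_of_real (1 / x)) \<in> O[at_top](\<lambda>_. 1)"
  proof (rule bigoI_tendsto[where c = 0])
    show "((\<lambda>x. complex_of_real (1 / x) / 1) \<longlongrightarrow> 0) at_top"
    proof -
      have "((\<lambda>x::real. 1 / x) \<longlongrightarrow> 0) at_top" by real_asymp
      from tendsto_of_real[OF this, where 'a = complex] show ?thesis by simp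
    qed
  qed auto
  have rO: "r k \<in> O[at_top](\<lambda>_. 1)" for k
  proof -
    have "(\<lambda>x. (r k x - 1) + 1) \<in> O[at_top](\<lambda>_. 1)"
      by (rule sum_in_bigo(1)[OF landau_o.big_trans[OF r1 inv1]]) simp
    thus ?thesis by simp
  qed
  have T: "(\<lambda>x. T n k x - (if 2 * n + k = j then Ihat_coeff \<mu> n * (\<sigma> ^ k / fact k) * 2 ^ k else 0)) \<in> O[at_top](\<lambda>x. of_real (1 / x))" for n k
  proof -
    consider "2 * n + k > j" | "2 * n + k = j" | "2 * n + k < j" by linarith
    thus ?thesis
    proof cases
      case 1
      hence "(\<lambda>x. T n k x - (if 2 * n + k = j then Ihat_coeff \<mu> n * (\<sigma> ^ k / fact k) * 2 ^ k else 0)) = (\<lambda>_. 0)"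
        by (simp add: T_def G_coeff_eq_0)
      thus ?thesis by simp
    next
      case 2
      let ?A = "Ihat_coeff \<mu> n * (\<sigma> ^ k / fact k) * 2 ^ k"
      have "(\<lambda>x. ?A * (r k x - 1)) \<in> O[at_top](\<lambda>x. of_real (1 / x))"
        using r1 by (cases "?A = 0") auto
      moreover have "eventually (\<lambda>x. ?A * (r k x - 1) = T n k x - (if 2 * n + k = j then ?A else 0)) at_top"
        using eventually_gt_at_top[of 0]
      proof eventually_elim
        case (elim x)
        have "(y\<^sup>2) ^ (n + k) = y ^ k * y ^ j" for y :: real
          unfolding power_mult[symmetric] power_add[symmetric] 2[symmetric]
          by (rule arg_cong[of _ _ "(^) y"]) simp
        hence hW: "sqhalf x ^ (n + k) = of_real ((x / 2) ^ k) * of_real ((x / 2) ^ j)"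
          unfolding sqhalf_def of_real_power[symmetric] of_real_mult[symmetric] by simp
        have "T n k x = ?A * r k x"
          unfolding T_def r_def G_coeff_top[OF 2] of_real_mult[of "D x"] hW
          using elim by (intro cancel_frac) auto
        thus ?case using 2 by (simp only: if_True right_diff_distrib mult_1_right refl)
      qed
      ultimately show ?thesis by (rule bigo_cong_ev)
    next
      case 3
      define d where "d = j - 2 * n - k"
      have j: "j = 2 * n + k + d" and d: "d \<ge> 1" using 3 by (auto simp: d_def)
      let ?A = "Ihat_coeff \<mu> n * (\<sigma> ^ k / fact k) * G_coeff ?s n k j"
      have dO: "(\<lambda>x. of_real (1 / (x / 2) ^ d)) \<in> O[at_top](\<lambda>x. complex_of_real (1 / x))"
      proof (rule bigoI[where c = 2])
        show "eventually (\<lambda>x. norm (complex_of_real (1 / (x / 2) ^ d)) \<le> 2 * norm (complex_of_real (1 / x))) at_top"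
          using eventually_ge_at_top[of 2]
        proof eventually_elim
          case (elim x)
          have "(x / 2) ^ 1 \<le> (x / 2) ^ d" using elim d by (intro power_increasing) auto
          hence "1 / (x / 2) ^ d \<le> 1 / (x / 2)" using elim by (intro divide_left_mono) auto
          thus ?case using elim by (simp add: norm_divide norm_power)
        qed
      qed
      have "(\<lambda>x. ?A * of_real (1 / (x / 2) ^ d) * r k x) \<in> O[at_top](\<lambda>x. of_real (1 / x) * 1)"
        by (intro landau_o.big.mult rO bigo_cmult dO)
      moreover have "eventually (\<lambda>x. ?A * of_real (1 / (x / 2) ^ d) * r k x = T n k x - (if 2 * n + k = j then Ihat_coeff \<mu> n * (\<sigma> ^ k / fact k) * 2 ^ k else 0)) at_top"
        using eventually_gt_at_top[of 0]
      proof eventually_elim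
        case (elim x)
        have "(y\<^sup>2) ^ (n + k) * y ^ d = y ^ k * y ^ j" for y :: real
          unfolding power_mult[symmetric] power_add[symmetric] j
          by (rule arg_cong[of _ _ "(^) y"]) simp
        hence "(y\<^sup>2) ^ (n + k) = (y ^ k * (1 / y ^ d)) * y ^ j" if "y > 0" for y :: real
          using that by (simp add: eq_divide_eq)
        from this[of "x / 2"] have "((x / 2)\<^sup>2) ^ (n + k) = ((x / 2) ^ k * (1 / (x / 2) ^ d)) * (x / 2) ^ j"
          using elim by simp
        hence hW: "sqhalf x ^ (n + k) = of_real ((x / 2) ^ k * (1 / (x / 2) ^ d)) * of_real ((x / 2) ^ j)"
          unfolding sqhalf_def of_real_power[symmetric] of_real_mult[symmetric] by simp
        have "T n k x = Ihat_coeff \<mu> n * (\<sigma> ^ k / fact k) * G_coeff ?s n k j *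
            (of_real ((x / 2) ^ k * (1 / (x / 2) ^ d)) * F (of_real \<nu> / 2 + of_nat k) (sqhalf x) / of_real (D x))"
          unfolding T_def of_real_mult[of "D x"] hW using elim by (intro cancel_frac) auto
        hence "T n k x = ?A * of_real (1 / (x / 2) ^ d) * r k x"
          unfolding r_def by (simp add: mult_ac)
        thus ?case using 3 by simp
      qed
      ultimately show ?thesis unfolding mult_1_right by (rule bigo_cong_ev)
    qed
  qed
  have "(\<lambda>x. \<Sum>n\<le>j. \<Sum>k\<le>j. T n k x - (if 2 * n + k = j then Ihat_coeff \<mu> n * (\<sigma> ^ k / fact k) * 2 ^ k else 0)) \<in> O[at_top](\<lambda>x. of_real (1 / x))"
    by (intro big_sum_in_bigo T)
  also have "(\<lambda>x. \<Sum>n\<le>j. \<Sum>k\<le>j. T n k x - (if 2 * n + k = j then Ihat_coeff \<mu> n * (\<sigma> ^ k / fact k) * 2 ^ k else 0)) =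
      (\<lambda>x. Lambda_sum \<sigma> F \<mu> \<nu> j x / of_real (D x * (x / 2) ^ j) - leading_const \<sigma> \<mu> j)"
    unfolding Lambda_sum_def G_coeff_sum_def leading_const_def T_def sum_subtractf sum_divide_distrib ..
  finally show ?thesis .
qed

lemma bigo_of_real:
  fixes f g :: "real \<Rightarrow> real"
  assumes "f \<in> O[at_top](g)"
  shows "(\<lambda>x. complex_of_real (f x)) \<in> O[at_top](\<lambda>x. of_real (g x))"
  using assms by (elim landau_o.bigE, intro bigoI) (auto simp: norm_of_real)

lemma Lambda_sum_Khat_asymp_inf:
  "(\<lambda>x. Lambda_sum \<sigma> Khat \<mu> \<nu> j x / of_real ((x / 2) powr (- \<nu> / 2) * macdonald (1 / 2) x * (x / 2) ^ j) - leading_const \<sigma> \<mu> j)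
     \<in> O[at_top](\<lambda>x. of_real (1 / x))"
proof (rule Lambda_sum_asymp_inf)
  fix k :: nat
  have "eventually (\<lambda>x. of_real (K_norm (\<nu> / 2 + real k) x - 1) =
     of_real ((x / 2) ^ k) * Khat (of_real \<nu> / 2 + of_nat k) (sqhalf x) / of_real ((x / 2) powr (- \<nu> / 2) * macdonald (1 / 2) x) - 1) at_top"
    using eventually_gt_at_top[of 0]
  proof eventually_elim
    case (elim x)
    have p: "(x / 2) powr (- \<nu> / 2) = inverse ((x / 2) powr (\<nu> / 2))"
      using powr_minus[of "x / 2" "\<nu> / 2"] by simp
    have K: "Khat (of_real \<nu> / 2 + of_nat k) (sqhalf x) = of_real (Khat_real (\<nu> / 2 + real k) ((x / 2)\<^sup>2))"
      using Khat_of_real[of "\<nu> / 2 + real k" "(x / 2)\<^sup>2"] by (simp add: sqhalf_def)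
    have "macdonald (\<nu> / 2 + real k) x = (x / 2) powr (\<nu> / 2) * (x / 2) ^ k * Khat_real (\<nu> / 2 + real k) ((x / 2)\<^sup>2)"
      using elim by (simp add: macdonald_def powr_add powr_realpow)
    hence "K_norm (\<nu> / 2 + real k) x = (x / 2) ^ k * Khat_real (\<nu> / 2 + real k) ((x / 2)\<^sup>2) / ((x / 2) powr (- \<nu> / 2) * macdonald (1 / 2) x)"
      unfolding p by (simp only: divide_inverse inverse_mult_distrib inverse_inverse_eq mult_ac)
    thus ?case unfolding K by simp
  qed
  from bigo_cong_ev[OF bigo_of_real[OF K_norm_asymp[of "\<nu> / 2 + real k"]] this]
  show "(\<lambda>x. of_real ((x / 2) ^ k) * Khat (of_real \<nu> / 2 + of_nat k) (sqhalf x) / of_real ((x / 2) powr (- \<nu> / 2) * macdonald (1 / 2) x) - 1)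
      \<in> O[at_top](\<lambda>x. of_real (1 / x))" .
qed

lemma Lambda_sum_Ihat_asymp_inf:
  "(\<lambda>x. Lambda_sum \<sigma> Ihat \<mu> \<nu> j x / of_real ((x / 2) powr (- \<nu> / 2) / (2 * x * macdonald (1 / 2) x) * (x / 2) ^ j) - leading_const \<sigma> \<mu> j)
     \<in> O[at_top](\<lambda>x. of_real (1 / x))"
proof (rule Lambda_sum_asymp_inf)
  fix k :: nat
  have "eventually (\<lambda>x. of_real (I_norm (\<nu> / 2 + real k) x - 1) =
     of_real ((x / 2) ^ k) * Ihat (of_real \<nu> / 2 + of_nat k) (sqhalf x) / of_real ((x / 2) powr (- \<nu> / 2) / (2 * x * macdonald (1 / 2) x)) - 1) at_top"
    using eventually_gt_at_top[of 0]
  proof eventually_elim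
    case (elim x)
    have p: "(x / 2) powr (- \<nu> / 2) = inverse ((x / 2) powr (\<nu> / 2))"
      using powr_minus[of "x / 2" "\<nu> / 2"] by simp
    have K: "Ihat (of_real \<nu> / 2 + of_nat k) (sqhalf x) = of_real (Ihat_real (\<nu> / 2 + real k) ((x / 2)\<^sup>2))"
      using Ihat_of_real[of "\<nu> / 2 + real k" "(x / 2)\<^sup>2"] by (simp add: sqhalf_def)
    have "modified_bessel (\<nu> / 2 + real k) x = (x / 2) powr (\<nu> / 2) * (x / 2) ^ k * Ihat_real (\<nu> / 2 + real k) ((x / 2)\<^sup>2)"
      using elim by (simp add: modified_bessel_def powr_add powr_realpow)
    hence "I_norm (\<nu> / 2 + real k) x = (x / 2) ^ k * Ihat_real (\<nu> / 2 + real k) ((x / 2)\<^sup>2) / ((x / 2) powr (- \<nu> / 2) / (2 * x * macdonald (1 / 2) x))"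
      unfolding p by (simp only: divide_inverse inverse_mult_distrib inverse_inverse_eq mult_ac)
    thus ?case unfolding K by simp
  qed
  from bigo_cong_ev[OF bigo_of_real[OF I_norm_asymp[of "\<nu> / 2 + real k"]] this]
  show "(\<lambda>x. of_real ((x / 2) ^ k) * Ihat (of_real \<nu> / 2 + of_nat k) (sqhalf x) / of_real ((x / 2) powr (- \<nu> / 2) / (2 * x * macdonald (1 / 2) x)) - 1)
      \<in> O[at_top](\<lambda>x. of_real (1 / x))" .
qed

lemma scale_split:
  fixes x :: real
  assumes "x > 0"
  shows "x powr (real j - (\<nu> + 1) / 2) = x ^ j * x powr (- \<nu> / 2) * x powr (- 1 / 2)"
    and "(x / 2) powr (- \<nu> / 2) = x powr (- \<nu> / 2) * 2 powr (\<nu> / 2)"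
proof -
  have "real j - (\<nu> + 1) / 2 = real j + (- \<nu> / 2) + (- 1 / 2)" by (simp add: field_simps)
  hence "x powr (real j - (\<nu> + 1) / 2) = x powr (real j + (- \<nu> / 2) + (- 1 / 2))" by (simp only:)
  thus "x powr (real j - (\<nu> + 1) / 2) = x ^ j * x powr (- \<nu> / 2) * x powr (- 1 / 2)"
    unfolding powr_add powr_realpow[OF assms] .
  have "(2::real) powr (- \<nu> / 2) = 1 / 2 powr (\<nu> / 2)"
    using powr_minus_divide[of 2 "\<nu> / 2"] by simp
  thus "(x / 2) powr (- \<nu> / 2) = x powr (- \<nu> / 2) * 2 powr (\<nu> / 2)"
    using assms powr_divide[of x 2 "- \<nu> / 2"] by (simp only:) simp
qed

lemma K_scale:
  assumes "x > 0"
  shows "(x / 2) powr (- \<nu> / 2) * macdonald (1 / 2) x * (x / 2) ^ j =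
     2 powr (\<nu> / 2) * sqrt (pi / 2) / 2 ^ j * (x powr (real j - (\<nu> + 1) / 2) * exp (- x))"
  unfolding scale_split[OF assms] macdonald_half[OF assms] power_divide
  by (simp only: times_divide_eq_left times_divide_eq_right mult_ac)

text \<open>The auxiliary identity \<open>alg\<close> rests on x (x^(-1/2))^2 = 1, which turns the
  factor 1 / (x x^(-1/2)) into x^(-1/2).\<close>

lemma I_scale:
  assumes "x > 0"
  shows "(x / 2) powr (- \<nu> / 2) / (2 * x * macdonald (1 / 2) x) * (x / 2) ^ j =
     2 powr (\<nu> / 2) / (2 * sqrt (pi / 2) * 2 ^ j) * (x powr (real j - (\<nu> + 1) / 2) * exp x)"
proof -
  have alg: "p * t / (2 * y * (q * (a * inverse e))) * (r / b) = t / (2 * q * b) * (r * p * a * e)"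
    if "y * (a * a) = 1" "e \<noteq> 0" "q \<noteq> 0" "b \<noteq> 0" for p t y q a e r b :: real
  proof -
    have "a \<noteq> 0" "y \<noteq> 0" using that by auto
    moreover have "a * (y * a) = 1" using that(1) by (simp add: mult_ac)
    ultimately show ?thesis using that by (simp add: divide_simps)
  qed
  have "x powr (- 1 / 2) * x powr (- 1 / 2) = x powr (- 1 / 2 + - 1 / 2)"
    by (simp only: powr_add)
  also have "\<dots> = 1 / x" using assms by (simp add: powr_minus_divide)
  finally have "x * (x powr (- 1 / 2) * x powr (- 1 / 2)) = 1" using assms by simp
  thus ?thesis
    unfolding scale_split[OF assms] macdonald_half[OF assms] power_divide exp_minus by (rule alg) auto
qed

definition K_const :: "real \<Rightarrow> nat \<Rightarrow> real" where
  "K_const \<nu> j = 2 powr (\<nu> / 2) * sqrt (pi / 2) / 2 ^ j"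

definition I_const :: "real \<Rightarrow> nat \<Rightarrow> real" where
  "I_const \<nu> j = 2 powr (\<nu> / 2) / (2 * sqrt (pi / 2) * 2 ^ j)"

lemma K_const_nonzero: "K_const \<nu> j \<noteq> 0" and I_const_nonzero: "I_const \<nu> j \<noteq> 0"
  by (simp_all add: K_const_def I_const_def)

lemma Lambda_sum_Khat_asymp:
  "(\<lambda>x. Lambda_sum \<sigma> Khat \<mu> \<nu> j x / of_real (K_const \<nu> j * (x powr (real j - (\<nu> + 1) / 2) * exp (- x))) - leading_const \<sigma> \<mu> j)
     \<in> O[at_top](\<lambda>x. of_real (1 / x))"
  by (rule bigo_cong_ev[OF Lambda_sum_Khat_asymp_inf], rule eventually_mono[OF eventually_gt_at_top[of 0]])
     (simp only: K_scale K_const_def)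

lemma Lambda_sum_Ihat_asymp:
  "(\<lambda>x. Lambda_sum \<sigma> Ihat \<mu> \<nu> j x / of_real (I_const \<nu> j * (x powr (real j - (\<nu> + 1) / 2) * exp x)) - leading_const \<sigma> \<mu> j)
     \<in> O[at_top](\<lambda>x. of_real (1 / x))"
  by (rule bigo_cong_ev[OF Lambda_sum_Ihat_asymp_inf], rule eventually_mono[OF eventually_gt_at_top[of 0]])
     (simp only: I_scale I_const_def)

text \<open>The witnesses are C = S C0 and the relative error h = L / (S C0 e) - 1, so the product
  form holds for every x > 0 and not only eventually.\<close>

lemma asymp_form:
  fixes L :: "real \<Rightarrow> complex" and e :: "real \<Rightarrow> real"
  assumes L: "(\<lambda>x. L x / of_real (C0 * e x) - S) \<in> O[at_top](\<lambda>x. of_real (1 / x))" and "S \<noteq> 0"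
    and "C0 \<noteq> 0" "\<And>x. x > 0 \<Longrightarrow> e x \<noteq> 0" "\<And>x. x > 0 \<Longrightarrow> L' x = L x"
  shows "\<exists>C h. C \<noteq> 0 \<and> h \<in> O[at_top](\<lambda>x. of_real (1 / x)) \<and> (\<forall>x>0. L' x = C * of_real (e x) * (1 + h x))"
proof (intro exI conjI allI impI)
  show "S * of_real C0 \<noteq> 0" using assms by simp
  show "(\<lambda>x. 1 / S * (L x / of_real (C0 * e x) - S)) \<in> O[at_top](\<lambda>x. of_real (1 / x))"
    by (rule bigo_cmult[OF L])
  fix x :: real assume "x > 0"
  hence "complex_of_real (C0 * e x) \<noteq> 0" "L' x = L x" using assms by auto
  thus "L' x = S * of_real C0 * of_real (e x) * (1 + 1 / S * (L x / of_real (C0 * e x) - S))"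
    using \<open>S \<noteq> 0\<close> by (simp add: field_simps)
qed

lemma asymp_bigo:
  fixes L :: "real \<Rightarrow> complex" and e :: "real \<Rightarrow> real"
  assumes L: "(\<lambda>x. L x / of_real (C0 * e x) - S) \<in> O[at_top](\<lambda>x. of_real (1 / x))"
    and "C0 \<noteq> 0" "\<And>x. x > 0 \<Longrightarrow> e x \<noteq> 0"
  shows "L \<in> O[at_top](\<lambda>x. of_real (e x))"
proof -
  have "(\<lambda>x::real. 1 / x) \<in> O[at_top](\<lambda>_. 1)" by real_asymp
  hence "(\<lambda>x. complex_of_real (1 / x)) \<in> O[at_top](\<lambda>_. of_real 1)" by (rule bigo_of_real)
  with L have "(\<lambda>x. L x / of_real (C0 * e x) - S) \<in> O[at_top](\<lambda>_. of_real 1)"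
    by (rule landau_o.big_trans)
  hence "(\<lambda>x. (L x / of_real (C0 * e x) - S) + S) \<in> O[at_top](\<lambda>_. of_real 1)"
    by (rule sum_in_bigo(1)) simp
  hence "(\<lambda>x. of_real C0 * ((L x / of_real (C0 * e x) - S) + S)) \<in> O[at_top](\<lambda>_. of_real 1)"
    by (rule bigo_cmult)
  hence "(\<lambda>x. of_real C0 * ((L x / of_real (C0 * e x) - S) + S) * of_real (e x)) \<in> O[at_top](\<lambda>x. of_real 1 * of_real (e x))"
    by (rule landau_o.big.mult) simp
  moreover have "eventually (\<lambda>x. of_real C0 * ((L x / of_real (C0 * e x) - S) + S) * of_real (e x) = L x) at_top"
    using eventually_gt_at_top[of 0] by eventually_elim (use assms in simp)
  ultimately show ?thesis unfolding of_real_1 mult_1_left by (rule bigo_cong_ev)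
qed

lemma Lambda_sum_Khat_bigo:
  "Lambda_sum \<sigma> Khat \<mu> \<nu> j \<in> O[at_top](\<lambda>x. of_real (x powr (real j - (\<nu> + 1) / 2) * exp (- x)))"
  using Lambda_sum_Khat_asymp K_const_nonzero by (rule asymp_bigo) simp

lemma Lambda_sum_Ihat_bigo:
  "Lambda_sum \<sigma> Ihat \<mu> \<nu> j \<in> O[at_top](\<lambda>x. of_real (x powr (real j - (\<nu> + 1) / 2) * exp x))"
  using Lambda_sum_Ihat_asymp I_const_nonzero by (rule asymp_bigo) simp

section \<open>Combining \<mu> = m and \<mu> = -m, and the final assembly\<close>

text \<open>The factor (x/2)^(-m) brings the exponent j + m of the part with \<mu> = -m down to j,
  the exponent of the part with \<mu> = m.\<close>

lemma Lambda_odd_bigo: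
  assumes L: "\<And>\<mu> j. Lambda_sum \<sigma> F \<mu> \<nu> j \<in> O[at_top](\<lambda>x. of_real (x powr (real j - b) * e x))"
    and j: "j \<ge> - int m"
  shows "Lambda_odd \<sigma> F m \<nu> j \<in> O[at_top](\<lambda>x. of_real (x powr (real_of_int j - b) * e x))"
proof -
  let ?g = "\<lambda>x. complex_of_real (x powr (real_of_int j - b) * e x)"
  have "(\<lambda>x. (x / 2) powr (- real m)) \<in> O[at_top](\<lambda>x. x powr (- real m))" by real_asymp
  from landau_o.big.mult[OF bigo_of_real[OF this] L[of "- of_nat m" "nat (j + int m)"]]
  have "(\<lambda>x. of_real ((x / 2) powr (- real m)) * Lambda_sum \<sigma> F (- of_nat m) \<nu> (nat (j + int m)) x) \<in>
     O[at_top](\<lambda>x. of_real (x powr (- real m)) * of_real (x powr (real (nat (j + int m)) - b) * e x))" .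
  moreover have ev: "eventually (\<lambda>x. of_real (x powr (- real m)) * of_real (x powr (real (nat (j + int m)) - b) * e x) = ?g x) at_top"
    using eventually_gt_at_top[of 0]
  proof eventually_elim
    case (elim x)
    have "x powr (real_of_int j - b) = x powr (- real m + (real (nat (j + int m)) - b))"
      using j by simp
    also have "\<dots> = x powr (- real m) * x powr (real (nat (j + int m)) - b)"
      by (rule powr_add)
    finally show ?case by simp
  qed
  ultimately have 1: "(\<lambda>x. of_real ((x / 2) powr (- real m)) * Lambda_sum \<sigma> F (- of_nat m) \<nu> (nat (j + int m)) x) \<in> O[at_top](?g)"
    by (simp only: landau_o.big.cong[OF ev])
  have 2: "(\<lambda>x. if j < 0 then 0 else Lambda_sum \<sigma> F (of_nat m) \<nu> (nat j) x) \<in> O[at_top](?g)"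
  proof (cases "j < 0")
    case False
    thus ?thesis using L[of "of_nat m" "nat j"] by simp
  qed auto
  show ?thesis
    unfolding Lambda_odd_def[abs_def] by (intro bigo_cmult sum_in_bigo(2) 1 2)
qed

text \<open>Relative to x^(-m) T the part with \<mu> = m carries an extra x^m and disappears. The
  factor 2^m comes from (x/2)^(-m).\<close>

lemma Lambda_odd_lim_0:
  assumes L: "\<And>\<mu> j. ((\<lambda>x. Lambda_sum \<sigma> F \<mu> \<nu> j x / T x) \<longlongrightarrow> P \<mu> j) (at_right 0)" and "m > 0"
  shows "((\<lambda>x. Lambda_odd \<sigma> F m \<nu> j x / (of_real (x powr (- real m)) * T x)) \<longlongrightarrow> 
     of_real pi / 2 / sin (of_real pi * (of_nat m / 2)) * (2 ^ m * P (- of_nat m) (nat (j + int m)))) (at_right 0)"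
proof -
  let ?c = "of_real pi / 2 / sin (of_real pi * (of_nat m / 2)) :: complex"
  let ?B = "\<lambda>x. if j < 0 then 0 else Lambda_sum \<sigma> F (of_nat m) \<nu> (nat j) x / T x"
  have 1: "(?B \<longlongrightarrow> (if j < 0 then 0 else P (of_nat m) (nat j))) (at_right 0)"
    using L by (cases "j < 0") auto
  have "((\<lambda>x. of_real (x ^ m) :: complex) \<longlongrightarrow> of_real (0 ^ m)) (at_right 0)"
    by (intro tendsto_intros)
  hence 2: "((\<lambda>x. of_real (x ^ m) :: complex) \<longlongrightarrow> 0) (at_right 0)"
    using \<open>m > 0\<close> by (simp add: power_0_left)
  have "((\<lambda>x. ?c * (2 ^ m * (Lambda_sum \<sigma> F (- of_nat m) \<nu> (nat (j + int m)) x / T x) - of_real (x ^ m) * ?B x)) \<longlongrightarrow>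
     ?c * (2 ^ m * P (- of_nat m) (nat (j + int m)) - 0 * (if j < 0 then 0 else P (of_nat m) (nat j)))) (at_right 0)"
    by (intro tendsto_mult tendsto_diff tendsto_const L 1 2)
  moreover have "eventually (\<lambda>x. ?c * (2 ^ m * (Lambda_sum \<sigma> F (- of_nat m) \<nu> (nat (j + int m)) x / T x) - of_real (x ^ m) * ?B x) =
     Lambda_odd \<sigma> F m \<nu> j x / (of_real (x powr (- real m)) * T x)) (at_right 0)"
  proof -
    have "eventually (\<lambda>x::real. x > 0) (at_right 0)" by (simp add: eventually_at_filter)
    thus ?thesis
    proof eventually_elim
      case (elim x)
      have p: "(x / 2) powr (- real m) = 2 ^ m / x ^ m" "x powr (- real m) = 1 / x ^ m"
        using elim by (simp_all add: powr_minus powr_realpow power_divide divide_simps)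
      have x: "complex_of_real (x ^ m) \<noteq> 0" using elim by simp
      have B: "?B x = (if j < 0 then 0 else Lambda_sum \<sigma> F (of_nat m) \<nu> (nat j) x) / T x" by simp
      have alg: "c * (q * (l / t) - y * (b / t)) = c * (q / y * l - b) / (1 / y * t)"
        if "y \<noteq> 0" for c q l t y b :: complex
        using that by (cases "t = 0") (simp_all add: field_simps)
      show ?case unfolding Lambda_odd_def p B of_real_divide of_real_1
        using alg[OF x] by simp
    qed
  qed
  ultimately show ?thesis by (simp add: tendsto_cong)
qed

text \<open>By reflection 1 / Gamma (1 - m/2) = sin (pi m/2) / pi * Gamma (m/2). This cancels the
  sine from the definition of K and leaves 2^(m-1) Gamma (m/2).\<close>

lemma reflection_half:
  assumes "odd m"
  shows "of_real pi / 2 / sin (of_real pi * (of_nat m / 2)) * (2 ^ m * (a * rGamma ((- of_nat m + 2) / 2) / b * c)) =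
     2 powr (of_nat m - 1) * Gamma (of_nat m / 2) * a / b * (c :: complex)"
proof -
  let ?z = "of_nat m / 2 :: complex"
  have m: "m > 0" using assms by (cases m) auto
  have G: "Gamma ?z \<noteq> 0" 
    using half_odd_not_Ints[OF assms] by (auto simp: Gamma_eq_zero_iff dest: nonpos_Ints_Int)
  have sin: "sin (of_real pi * ?z) \<noteq> 0"
  proof
    assume "sin (of_real pi * ?z) = 0"
    then obtain n :: int where "of_real pi * ?z = of_real (n * pi)" by (auto simp only: sin_eq_0)
    hence "?z = of_int n" by simp
    thus False using half_odd_not_Ints[OF assms] by (metis Ints_of_int)
  qed
  have "rGamma ?z * rGamma (1 - ?z) = sin (of_real pi * ?z) / of_real pi"
    by (rule rGamma_reflection_complex)
  moreover have "rGamma (1 - ?z) = Gamma ?z * (rGamma ?z * rGamma (1 - ?z))"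
    using G by (simp add: rGamma_inverse_Gamma[of ?z])
  ultimately have 1: "rGamma (1 - ?z) = sin (of_real pi * ?z) / of_real pi * Gamma ?z"
    by (simp only: mult.commute)
  have 2: "(- of_nat m + 2) / 2 = 1 - ?z" by (simp add: field_simps)
  have 3: "(2::complex) powr (of_nat m - 1) = 2 ^ m / 2"
    by (simp add: powr_diff powr_nat')
  have "p / 2 / s * (t * (a * (s / p * g) / b * c)) = t / 2 * g * a / b * c"
    if "p \<noteq> 0" "s \<noteq> 0" for p s t g :: complex
    using that by (simp add: field_simps)
  from this[OF _ sin] show ?thesis unfolding 1 2 3 by simp
qed

text \<open>Here f is the explicit sum and f' the coefficient as defined, which agree for small x >
  0; h is the main term in the shape of the theorem.\<close>

lemma smalloI_lim:
  fixes f g :: "real \<Rightarrow> complex"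
  assumes "((\<lambda>x. f x / g x) \<longlongrightarrow> A) F" "eventually (\<lambda>x. g x \<noteq> 0 \<and> f' x = f x \<and> h x = A * g x) F"
  shows "(\<lambda>x. f' x - h x) \<in> o[F](g)"
proof (rule smalloI_tendsto)
  have "((\<lambda>x. f x / g x - A) \<longlongrightarrow> 0) F"
    using assms(1) by (simp add: LIM_zero)
  moreover have "eventually (\<lambda>x. f x / g x - A = (f' x - h x) / g x) F"
    using assms(2) by eventually_elim (auto simp: diff_divide_distrib)
  ultimately show "((\<lambda>x. (f' x - h x) / g x) \<longlongrightarrow> 0) F"
    by (simp add: tendsto_cong)
  show "eventually (\<lambda>x. g x \<noteq> 0) F"
    using assms(2) by eventually_elim auto
qed

lemma eventually_pos_at_right_0: "eventually (\<lambda>x::real. 0 < x \<and> x < 1) (at_right 0)"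
  using eventually_at_right_real[of 0 1] by simp

theorem theorem4p1:
  fixes \<mu> :: complex and \<nu> :: real
  assumes hmu: "\<forall>k::nat. k \<ge> 1 \<longrightarrow> \<mu> \<noteq> - of_nat k"
  shows
  "(\<forall>j::int. j \<ge> 0 \<longrightarrow>
     (let A1 = pochhammer ((\<mu> + of_real \<nu> + 2) / 2) (nat j) * rGamma ((\<mu> + 2) / 2)
                 * rGamma ((of_real \<nu> + 2) / 2) / fact (nat j);
          A2 = pochhammer ((\<mu> - of_real \<bar>\<nu>\<bar> + 2) / 2) (nat j) * rGamma ((\<mu> + 2) / 2)
                 / fact (nat j)
      in
      \<comment> \<open>(1), i = 1\<close>
      (\<lambda>x. Lambda 1 \<mu> \<nu> j x - A1) \<in> o[at_right 0](\<lambda>x. 1)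
      \<comment> \<open>(1), i = 2\<close>
    \<and> (\<nu> > 0 \<longrightarrow>
         (\<lambda>x. Lambda 2 \<mu> \<nu> j x - A2 * (2 powr (of_real \<nu> - 1) * Gamma (of_real \<nu> / 2)
                 * of_real (x powr (- \<nu>))))
           \<in> o[at_right 0](\<lambda>x. of_real (x powr (- \<nu>))))
    \<and> (\<nu> = 0 \<longrightarrow>
         (\<lambda>x. Lambda 2 \<mu> \<nu> j x - A2 * (- of_real (ln (x / 2))))
           \<in> o[at_right 0](\<lambda>x. of_real (ln (x / 2))))
    \<and> (\<nu> < 0 \<longrightarrow>
         (\<lambda>x. Lambda 2 \<mu> \<nu> j x - A2 * (1 / 2 * Gamma (- of_real \<nu> / 2)))
           \<in> o[at_right 0](\<lambda>x. 1))
      \<comment> \<open>(2), i = 1, 2\<close>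
    \<and> (\<exists>(C::complex) (h::real \<Rightarrow> complex). C \<noteq> 0 \<and> h \<in> O[at_top](\<lambda>x. of_real (1 / x)) \<and>
         (\<forall>x>0. Lambda 1 \<mu> \<nu> j x
            = C * of_real (x powr (real_of_int j - (\<nu> + 1) / 2) * exp x) * (1 + h x)))
    \<and> (\<exists>(C::complex) (h::real \<Rightarrow> complex). C \<noteq> 0 \<and> h \<in> O[at_top](\<lambda>x. of_real (1 / x)) \<and>
         (\<forall>x>0. Lambda 2 \<mu> \<nu> j x
            = C * of_real (x powr (real_of_int j - (\<nu> + 1) / 2) * exp (- x)) * (1 + h x)))))
 \<and> (\<forall>m::nat. odd m \<longrightarrow> \<mu> = of_nat m \<longrightarrow>
    (\<forall>j::int. j \<ge> - int m \<longrightarrow>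
     (let A3 = 2 powr (of_nat m - 1) * Gamma (of_nat m / 2)
                 * pochhammer ((- of_nat m + of_real \<nu> + 2) / 2) (nat (j + int m))
                 * rGamma ((of_real \<nu> + 2) / 2) / fact (nat (j + int m));
          A4 = Gamma (of_nat m / 2)
                 * pochhammer ((- of_nat m - of_real \<bar>\<nu>\<bar> + 2) / 2) (nat (j + int m))
                 / fact (nat (j + int m))
      in
      \<comment> \<open>(1), i = 3\<close>
      (\<lambda>x. Lambda 3 \<mu> \<nu> j x - A3 * of_real (x powr (- real m)))
         \<in> o[at_right 0](\<lambda>x. of_real (x powr (- real m)))
      \<comment> \<open>(1), i = 4\<close>
    \<and> (\<nu> > 0 \<longrightarrow>
         (\<lambda>x. Lambda 4 \<mu> \<nu> j x - A4 * (2 powr (of_nat m + of_real \<nu> - 2) * Gamma (of_real \<nu> / 2)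
                 * of_real (x powr (- real m - \<nu>))))
           \<in> o[at_right 0](\<lambda>x. of_real (x powr (- real m - \<nu>))))
    \<and> (\<nu> = 0 \<longrightarrow>
         (\<lambda>x. Lambda 4 \<mu> \<nu> j x - A4 * (- (2 powr (of_nat m - 1))
                 * of_real (x powr (- real m) * ln (x / 2))))
           \<in> o[at_right 0](\<lambda>x. of_real (x powr (- real m) * ln (x / 2))))
    \<and> (\<nu> < 0 \<longrightarrow>
         (\<lambda>x. Lambda 4 \<mu> \<nu> j x - A4 * (2 powr (of_nat m - 2) * Gamma (- of_real \<nu> / 2)
                 * of_real (x powr (- real m))))
           \<in> o[at_right 0](\<lambda>x. of_real (x powr (- real m))))
      \<comment> \<open>(2), i = 3, 4\<close>
    \<and> Lambda 3 \<mu> \<nu> j \<in> O[at_top](\<lambda>x. of_real (x powr (real_of_int j - (\<nu> + 1) / 2) * exp x))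
    \<and> Lambda 4 \<mu> \<nu> j \<in> O[at_top](\<lambda>x. of_real (x powr (real_of_int j - (\<nu> + 1) / 2) * exp (- x))))))"
proof (intro conjI allI impI)
  fix j :: int assume j: "j \<ge> 0"
  let ?A2 = "pochhammer ((\<mu> - of_real \<bar>\<nu>\<bar> + 2) / 2) (nat j) * rGamma ((\<mu> + 2) / 2) / fact (nat j)"
  have rj: "real_of_int j = real (nat j)" using j by simp
  show "let A1 = pochhammer ((\<mu> + of_real \<nu> + 2) / 2) (nat j) * rGamma ((\<mu> + 2) / 2)
                 * rGamma ((of_real \<nu> + 2) / 2) / fact (nat j);
          A2 = ?A2
      in
      (\<lambda>x. Lambda 1 \<mu> \<nu> j x - A1) \<in> o[at_right 0](\<lambda>x. 1)
    \<and> (\<nu> > 0 \<longrightarrow>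
         (\<lambda>x. Lambda 2 \<mu> \<nu> j x - A2 * (2 powr (of_real \<nu> - 1) * Gamma (of_real \<nu> / 2)
                 * of_real (x powr (- \<nu>))))
           \<in> o[at_right 0](\<lambda>x. of_real (x powr (- \<nu>))))
    \<and> (\<nu> = 0 \<longrightarrow>
         (\<lambda>x. Lambda 2 \<mu> \<nu> j x - A2 * (- of_real (ln (x / 2))))
           \<in> o[at_right 0](\<lambda>x. of_real (ln (x / 2))))
    \<and> (\<nu> < 0 \<longrightarrow>
         (\<lambda>x. Lambda 2 \<mu> \<nu> j x - A2 * (1 / 2 * Gamma (- of_real \<nu> / 2)))
           \<in> o[at_right 0](\<lambda>x. 1))
    \<and> (\<exists>(C::complex) (h::real \<Rightarrow> complex). C \<noteq> 0 \<and> h \<in> O[at_top](\<lambda>x. of_real (1 / x)) \<and>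
         (\<forall>x>0. Lambda 1 \<mu> \<nu> j x
            = C * of_real (x powr (real_of_int j - (\<nu> + 1) / 2) * exp x) * (1 + h x)))
    \<and> (\<exists>(C::complex) (h::real \<Rightarrow> complex). C \<noteq> 0 \<and> h \<in> O[at_top](\<lambda>x. of_real (1 / x)) \<and>
         (\<forall>x>0. Lambda 2 \<mu> \<nu> j x
            = C * of_real (x powr (real_of_int j - (\<nu> + 1) / 2) * exp (- x)) * (1 + h x)))"
    unfolding Let_def
  proof (intro conjI impI)
    show "(\<lambda>x. Lambda 1 \<mu> \<nu> j x - pochhammer ((\<mu> + of_real \<nu> + 2) / 2) (nat j) * rGamma ((\<mu> + 2) / 2)
                 * rGamma ((of_real \<nu> + 2) / 2) / fact (nat j)) \<in> o[at_right 0](\<lambda>x. 1)"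
      by (rule smalloI_lim[OF Lambda_sum_Ihat_lim_0[of 1 \<mu> \<nu> "nat j"]], rule eventually_mono[OF eventually_pos_at_right_0])
         (use j in \<open>simp add: Lambda_1 del: One_nat_def\<close>)
    show "(\<lambda>x. Lambda 2 \<mu> \<nu> j x - ?A2 * (2 powr (of_real \<nu> - 1) * Gamma (of_real \<nu> / 2)
                 * of_real (x powr (- \<nu>)))) \<in> o[at_right 0](\<lambda>x. of_real (x powr (- \<nu>)))" if "\<nu> > 0"
      by (rule smalloI_lim[OF Lambda_sum_Khat_lim_pos[OF that, of \<mu> "nat j"]], rule eventually_mono[OF eventually_pos_at_right_0])
         (use j in \<open>simp add: Lambda_2\<close>)
    show "(\<lambda>x. Lambda 2 \<mu> \<nu> j x - ?A2 * (- of_real (ln (x / 2)))) \<in> o[at_right 0](\<lambda>x. of_real (ln (x / 2)))" if "\<nu> = 0"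
      unfolding that
      by (rule smalloI_lim[OF Lambda_sum_Khat_lim_zero[of "- 1" \<mu> "nat j"]], rule eventually_mono[OF eventually_pos_at_right_0])
         (use j in \<open>simp add: Lambda_2\<close>)
    show "(\<lambda>x. Lambda 2 \<mu> \<nu> j x - ?A2 * (1 / 2 * Gamma (- of_real \<nu> / 2))) \<in> o[at_right 0](\<lambda>x. 1)" if "\<nu> < 0"
      by (rule smalloI_lim[OF Lambda_sum_Khat_lim_neg[OF that, of "- 1" \<mu> "nat j"]], rule eventually_mono[OF eventually_pos_at_right_0])
         (use j in \<open>simp add: Lambda_2\<close>)
    show "\<exists>(C::complex) (h::real \<Rightarrow> complex). C \<noteq> 0 \<and> h \<in> O[at_top](\<lambda>x. of_real (1 / x)) \<and>
         (\<forall>x>0. Lambda 1 \<mu> \<nu> j x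
            = C * of_real (x powr (real_of_int j - (\<nu> + 1) / 2) * exp x) * (1 + h x))"
      unfolding rj
      by (rule asymp_form[OF Lambda_sum_Ihat_asymp leading_const_nonzero[OF hmu] I_const_nonzero])
         (use j in \<open>auto simp: Lambda_1 simp del: One_nat_def\<close>)
    show "\<exists>(C::complex) (h::real \<Rightarrow> complex). C \<noteq> 0 \<and> h \<in> O[at_top](\<lambda>x. of_real (1 / x)) \<and>
         (\<forall>x>0. Lambda 2 \<mu> \<nu> j x
            = C * of_real (x powr (real_of_int j - (\<nu> + 1) / 2) * exp (- x)) * (1 + h x))"
      unfolding rj
      by (rule asymp_form[OF Lambda_sum_Khat_asymp leading_const_nonzero[OF hmu] K_const_nonzero])
         (use j in \<open>auto simp: Lambda_2\<close>)
  qed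
next
  fix m :: nat and j :: int assume m: "odd m" and \<mu>: "\<mu> = of_nat m" and j: "j \<ge> - int m"
  have m0: "m > 0" using m by (cases m) auto
  let ?n = "nat (j + int m)"
  let ?A3 = "2 powr (of_nat m - 1) * Gamma (of_nat m / 2) * pochhammer ((- of_nat m + of_real \<nu> + 2) / 2) ?n
               * rGamma ((of_real \<nu> + 2) / 2) / fact ?n :: complex"
  let ?A4 = "Gamma (of_nat m / 2) * pochhammer ((- of_nat m - of_real \<bar>\<nu>\<bar> + 2) / 2) ?n / fact ?n :: complex"
  \<comment> \<open>The limits at 0 all have the form
    \<open>a \<mu> j * rGamma ((\<mu> + 2) / 2) / b \<mu> j * c\<close>. With a, b, c left free, the
    reflection formula is applied once for all cases of i = 3 and i = 4.\<close>
  note lim = Lambda_odd_lim_0[OF _ m0, where P = "\<lambda>\<mu> j. a \<mu> j * rGamma ((\<mu> + 2) / 2) / b \<mu> j * c" for a b c,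
      unfolded reflection_half[OF m]]
  show "let A3 = ?A3; A4 = ?A4 in
      (\<lambda>x. Lambda 3 \<mu> \<nu> j x - A3 * of_real (x powr (- real m)))
         \<in> o[at_right 0](\<lambda>x. of_real (x powr (- real m)))
    \<and> (\<nu> > 0 \<longrightarrow>
         (\<lambda>x. Lambda 4 \<mu> \<nu> j x - A4 * (2 powr (of_nat m + of_real \<nu> - 2) * Gamma (of_real \<nu> / 2)
                 * of_real (x powr (- real m - \<nu>))))
           \<in> o[at_right 0](\<lambda>x. of_real (x powr (- real m - \<nu>))))
    \<and> (\<nu> = 0 \<longrightarrow>
         (\<lambda>x. Lambda 4 \<mu> \<nu> j x - A4 * (- (2 powr (of_nat m - 1))
                 * of_real (x powr (- real m) * ln (x / 2))))
           \<in> o[at_right 0](\<lambda>x. of_real (x powr (- real m) * ln (x / 2))))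
    \<and> (\<nu> < 0 \<longrightarrow>
         (\<lambda>x. Lambda 4 \<mu> \<nu> j x - A4 * (2 powr (of_nat m - 2) * Gamma (- of_real \<nu> / 2)
                 * of_real (x powr (- real m))))
           \<in> o[at_right 0](\<lambda>x. of_real (x powr (- real m))))
    \<and> Lambda 3 \<mu> \<nu> j \<in> O[at_top](\<lambda>x. of_real (x powr (real_of_int j - (\<nu> + 1) / 2) * exp x))
    \<and> Lambda 4 \<mu> \<nu> j \<in> O[at_top](\<lambda>x. of_real (x powr (real_of_int j - (\<nu> + 1) / 2) * exp (- x)))"
    unfolding Let_def \<mu>
  proof (intro conjI impI)
    show "(\<lambda>x. Lambda 3 (of_nat m) \<nu> j x - ?A3 * of_real (x powr (- real m)))
         \<in> o[at_right 0](\<lambda>x. of_real (x powr (- real m)))"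
    proof (rule smalloI_lim)
      show "((\<lambda>x. Lambda_odd 1 Ihat m \<nu> j x / of_real (x powr (- real m))) \<longlongrightarrow> ?A3) (at_right 0)"
        using lim[OF Lambda_sum_Ihat_lim_0, of 1 \<nu> j] by (simp add: mult_ac)
      show "eventually (\<lambda>x. complex_of_real (x powr (- real m)) \<noteq> 0 \<and> Lambda 3 (of_nat m) \<nu> j x = Lambda_odd 1 Ihat m \<nu> j x \<and>
          ?A3 * of_real (x powr (- real m)) = ?A3 * of_real (x powr (- real m))) (at_right 0)"
        by (rule eventually_mono[OF eventually_pos_at_right_0]) (use m j in \<open>auto simp: Lambda_3\<close>)
    qed
    show "(\<lambda>x. Lambda 4 (of_nat m) \<nu> j x - ?A4 * (2 powr (of_nat m + of_real \<nu> - 2) * Gamma (of_real \<nu> / 2)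
                 * of_real (x powr (- real m - \<nu>))))
           \<in> o[at_right 0](\<lambda>x. of_real (x powr (- real m - \<nu>)))" if \<nu>: "\<nu> > 0"
    proof (rule smalloI_lim)
      \<comment> \<open>The exponent m + \<nu> - 2 collects 2^(m-1) from the reflection formula and
        2^(\<nu>-1) from the limit of K at positive \<nu>.\<close>
      have "(2::complex) powr (of_nat m + of_real \<nu> - 2) = 2 powr (of_nat m - 1) * 2 powr (of_real \<nu> - 1)"
        by (simp add: algebra_simps flip: powr_add)
      thus "((\<lambda>x. Lambda_odd (- 1) Khat m \<nu> j x / of_real (x powr (- real m - \<nu>))) \<longlongrightarrow>
          ?A4 * (2 powr (of_nat m + of_real \<nu> - 2) * Gamma (of_real \<nu> / 2))) (at_right 0)"
        using lim[OF Lambda_sum_Khat_lim_pos[OF \<nu>], of j] powr_add[of _ "- real m" "- \<nu>"] by (simp add: mult_ac)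
      show "eventually (\<lambda>x. complex_of_real (x powr (- real m - \<nu>)) \<noteq> 0 \<and> Lambda 4 (of_nat m) \<nu> j x = Lambda_odd (- 1) Khat m \<nu> j x \<and>
          ?A4 * (2 powr (of_nat m + of_real \<nu> - 2) * Gamma (of_real \<nu> / 2) * of_real (x powr (- real m - \<nu>)))
          = ?A4 * (2 powr (of_nat m + of_real \<nu> - 2) * Gamma (of_real \<nu> / 2)) * of_real (x powr (- real m - \<nu>))) (at_right 0)"
        by (rule eventually_mono[OF eventually_pos_at_right_0]) (use m j in \<open>auto simp: Lambda_4\<close>)
    qed
    show "(\<lambda>x. Lambda 4 (of_nat m) \<nu> j x - ?A4 * (- (2 powr (of_nat m - 1))
                 * of_real (x powr (- real m) * ln (x / 2))))
           \<in> o[at_right 0](\<lambda>x. of_real (x powr (- real m) * ln (x / 2)))" if \<nu>: "\<nu> = 0"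
    proof (rule smalloI_lim)
      show "((\<lambda>x. Lambda_odd (- 1) Khat m \<nu> j x / of_real (x powr (- real m) * ln (x / 2))) \<longlongrightarrow>
          ?A4 * (- (2 powr (of_nat m - 1)))) (at_right 0)"
        unfolding \<nu> using lim[OF Lambda_sum_Khat_lim_zero, of "- 1" j] by (simp add: mult_ac)
      show "eventually (\<lambda>x. complex_of_real (x powr (- real m) * ln (x / 2)) \<noteq> 0 \<and> Lambda 4 (of_nat m) \<nu> j x = Lambda_odd (- 1) Khat m \<nu> j x \<and>
          ?A4 * (- (2 powr (of_nat m - 1)) * of_real (x powr (- real m) * ln (x / 2)))
          = ?A4 * (- (2 powr (of_nat m - 1))) * of_real (x powr (- real m) * ln (x / 2))) (at_right 0)"
        by (rule eventually_mono[OF eventually_pos_at_right_0]) (use m j in \<open>auto simp: Lambda_4\<close>)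
    qed
    show "(\<lambda>x. Lambda 4 (of_nat m) \<nu> j x - ?A4 * (2 powr (of_nat m - 2) * Gamma (- of_real \<nu> / 2)
                 * of_real (x powr (- real m))))
           \<in> o[at_right 0](\<lambda>x. of_real (x powr (- real m)))" if \<nu>: "\<nu> < 0"
    proof (rule smalloI_lim)
      have p: "(2::complex) powr (of_nat m - 2) = 2 powr (of_nat m - 1) * (1 / 2)"
        by (simp add: powr_diff)
      show "((\<lambda>x. Lambda_odd (- 1) Khat m \<nu> j x / of_real (x powr (- real m))) \<longlongrightarrow>
          ?A4 * (2 powr (of_nat m - 2) * Gamma (- of_real \<nu> / 2))) (at_right 0)"
        unfolding p using lim[OF Lambda_sum_Khat_lim_neg[OF \<nu>], of "- 1" j] by (simp add: mult_ac)
      show "eventually (\<lambda>x. complex_of_real (x powr (- real m)) \<noteq> 0 \<and> Lambda 4 (of_nat m) \<nu> j x = Lambda_odd (- 1) Khat m \<nu> j x \<and>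
          ?A4 * (2 powr (of_nat m - 2) * Gamma (- of_real \<nu> / 2) * of_real (x powr (- real m)))
          = ?A4 * (2 powr (of_nat m - 2) * Gamma (- of_real \<nu> / 2)) * of_real (x powr (- real m))) (at_right 0)"
        by (rule eventually_mono[OF eventually_pos_at_right_0]) (use m j in \<open>auto simp: Lambda_4\<close>)
    qed
    show "Lambda 3 (of_nat m) \<nu> j \<in> O[at_top](\<lambda>x. of_real (x powr (real_of_int j - (\<nu> + 1) / 2) * exp x))"
      by (rule bigo_cong_ev[OF Lambda_odd_bigo[OF Lambda_sum_Ihat_bigo j]], rule eventually_mono[OF eventually_gt_at_top[of 0]])
         (use m j in \<open>simp add: Lambda_3\<close>)
    show "Lambda 4 (of_nat m) \<nu> j \<in> O[at_top](\<lambda>x. of_real (x powr (real_of_int j - (\<nu> + 1) / 2) * exp (- x)))"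
      by (rule bigo_cong_ev[OF Lambda_odd_bigo[OF Lambda_sum_Khat_bigo j]], rule eventually_mono[OF eventually_gt_at_top[of 0]])
         (use m j in \<open>simp add: Lambda_4\<close>)
  qed
qed

end
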